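(* Let $N\subset M$ be a subfactor of type II$_1$ with finite index satisfying the standing assumptions (A1)–(A5) listed in the context. Let $\sigma$ and $\tilde\sigma$ be liftings of $\chi_a(M,N)$ to $\mathrm{Aut}(M,N)$. If $\kappa_a^{\sigma}=\kappa_a^{\tilde\sigma}$ holds, then $\tilde\sigma$ is a cocycle perturbation of $\sigma$, i.e. there exist unitaries $u_h\in U(N)$, $h\in\chi_a(M,N)$, with $u_h\sigma_h(u_k)=u_{hk}$ and $\tilde\sigma_h=\mathrm{Ad}\,u_h\,\sigma_h$ for all $h,k\in\chi_a(M,N)$.
   Context: Subfactor notation. $N\subset M$ is an inclusion of type II$_1$ factors with finite Jones index; $N\subset M\subset M_1\subset M_2\subset\cdots$ is the Jones tower ($M_0=M$). $\mathrm{Aut}(M,N)$ is the group of automorphisms $\theta$ of $M$ with $\theta(N)=N$; each such $\theta$ is extended canonically to every $M_k$ by fixing the Jones projections (same symbol for the extension). $U(N)$ is the unitary group of $N$ and $\mathrm{Int}(M,N)=\{\mathrm{Ad}\,u: u\in U(N)\}$. The Loi invariant of $\theta$ is $\Phi(\theta)=\{\theta|_{M'\cap M_k}\}_k$; $\mathrm{Ker}\,\Phi$ is the set of $\theta$ acting trivially on all $M'\cap M_k$. $\theta\in\mathrm{Aut}(M,N)$ is non-strongly outer if for some $k$ there is $0\ne a\in M_k$ with $\theta(x)a=ax$ for all $x\in M$; $\mathrm{Cnt}_r(M,N)$ is the set of non-strongly outer automorphisms. $\chi_a(M,N)=(\mathrm{Cnt}_r(M,N)\cap\mathrm{Ker}\,\Phi)/\mathrm{Int}(M,N)$;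 it is an abelian group. A lifting of $\chi_a(M,N)$ is a homomorphism $\sigma:\chi_a(M,N)\to\mathrm{Aut}(M,N)$, $k\mapsto\sigma_k$, with $[\sigma_k]=k$. Standing assumptions. (A1) $N\subset M$ is extremal. (A2) $N\subset M$ and $M\subset M_1$ have trivial normalizer (every $u\in U(M)$ with $uNu^*=N$ lies in $U(N)$; every $u\in U(M_1)$ with $uMu^*=M$ lies in $U(M)$). (A3) $\mathrm{Ker}\,\Phi=\mathrm{Aut}(M,N)$. (A4) $\chi_a(M,N)$ is finite. (A5) there exists a lifting of $\chi_a(M,N)$ to $\mathrm{Aut}(M,N)$. Cocycle and algebraic $\kappa$ invariant. For $\alpha\in\mathrm{Ker}\,\Phi$ and $\rho\in\mathrm{Cnt}_r(M,N)$ there is a unique unitary $u_{\alpha,\rho}\in U(N)$ such that $\alpha(a)=u_{\alpha,\rho}\,a$ for all $k$ and all $a\in M_k$ with $\rho(x)a=ax$ for all $x\in M$ (known result). For a lifting $\sigma$, $\kappa_a^\sigma(h,k)=u_{\sigma_k,\sigma_h}^*$ for $h,k\in\chi_a(M,N)$; this is a $\mathbf{T}$-valued bicharacter of $\chi_a(M,N)$. *)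

theory Defs
  imports "HOL-Analysis.Analysis" "HOL-Library.Nonpos_Ints" "HOL-Algebra.Bij" "HOL-Algebra.Coset"
begin

section \<open>Complex Hilbert spaces and bounded operators\<close>

class complex_vector = ab_group_add +
  fixes scaleC :: "complex \<Rightarrow> 'a \<Rightarrow> 'a"  (infixr "*\<^sub>C" 75)
  assumes scaleC_add_right: "c *\<^sub>C (x + y) = c *\<^sub>C x + c *\<^sub>C y"
    and scaleC_add_left: "(c + d) *\<^sub>C x = c *\<^sub>C x + d *\<^sub>C x"
    and scaleC_scaleC: "c *\<^sub>C (d *\<^sub>C x) = (c * d) *\<^sub>C x"
    and scaleC_one: "1 *\<^sub>C x = x"

lemma vector_space_scaleC: "vector_space (scaleC :: complex \<Rightarrow> 'a \<Rightarrow> 'a::complex_vector)"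
  by unfold_locales (simp_all add: scaleC_add_right scaleC_add_left scaleC_scaleC scaleC_one)

text \<open>The inner product is conjugate linear in the first and linear in the second argument.\<close>

class chilbert_space = banach + complex_vector +
  fixes cinner :: "'a \<Rightarrow> 'a \<Rightarrow> complex"
  assumes scaleR_scaleC: "r *\<^sub>R x = complex_of_real r *\<^sub>C x"
    and cinner_add_right: "cinner x (y + z) = cinner x y + cinner x z"
    and cinner_scaleC_right: "cinner x (c *\<^sub>C y) = c * cinner x y"
    and cinner_commute: "cinner x y = cnj (cinner y x)"
    and cinner_self: "cinner x x = complex_of_real ((norm x)\<^sup>2)"

definition bounded_clinear :: "('h::chilbert_space \<Rightarrow> 'h) \<Rightarrow> bool" where
  "bounded_clinear f \<longleftrightarrow> bounded_linear f \<and> (\<forall>c x. f (c *\<^sub>C x) = c *\<^sub>C f x)"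

lemma scaleC_zero_right [simp]: "c *\<^sub>C (0::'a::complex_vector) = 0"
  using scaleC_add_right[of c 0 "0::'a"] by simp

lemma scaleC_minus_right: "c *\<^sub>C (- x) = - (c *\<^sub>C (x::'a::complex_vector))"
  using scaleC_add_right[of c "-x" x] by (simp add: eq_neg_iff_add_eq_0)

lemma scaleC_diff_right: "c *\<^sub>C (x - y) = c *\<^sub>C x - c *\<^sub>C (y::'a::complex_vector)"
  using scaleC_add_right[of c x "-y"] by (simp add: scaleC_minus_right)

lemma bounded_clinear_scaleC: "bounded_clinear (\<lambda>x::'h::chilbert_space. c *\<^sub>C x)"
proof -
  have comm: "a *\<^sub>C (b *\<^sub>C x) = b *\<^sub>C (a *\<^sub>C x)" for a b and x :: 'h
    by (simp add: scaleC_scaleC mult.commute)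
  have nrm: "norm (c *\<^sub>C x) = norm x * cmod c" for x :: 'h
  proof -
    have "complex_of_real ((norm (c *\<^sub>C x))\<^sup>2) = c * cinner (c *\<^sub>C x) x"
      using cinner_self[of "c *\<^sub>C x"] by (simp only: cinner_scaleC_right)
    also have "cinner (c *\<^sub>C x) x = cnj (c * cinner x x)"
      by (subst cinner_commute) (simp add: cinner_scaleC_right)
    also have "c * cnj (c * cinner x x) = complex_of_real ((norm x * cmod c)\<^sup>2)"
      by (simp add: cinner_self power_mult_distrib complex_norm_square[unfolded of_real_power] mult_ac)
    finally have "(norm (c *\<^sub>C x))\<^sup>2 = (norm x * cmod c)\<^sup>2" 
      using of_real_eq_iff by blast
    then show ?thesis by (simp add: power2_eq_iff_nonneg)
  qed
  have "bounded_linear (\<lambda>x::'h. c *\<^sub>C x)"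
    by (rule bounded_linear_intro[where K = "cmod c"])
       (simp_all add: scaleC_add_right scaleR_scaleC comm nrm)
  then show ?thesis by (simp add: bounded_clinear_def comm)
qed

typedef (overloaded) 'h bop = "{f :: 'h::chilbert_space \<Rightarrow> 'h. bounded_clinear f}"
  morphisms bop_apply Bop
  by (rule exI[of _ "\<lambda>x. 0"]) (simp add: bounded_clinear_def bounded_linear_zero)

setup_lifting type_definition_bop

instantiation bop :: (chilbert_space) "{ring, monoid_mult, complex_vector}"
begin

lift_definition zero_bop :: "'a bop" is "\<lambda>x. 0"
  by (simp add: bounded_clinear_def bounded_linear_zero)
lift_definition one_bop :: "'a bop" is "\<lambda>x. x"
  by (simp add: bounded_clinear_def bounded_linear_ident)
lift_definition plus_bop :: "'a bop \<Rightarrow> 'a bop \<Rightarrow> 'a bop" is "\<lambda>f g x. f x + g x"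
  by (simp add: bounded_clinear_def bounded_linear_add scaleC_add_right)
lift_definition minus_bop :: "'a bop \<Rightarrow> 'a bop \<Rightarrow> 'a bop" is "\<lambda>f g x. f x - g x"
  by (simp add: bounded_clinear_def bounded_linear_sub scaleC_diff_right)
lift_definition uminus_bop :: "'a bop \<Rightarrow> 'a bop" is "\<lambda>f x. - f x"
  by (simp add: bounded_clinear_def bounded_linear_minus scaleC_minus_right)
lift_definition times_bop :: "'a bop \<Rightarrow> 'a bop \<Rightarrow> 'a bop" is "\<lambda>f g x. f (g x)"
  by (simp add: bounded_clinear_def bounded_linear_compose)
lift_definition scaleC_bop :: "complex \<Rightarrow> 'a bop \<Rightarrow> 'a bop" is "\<lambda>c f x. c *\<^sub>C f x"
  using bounded_clinear_scaleC
  by (fastforce simp add: bounded_clinear_def scaleC_scaleC mult.commute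
      intro: bounded_linear_compose[of "\<lambda>x. _ *\<^sub>C x"])

instance
  by standard (transfer; simp add: fun_eq_iff algebra_simps bounded_clinear_def
      linear_add[OF bounded_linear.linear] scaleC_add_right scaleC_add_left scaleC_scaleC scaleC_one)+

end

definition adj :: "'h::chilbert_space bop \<Rightarrow> 'h bop" where
  "adj T = (THE S. \<forall>x y. cinner (bop_apply S x) y = cinner x (bop_apply T y))"

definition projection :: "'h::chilbert_space bop \<Rightarrow> bool" where
  "projection p \<longleftrightarrow> adj p = p \<and> p * p = p"

section \<open>Von Neumann algebras and \<open>II\<^sub>1\<close> factors\<close>

text \<open>Operators on a closed subspace \<open>K\<close> are encoded as operators \<open>T\<close> on the ambient space with
  \<open>pTp = T\<close>, where \<open>p\<close> is the projection onto \<open>K\<close>. So a von Neumann algebra on \<open>K\<close> has unit \<open>p\<close>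
  and commutants are taken in \<open>pB(H)p\<close>; on the whole space one takes \<open>p = 1\<close>.\<close>

definition commutant :: "'h::chilbert_space bop \<Rightarrow> 'h bop set \<Rightarrow> 'h bop set" where
  "commutant p A = {T. p * T * p = T \<and> (\<forall>x\<in>A. T * x = x * T)}"

definition von_neumann_algebra :: "'h::chilbert_space bop \<Rightarrow> 'h bop set \<Rightarrow> bool" where
  "von_neumann_algebra p A \<longleftrightarrow>
     projection p \<and> adj ` A \<subseteq> A \<and> commutant p (commutant p A) = A"

definition ultraweakly_continuous_on ::
    "'h::chilbert_space bop set \<Rightarrow> ('h bop \<Rightarrow> complex) \<Rightarrow> bool" where
  "ultraweakly_continuous_on A \<tau> \<longleftrightarrow>
     (\<exists>\<xi> \<eta>. summable (\<lambda>n::nat. (norm (\<xi> n))\<^sup>2) \<and> summable (\<lambda>n. (norm (\<eta> n))\<^sup>2) \<and>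
        (\<forall>x\<in>A. (\<lambda>n. cinner (\<xi> n) (bop_apply x (\<eta> n))) sums \<tau> x))"

definition normal_trace ::
    "'h::chilbert_space bop \<Rightarrow> 'h bop set \<Rightarrow> ('h bop \<Rightarrow> complex) \<Rightarrow> bool" where
  "normal_trace p A \<tau> \<longleftrightarrow>
     (\<forall>x\<in>A. \<forall>y\<in>A. \<tau> (x + y) = \<tau> x + \<tau> y) \<and>
     (\<forall>c. \<forall>x\<in>A. \<tau> (c *\<^sub>C x) = c * \<tau> x) \<and>
     \<tau> p = 1 \<and>
     (\<forall>x\<in>A. \<tau> (adj x * x) \<in> \<real>\<^sub>\<ge>\<^sub>0) \<and>
     (\<forall>x\<in>A. \<tau> (adj x * x) = 0 \<longrightarrow> x = 0) \<and>
     (\<forall>x\<in>A. \<forall>y\<in>A. \<tau> (x * y) = \<tau> (y * x)) \<and>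
     ultraweakly_continuous_on A \<tau>"

definition factor_II1 :: "'h::chilbert_space bop \<Rightarrow> 'h bop set \<Rightarrow> bool" where
  "factor_II1 p A \<longleftrightarrow>
     von_neumann_algebra p A \<and>
     A \<inter> commutant p A = range (\<lambda>c. c *\<^sub>C p) \<and>
     \<not> (\<exists>B. finite B \<and> A \<subseteq> module.span scaleC B) \<and>
     (\<exists>\<tau>. normal_trace p A \<tau>)"

definition unitaries :: "'h::chilbert_space bop set \<Rightarrow> 'h bop set" where
  "unitaries A = {u \<in> A. adj u * u = 1 \<and> u * adj u = 1}"

definition star_iso ::
    "'h::chilbert_space bop set \<Rightarrow> 'h bop set \<Rightarrow> ('h bop \<Rightarrow> 'h bop) \<Rightarrow> bool" where
  "star_iso A B \<phi> \<longleftrightarrow>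
     bij_betw \<phi> A B \<and>
     (\<forall>x\<in>A. \<forall>y\<in>A. \<phi> (x + y) = \<phi> x + \<phi> y) \<and>
     (\<forall>c. \<forall>x\<in>A. \<phi> (c *\<^sub>C x) = c *\<^sub>C \<phi> x) \<and>
     (\<forall>x\<in>A. \<forall>y\<in>A. \<phi> (x * y) = \<phi> x * \<phi> y) \<and>
     (\<forall>x\<in>A. \<phi> (adj x) = adj (\<phi> x))"

section \<open>Index, basic construction and Jones tower\<close>

text \<open>\<open>L\<^sup>2(M, \<tau>)\<close> is realised as a closed subspace of the ambient space, with projection \<open>p\<close>:
  \<open>\<Lambda>\<close> is the canonical map from \<open>M\<close> to \<open>L\<^sup>2(M, \<tau>)\<close> and \<open>\<pi>\<close> is left multiplication. Such a
  realisation is unique up to unitary equivalence. It exists whenever the von Neumann algebra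
  \<open>M\<close> with trace \<open>\<tau>\<close> is infinite dimensional: the \<open>2\<close>-norm topology and the strong topology
  agree on the unit ball of \<open>M\<close>, so that the Hilbert dimension of \<open>L\<^sup>2(M, \<tau>)\<close> is at most that of
  the ambient space.\<close>

definition L2_realisation ::
    "'h::chilbert_space bop set \<Rightarrow> ('h bop \<Rightarrow> complex) \<Rightarrow> 'h bop \<Rightarrow> ('h bop \<Rightarrow> 'h) \<Rightarrow>
     ('h bop \<Rightarrow> 'h bop) \<Rightarrow> bool" where
  "L2_realisation M \<tau> p \<Lambda> \<pi> \<longleftrightarrow>
     normal_trace 1 M \<tau> \<and>
     (\<forall>x\<in>M. \<forall>y\<in>M. \<Lambda> (x + y) = \<Lambda> x + \<Lambda> y) \<and>
     (\<forall>c. \<forall>x\<in>M. \<Lambda> (c *\<^sub>C x) = c *\<^sub>C \<Lambda> x) \<and>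
     (\<forall>x\<in>M. \<forall>y\<in>M. cinner (\<Lambda> x) (\<Lambda> y) = \<tau> (adj x * y)) \<and>
     projection p \<and> range (bop_apply p) = closure (\<Lambda> ` M) \<and>
     (\<forall>x\<in>M. p * \<pi> x * p = \<pi> x \<and> (\<forall>y\<in>M. bop_apply (\<pi> x) (\<Lambda> y) = \<Lambda> (x * y)))"

definition subfactor_II1 :: "'h::chilbert_space bop set \<Rightarrow> 'h bop set \<Rightarrow> bool" where
  "subfactor_II1 N M \<longleftrightarrow> factor_II1 1 N \<and> factor_II1 1 M \<and> N \<subseteq> M"

text \<open>The Jones index is the coupling constant \<open>dim\<^sub>N L\<^sup>2(M)\<close>, which is by definition finite iff the
  commutant of \<open>N\<close> on \<open>L\<^sup>2(M)\<close> is a finite factor. This commutant is infinite dimensional, as it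
  contains the right action of \<open>M\<close>, so finite means type \<open>II\<^sub>1\<close> here.\<close>

definition finite_index :: "'h::chilbert_space bop set \<Rightarrow> 'h bop set \<Rightarrow> bool" where
  "finite_index N M \<longleftrightarrow>
     (\<exists>\<tau> p \<Lambda> \<pi>. L2_realisation M \<tau> p \<Lambda> \<pi> \<and> factor_II1 p (commutant p (\<pi> ` N)))"

text \<open>Extremality: the traces of \<open>M\<close> and of the commutant of \<open>N\<close> on \<open>L\<^sup>2(M)\<close> agree on the
  relative commutant of \<open>N\<close> in \<open>M\<close>.\<close>

definition extremal :: "'h::chilbert_space bop set \<Rightarrow> 'h bop set \<Rightarrow> bool" where
  "extremal N M \<longleftrightarrow>
     (\<exists>\<tau> p \<Lambda> \<pi> \<tau>'. L2_realisation M \<tau> p \<Lambda> \<pi> \<and> normal_trace p (commutant p (\<pi> ` N)) \<tau>' \<and>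
        (\<forall>x \<in> commutant 1 N \<inter> M. \<tau>' (\<pi> x) = \<tau> x))"

text \<open>As \<open>\<tau>\<close> is faithful, this determines the \<open>\<tau>\<close>-preserving conditional expectation \<open>E\<close> of \<open>M\<close>
  onto \<open>N\<close>; linearity and \<open>N\<close>-bimodularity follow.\<close>

definition conditional_expectation ::
    "('h::chilbert_space bop \<Rightarrow> complex) \<Rightarrow> 'h bop set \<Rightarrow> 'h bop set \<Rightarrow> ('h bop \<Rightarrow> 'h bop) \<Rightarrow> bool"
  where
  "conditional_expectation \<tau> M N E \<longleftrightarrow>
     (\<forall>x\<in>M. E x \<in> N \<and> (\<forall>y\<in>N. \<tau> (E x * y) = \<tau> (x * y)))"

text \<open>\<open>M\<^sub>1\<close>, together with \<open>M\<close> and the element \<open>e\<close> of \<open>M\<^sub>1\<close>, is a copy of the von Neumann algebra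
  on \<open>L\<^sup>2(M)\<close> generated by \<open>M\<close> and the Jones projection \<open>q\<close>, the extension to \<open>L\<^sup>2(M)\<close> of the
  conditional expectation \<open>E\<close> of \<open>M\<close> onto \<open>N\<close>. The copy lives on the ambient space, so that the
  algebras in the tower are honestly nested.\<close>

definition basic_construction ::
    "'h::chilbert_space bop set \<Rightarrow> 'h bop set \<Rightarrow> 'h bop set \<Rightarrow> 'h bop \<Rightarrow> bool" where
  "basic_construction N M M\<^sub>1 e \<longleftrightarrow>
     von_neumann_algebra 1 M\<^sub>1 \<and> M \<subseteq> M\<^sub>1 \<and> e \<in> M\<^sub>1 \<and>
     (\<exists>\<tau> p \<Lambda> \<pi> E q \<phi>.
        L2_realisation M \<tau> p \<Lambda> \<pi> \<and>
        conditional_expectation \<tau> M N E \<and>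
        p * q * p = q \<and> (\<forall>x\<in>M. bop_apply q (\<Lambda> x) = \<Lambda> (E x)) \<and>
        star_iso M\<^sub>1 (commutant p (commutant p (insert q (\<pi> ` M)))) \<phi> \<and>
        (\<forall>x\<in>M. \<phi> x = \<pi> x) \<and> \<phi> e = q)"

text \<open>\<open>e (k + 1)\<close> is the Jones projection in \<open>M\<^sub>k\<^sub>+\<^sub>1\<close>; the value \<open>e 0\<close> is irrelevant.\<close>

definition jones_tower ::
    "'h::chilbert_space bop set \<Rightarrow> 'h bop set \<Rightarrow> (nat \<Rightarrow> 'h bop set) \<Rightarrow> (nat \<Rightarrow> 'h bop) \<Rightarrow> bool" where
  "jones_tower N M Mk e \<longleftrightarrow>
     Mk 0 = M \<and> basic_construction N M (Mk 1) (e 1) \<and>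
     (\<forall>k. basic_construction (Mk k) (Mk (Suc k)) (Mk (Suc (Suc k))) (e (Suc (Suc k))))"

definition trivial_normalizer :: "'h::chilbert_space bop set \<Rightarrow> 'h bop set \<Rightarrow> bool" where
  "trivial_normalizer N M \<longleftrightarrow>
     (\<forall>u \<in> unitaries M. (\<lambda>x. u * x * adj u) ` N = N \<longrightarrow> u \<in> unitaries N)"

section \<open>Automorphisms and the groups built from them\<close>

text \<open>Automorphisms are normalised to be \<open>undefined\<close> off \<open>M\<close>, as in \<^const>\<open>BijGroup\<close>, whose
  multiplication is composition.\<close>

definition Aut :: "'h::chilbert_space bop set \<Rightarrow> 'h bop set \<Rightarrow> ('h bop \<Rightarrow> 'h bop) set" where
  "Aut M N = {\<theta> \<in> extensional M. star_iso M M \<theta> \<and> \<theta> ` N = N}"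

definition AutGroup ::
    "'h::chilbert_space bop set \<Rightarrow> 'h bop set \<Rightarrow> ('h bop \<Rightarrow> 'h bop) monoid" where
  "AutGroup M N = BijGroup M \<lparr>carrier := Aut M N\<rparr>"

definition Inn :: "'h::chilbert_space bop set \<Rightarrow> 'h bop set \<Rightarrow> ('h bop \<Rightarrow> 'h bop) set" where
  "Inn M N = (\<lambda>u. \<lambda>x\<in>M. u * x * adj u) ` unitaries N"

definition tower_ext ::
    "(nat \<Rightarrow> 'h::chilbert_space bop set) \<Rightarrow> (nat \<Rightarrow> 'h bop) \<Rightarrow> ('h bop \<Rightarrow> 'h bop) \<Rightarrow>
     'h bop \<Rightarrow> 'h bop" where
  "tower_ext Mk e \<theta> =
     (THE \<phi>. \<phi> \<in> extensional (\<Union>k. Mk k) \<and>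
        (\<forall>k. star_iso (Mk k) (Mk k) \<phi>) \<and>
        (\<forall>x \<in> Mk 0. \<phi> x = \<theta> x) \<and>
        (\<forall>k. \<phi> (e (Suc k)) = e (Suc k)))"

definition Ker_Loi ::
    "'h::chilbert_space bop set \<Rightarrow> 'h bop set \<Rightarrow> (nat \<Rightarrow> 'h bop set) \<Rightarrow> (nat \<Rightarrow> 'h bop) \<Rightarrow>
     ('h bop \<Rightarrow> 'h bop) set" where
  "Ker_Loi M N Mk e =
     {\<theta> \<in> Aut M N. \<forall>k. \<forall>x \<in> commutant 1 M \<inter> Mk k. tower_ext Mk e \<theta> x = x}"

definition intertwiners ::
    "'h::chilbert_space bop set \<Rightarrow> 'h bop set \<Rightarrow> ('h bop \<Rightarrow> 'h bop) \<Rightarrow> 'h bop set" where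
  "intertwiners M P \<theta> = {a \<in> P. \<forall>x\<in>M. \<theta> x * a = a * x}"

definition Cnt_r ::
    "'h::chilbert_space bop set \<Rightarrow> 'h bop set \<Rightarrow> (nat \<Rightarrow> 'h bop set) \<Rightarrow> ('h bop \<Rightarrow> 'h bop) set" where
  "Cnt_r M N Mk = {\<theta> \<in> Aut M N. \<exists>k. \<exists>a \<in> intertwiners M (Mk k) \<theta>. a \<noteq> 0}"

definition chi_a ::
    "'h::chilbert_space bop set \<Rightarrow> 'h bop set \<Rightarrow> (nat \<Rightarrow> 'h bop set) \<Rightarrow> (nat \<Rightarrow> 'h bop) \<Rightarrow>
     ('h bop \<Rightarrow> 'h bop) set monoid" where
  "chi_a M N Mk e =
     (AutGroup M N \<lparr>carrier := Cnt_r M N Mk \<inter> Ker_Loi M N Mk e\<rparr>) Mod (Inn M N)"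

text \<open>The class of \<open>\<sigma> h\<close> is \<open>h\<close> iff \<open>\<sigma> h\<close> is an element of the coset \<open>h\<close>.\<close>

definition lifting ::
    "'h::chilbert_space bop set \<Rightarrow> 'h bop set \<Rightarrow> (nat \<Rightarrow> 'h bop set) \<Rightarrow> (nat \<Rightarrow> 'h bop) \<Rightarrow>
     (('h bop \<Rightarrow> 'h bop) set \<Rightarrow> 'h bop \<Rightarrow> 'h bop) \<Rightarrow> bool" where
  "lifting M N Mk e \<sigma> \<longleftrightarrow>
     \<sigma> \<in> hom (chi_a M N Mk e) (AutGroup M N) \<and> (\<forall>h \<in> carrier (chi_a M N Mk e). \<sigma> h \<in> h)"

definition intertwining_unitary ::
    "'h::chilbert_space bop set \<Rightarrow> 'h bop set \<Rightarrow> (nat \<Rightarrow> 'h bop set) \<Rightarrow> (nat \<Rightarrow> 'h bop) \<Rightarrow>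
     ('h bop \<Rightarrow> 'h bop) \<Rightarrow> ('h bop \<Rightarrow> 'h bop) \<Rightarrow> 'h bop" where
  "intertwining_unitary M N Mk e \<alpha> \<rho> =
     (THE u. u \<in> unitaries N \<and>
        (\<forall>k. \<forall>a \<in> intertwiners M (Mk k) \<rho>. tower_ext Mk e \<alpha> a = u * a))"

text \<open>Values are operators; the bicharacter is \<open>T\<close>-valued upon identifying \<open>c *\<^sub>C 1\<close> with \<open>c\<close>.\<close>

definition kappa_a ::
    "'h::chilbert_space bop set \<Rightarrow> 'h bop set \<Rightarrow> (nat \<Rightarrow> 'h bop set) \<Rightarrow> (nat \<Rightarrow> 'h bop) \<Rightarrow>
     (('h bop \<Rightarrow> 'h bop) set \<Rightarrow> 'h bop \<Rightarrow> 'h bop) \<Rightarrow>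
     ('h bop \<Rightarrow> 'h bop) set \<Rightarrow> ('h bop \<Rightarrow> 'h bop) set \<Rightarrow> 'h bop" where
  "kappa_a M N Mk e \<sigma> h k = adj (intertwining_unitary M N Mk e (\<sigma> k) (\<sigma> h))"

end

theory Submission
  imports Defs "HOL-Algebra.Multiplicative_Group"
begin

text \<open>
  Two liftings send \<open>h\<close> to the same class modulo \<open>Int(M, N)\<close>, so \<open>\<sigma>'\<^sub>h = Ad w\<^sub>h \<sigma>\<^sub>h\<close> for unitaries \<open>w\<^sub>h\<close> of
  \<open>N\<close>. As \<open>M\<close> is a factor, \<open>w\<^sub>h \<sigma>\<^sub>h(w\<^sub>k) = c(h, k) w\<^sub>h\<^sub>k\<close> with scalars of modulus 1, and \<open>c\<close> is a 2-cocycle of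
  \<open>\<chi>\<^sub>a(M, N)\<close>. If \<open>a\<close> intertwines \<open>\<sigma>\<^sub>h\<close> then \<open>w\<^sub>h a\<close> intertwines \<open>\<sigma>'\<^sub>h\<close>; applying \<open>\<sigma>'\<^sub>k\<close> to it shows that the two
  \<open>\<kappa>\<close> invariants differ by the factor \<open>c(h, k) / c(k, h)\<close> (\<open>equal_kappa_symmetric\<close>). Equal invariants thus
  make \<open>c\<close> symmetric, a symmetric cocycle on a finite abelian group is a coboundary
  (\<open>symmetric_cocycle_is_coboundary\<close>), and rescaling the \<open>w\<^sub>h\<close> gives the required unitaries
  (\<open>cocycle_perturbation\<close>).

  The argument uses that automorphisms extend uniquely to the tower, that the intertwining unitaries
  exist, and that \<open>\<chi>\<^sub>a(M, N)\<close> is an abelian group. These are derived from the definitions, and most of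
  the text is devoted to them.

  The analytic core consists of two facts on von Neumann algebras with a faithful normal trace.
  Isomorphisms are strongly continuous on bounded sets for the 2-norm (\<open>star_iso_normal\<close>). Therefore
  bounded sets are complete for the 2-norm, and an element can be averaged over a group of unitaries
  by minimising the 2-norm (\<open>averaging\<close>). For factors this gives the uniqueness of the trace
  (\<open>star_iso_trace\<close>) and the independence of a factor and its commutant (\<open>trace_independent\<close>).

  For a basic construction \<open>P \<subseteq> Q \<subseteq> R\<close> with Jones projection \<open>e\<close>, averaging over the unitaries of \<open>P\<close>
  identifies the trace of \<open>R\<close> on the corner \<open>e R e\<close> with the vacuum state of \<open>L\<^sup>2(Q)\<close>
  (\<open>trace_vector_state\<close>). An automorphism of \<open>R\<close> preserves the trace, so it is determined by its values
  on \<open>Q\<close> and \<open>e\<close> (\<open>iso_fixing_unique\<close>), and an automorphism of the pair \<open>P \<subseteq> Q\<close> extends by conjugation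
  with its unitary implementation on \<open>L\<^sup>2(Q)\<close> (\<open>iso_extends\<close>). The algebra \<open>R\<close> is again a factor
  (\<open>R_factor\<close>), which starts the next step of the tower.

  The intertwining unitary comes from an element \<open>w\<close> of a higher relative commutant of \<open>M\<close>, a product of
  Jones projections, that implements the conditional expectation of \<open>M\<^sub>k\<close> onto \<open>M\<close>
  (\<open>expectation_implemented\<close>). If \<open>a\<close> in \<open>M\<^sub>k\<close> intertwines \<open>\<rho>\<close>, then \<open>a w w\<^sup>* a\<^sup>*\<close> commutes with \<open>M\<close> and is
  fixed by every \<open>\<alpha>\<close> in the kernel of the Loi invariant; hence \<open>\<alpha>(a)\<close> is in \<open>a M = M a\<close>
  (\<open>intertwiner_moves_in_bimodule\<close>), so \<open>\<alpha>(a) = u a\<close>, and the trivial normalizer of \<open>N\<close> in \<open>M\<close> forces the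
  unitary \<open>u\<close> into \<open>N\<close> (\<open>intertwiner_unitary\<close>). The same \<open>u\<close> shows that \<open>\<chi>\<^sub>a(M, N)\<close> is abelian.
\<close>

abbreviation app_bop :: "'h::chilbert_space bop \<Rightarrow> 'h \<Rightarrow> 'h" (infixr "\<cdot>" 75) where
  "T \<cdot> v \<equiv> bop_apply T v"

section \<open>Complex Hilbert space and operator calculus\<close>

lemma scaleC_zero_left [simp]: "0 *\<^sub>C (x::'a::complex_vector) = 0"
  using scaleC_add_left[of 0 0 x] by simp

lemma scaleC_minus_left: "(- c) *\<^sub>C (x::'a::complex_vector) = - (c *\<^sub>C x)"
  using scaleC_add_left[of c "-c" x] by (simp add: eq_neg_iff_add_eq_0 add.commute)

lemma scaleC_diff_left: "(c - d) *\<^sub>C (x::'a::complex_vector) = c *\<^sub>C x - d *\<^sub>C x"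
  using scaleC_add_left[of c "-d" x] by (simp add: scaleC_minus_left)

declare scaleC_one [simp] scaleC_scaleC [simp]

lemma scaleC_cancel: "c \<noteq> 0 \<Longrightarrow> c *\<^sub>C (x::'a::complex_vector) = c *\<^sub>C y \<Longrightarrow> x = y"
  by (metis left_inverse scaleC_one scaleC_scaleC)

lemma scaleC_eq_0_iff [simp]: "c *\<^sub>C (x::'a::complex_vector) = 0 \<longleftrightarrow> c = 0 \<or> x = 0"
  by (metis scaleC_cancel scaleC_zero_left scaleC_zero_right)

context
  fixes x y z :: "'h::chilbert_space"
begin

lemma cinner_add_left: "cinner (x + y) z = cinner x z + cinner y z"
  by (metis cinner_add_right cinner_commute complex_cnj_add)

lemma cinner_scaleC_left: "cinner (c *\<^sub>C x) y = cnj c * cinner x y"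
  by (metis cinner_scaleC_right cinner_commute complex_cnj_mult)

lemma cinner_zero_right [simp]: "cinner x 0 = 0"
  using cinner_scaleC_right[of x 0 0] by simp

lemma cinner_zero_left [simp]: "cinner 0 x = 0"
  by (metis cinner_commute cinner_zero_right complex_cnj_zero)

lemma cinner_minus_right: "cinner x (- y) = - cinner x y"
  using cinner_scaleC_right[of x "-1" y] by (simp add: scaleC_minus_left)

lemma cinner_minus_left: "cinner (- x) y = - cinner x y"
  using cinner_scaleC_left[of "-1"] by (simp add: scaleC_minus_left)

end

lemma cinner_diff_right: "cinner x (y - z) = cinner x y - cinner (x::'h::chilbert_space) z"
  using cinner_add_right[of x y "-z"] by (simp add: cinner_minus_right)

lemma cinner_diff_left: "cinner (x - y) z = cinner x z - cinner (y::'h::chilbert_space) z"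
  using cinner_add_left[of x "-y" z] by (simp add: cinner_minus_left)

lemmas cinner_linear = cinner_add_left cinner_add_right cinner_diff_left cinner_diff_right
  cinner_minus_left cinner_minus_right cinner_scaleC_left cinner_scaleC_right

lemma Re_cinner_self [simp]: "Re (cinner x x) = (norm (x::'h::chilbert_space))\<^sup>2"
  by (simp add: cinner_self)

lemma cinner_self_eq_0 [simp]: "cinner x x = 0 \<longleftrightarrow> x = (0::'h::chilbert_space)"
  by (simp add: cinner_self)

lemma Re_cinner_commute: "Re (cinner x y) = Re (cinner (y::'h::chilbert_space) x)"
  by (subst cinner_commute) simp

lemma norm_scaleC: "norm (c *\<^sub>C x) = cmod c * norm (x::'h::chilbert_space)"
proof -
  have "cinner (c *\<^sub>C x) (c *\<^sub>C x) = (c * cnj c) * cinner x x"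
    by (simp only: cinner_scaleC_left cinner_scaleC_right mult_ac)
  then have "complex_of_real ((norm (c *\<^sub>C x))\<^sup>2) = complex_of_real ((cmod c * norm x)\<^sup>2)"
    by (simp only: cinner_self complex_norm_square[symmetric] power_mult_distrib of_real_mult)
  then have "(norm (c *\<^sub>C x))\<^sup>2 = (cmod c * norm x)\<^sup>2"
    using of_real_eq_iff by blast
  then show ?thesis by (simp add: power2_eq_iff_nonneg)
qed

lemma cinner_eqI:
  assumes "\<And>z::'h::chilbert_space. cinner z x = cinner z y" shows "x = y"
proof -
  have "cinner (x - y) (x - y) = 0" using assms by (simp only: cinner_diff_right) simp
  then show ?thesis by (simp only: cinner_self_eq_0) simp
qed

text \<open>The discriminant argument behind every Cauchy--Schwarz inequality below: for the inner
  product, for a positive operator and for a trace.\<close>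

lemma cauchy_schwarz_discriminant:
  fixes a c :: real and z :: complex
  assumes q: "\<And>t. 0 \<le> a + 2 * Re (t * z) + (cmod t)\<^sup>2 * c" and c: "0 \<le> c"
  shows "(cmod z)\<^sup>2 \<le> a * c"
proof (cases "c = 0")
  case True
  have "z = 0"
  proof (rule ccontr)
    assume z: "z \<noteq> 0"
    define s where "s = (\<bar>a\<bar> + 1) / (2 * (cmod z)\<^sup>2)"
    have "Re (complex_of_real (- s) * cnj z * z) = - s * (cmod z)\<^sup>2"
      unfolding cmod_power2 by (simp add: algebra_simps power2_eq_square)
    then have "0 \<le> a + 2 * (- s * (cmod z)\<^sup>2)"
      using q[of "complex_of_real (- s) * cnj z"] True by simp
    then show False using z unfolding s_def by simp
  qed
  then show ?thesis using True by simp
next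
  case False
  then have c: "c > 0" using c by simp
  define s where "s = - 1 / c"
  have "Re (complex_of_real s * cnj z * z) = s * (cmod z)\<^sup>2"
    unfolding cmod_power2 by (simp add: algebra_simps power2_eq_square)
  moreover have "(cmod (complex_of_real s * cnj z))\<^sup>2 = s\<^sup>2 * (cmod z)\<^sup>2"
    by (simp add: norm_mult power_mult_distrib)
  ultimately have "0 \<le> a + 2 * (s * (cmod z)\<^sup>2) + s\<^sup>2 * (cmod z)\<^sup>2 * c"
    using q[of "complex_of_real s * cnj z"] by simp
  also have "\<dots> = a - (cmod z)\<^sup>2 / c"
    using c by (simp add: s_def field_simps power2_eq_square)
  finally show ?thesis using c by (simp add: field_simps)
qed

lemma cinner_Cauchy_Schwarz: "cmod (cinner x y) \<le> norm x * norm (y::'h::chilbert_space)"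
proof -
  have "0 \<le> (norm x)\<^sup>2 + 2 * Re (t * cinner x y) + (cmod t)\<^sup>2 * (norm y)\<^sup>2" for t
  proof -
    have "0 \<le> Re (cinner (x + t *\<^sub>C y) (x + t *\<^sub>C y))" by simp
    also have "\<dots> = (norm x)\<^sup>2 + Re (cinner x (t *\<^sub>C y)) + Re (cinner (t *\<^sub>C y) x) + (norm (t *\<^sub>C y))\<^sup>2"
      by (simp only: cinner_add_left cinner_add_right plus_complex.simps Re_cinner_self)
    also have "Re (cinner x (t *\<^sub>C y)) = Re (t * cinner x y)"
      by (simp add: cinner_scaleC_right)
    also have "Re (cinner (t *\<^sub>C y) x) = Re (t * cinner x y)"
      by (subst Re_cinner_commute) (simp add: cinner_scaleC_right)
    finally show ?thesis by (simp add: norm_scaleC power_mult_distrib)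
  qed
  then have "(cmod (cinner x y))\<^sup>2 \<le> (norm x)\<^sup>2 * (norm y)\<^sup>2"
    by (rule cauchy_schwarz_discriminant) simp
  then have "(cmod (cinner x y))\<^sup>2 \<le> (norm x * norm y)\<^sup>2"
    by (simp only: power_mult_distrib)
  then show ?thesis by (rule power2_le_imp_le) simp
qed

lemma bounded_bilinear_cinner: "bounded_bilinear (cinner :: 'h::chilbert_space \<Rightarrow> _)"
proof (rule bounded_bilinear.intro)
  show "\<exists>K. \<forall>a b. norm (cinner a (b::'h)) \<le> norm a * norm b * K"
    by (rule exI[of _ 1]) (simp add: cinner_Cauchy_Schwarz)
  fix r and a b :: 'h
  show "cinner (r *\<^sub>R a) b = r *\<^sub>R cinner a b"
    unfolding scaleR_scaleC[of r a] cinner_scaleC_left scaleR_conv_of_real by simp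
  show "cinner a (r *\<^sub>R b) = r *\<^sub>R cinner a b"
    unfolding scaleR_scaleC[of r b] cinner_scaleC_right scaleR_conv_of_real by simp
qed (rule cinner_add_left cinner_add_right)+

lemmas tendsto_cinner [tendsto_intros] = bounded_bilinear.tendsto[OF bounded_bilinear_cinner]

lemma parallelogram:
  "(norm (x + y))\<^sup>2 + (norm (x - y))\<^sup>2 = 2 * (norm x)\<^sup>2 + 2 * (norm (y::'h::chilbert_space))\<^sup>2"
proof -
  have "Re (cinner (x + y) (x + y)) + Re (cinner (x - y) (x - y))
      = 2 * Re (cinner x x) + 2 * Re (cinner y y)"
    by (simp only: cinner_linear plus_complex.simps minus_complex.simps)
  then show ?thesis by simp
qed

subsection \<open>Pointwise rules for operators\<close>

context
  fixes S T :: "'h::chilbert_space bop"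
begin

lemma bop_clinear: "bounded_clinear (bop_apply T)"
  using bop_apply[of T] by simp

lemma bop_bounded_linear: "bounded_linear (bop_apply T)"
  using bop_clinear by (simp add: bounded_clinear_def)

lemma bop_apply_simps [simp]:
  "(S * T) \<cdot> v = S \<cdot> T \<cdot> v" "(S + T) \<cdot> v = S \<cdot> v + T \<cdot> v" "(S - T) \<cdot> v = S \<cdot> v - T \<cdot> v"
  "(- T) \<cdot> v = - (T \<cdot> v)" "(0::'h bop) \<cdot> v = 0" "(1::'h bop) \<cdot> v = v" "(c *\<^sub>C T) \<cdot> v = c *\<^sub>C (T \<cdot> v)"
  by (transfer; simp)+

lemma bop_linear_simps [simp]:
  "T \<cdot> (v + w) = T \<cdot> v + T \<cdot> w" "T \<cdot> (v - w) = T \<cdot> v - T \<cdot> w" "T \<cdot> (- v) = - (T \<cdot> v)" "T \<cdot> 0 = 0"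
  "T \<cdot> (c *\<^sub>C v) = c *\<^sub>C (T \<cdot> v)"
  using bop_bounded_linear bop_clinear
  by (auto simp: bounded_clinear_def linear_simps bounded_linear.linear linear_0 linear_neg linear_diff linear_add)

lemma bop_eqI: "(\<And>v. S \<cdot> v = T \<cdot> v) \<Longrightarrow> S = T"
  by (metis bop_apply_inject ext)

lemma bop_eq_cinnerI: "(\<And>x y. cinner x (S \<cdot> y) = cinner x (T \<cdot> y)) \<Longrightarrow> S = T"
  by (metis bop_eqI cinner_eqI)

end

lemmas tendsto_bop [tendsto_intros] = bounded_linear.tendsto[OF bop_bounded_linear]

lemma bop_scaleC_mult [simp]:
  "(c *\<^sub>C S) * T = c *\<^sub>C (S * (T::'h::chilbert_space bop))" "S * (c *\<^sub>C T) = c *\<^sub>C (S * T)"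
  by (rule bop_eqI; simp)+

definition opbound :: "real \<Rightarrow> 'h::chilbert_space bop \<Rightarrow> bool" where
  "opbound C T \<longleftrightarrow> 0 \<le> C \<and> (\<forall>v. norm (T \<cdot> v) \<le> C * norm v)"

lemma opbound_exists: "\<exists>C. opbound C T"
  using bounded_linear.nonneg_bounded[OF bop_bounded_linear[of T]]
  by (auto simp: opbound_def mult.commute)

lemma opboundD: "opbound C T \<Longrightarrow> norm (T \<cdot> v) \<le> C * norm v" "opbound C T \<Longrightarrow> 0 \<le> C"
  by (auto simp: opbound_def)

lemma opbound_mono: "opbound C T \<Longrightarrow> C \<le> D \<Longrightarrow> opbound D T"
  unfolding opbound_def by (metis order_trans mult_right_mono norm_ge_zero)

lemma opbound_add: "opbound C S \<Longrightarrow> opbound D T \<Longrightarrow> opbound (C + D) (S + T)"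
  unfolding opbound_def
  by (auto simp: distrib_right intro!: order_trans[OF norm_triangle_ineq] add_mono)

lemma opbound_diff: "opbound C S \<Longrightarrow> opbound D T \<Longrightarrow> opbound (C + D) (S - T)"
  unfolding opbound_def
  by (auto simp: distrib_right intro!: order_trans[OF norm_triangle_ineq4] add_mono)

lemma opbound_mult:
  assumes "opbound C S" "opbound D T" shows "opbound (C * D) (S * T)"
proof -
  have "norm (S \<cdot> T \<cdot> v) \<le> (C * D) * norm v" for v
  proof -
    have "norm (S \<cdot> T \<cdot> v) \<le> C * norm (T \<cdot> v)" by (rule opboundD[OF assms(1)])
    also have "\<dots> \<le> C * (D * norm v)"
      by (rule mult_left_mono) (use assms in \<open>simp_all add: opboundD\<close>)
    finally show ?thesis by (simp only: mult.assoc)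
  qed
  then show ?thesis using assms by (simp add: opbound_def)
qed

lemma opbound_scaleC: "opbound C T \<Longrightarrow> opbound (cmod c * C) (c *\<^sub>C T)"
  unfolding opbound_def by (auto simp: norm_scaleC mult.assoc mult_left_mono)

lemma bop_exists:
  assumes "\<And>x y. f (x + y) = f x + f y" "\<And>c x. f (c *\<^sub>C x) = c *\<^sub>C f x"
    and "\<And>x. norm (f x) \<le> C * norm x"
  obtains T :: "'h::chilbert_space bop" where "\<And>v. T \<cdot> v = f v"
proof -
  have "bounded_linear f"
    by (rule bounded_linear_intro[where K = C]) (simp_all add: assms scaleR_scaleC mult.commute)
  then have "bounded_clinear f" by (simp add: bounded_clinear_def assms)
  then have "Bop f \<cdot> v = f v" for v by (simp add: Bop_inverse)
  then show ?thesis by (rule that)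
qed

subsection \<open>A minimisation principle and adjoints\<close>

text \<open>Minimise the quadratic functional \<open>x \<mapsto> \<langle>x, Ax\<rangle> - 2 Re f(x)\<close>. A minimising sequence is
  Cauchy by the parallelogram identity, because the form dominates the norm. For \<open>A = 1\<close> this is
  the Riesz representation theorem, which provides adjoints; for \<open>A = 1 + h\<close> with \<open>h\<close> positive
  it shows that \<open>1 + h\<close> is onto.\<close>

lemma coercive_form_represents:
  fixes A :: "'h::chilbert_space bop"
  assumes sa: "\<And>x y. cinner (A \<cdot> x) y = cinner x (A \<cdot> y)"
    and lb: "\<And>x. (norm x)\<^sup>2 \<le> Re (cinner x (A \<cdot> x))"
    and f_add: "\<And>x y. f (x + y) = f x + f y" and f_scale: "\<And>c x. f (c *\<^sub>C x) = c * f x"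
    and f_bd: "\<And>x. cmod (f x) \<le> K * norm x"
  obtains y where "\<And>x. f x = cinner y (A \<cdot> x)"
proof -
  define q where "q x = Re (cinner x (A \<cdot> x))" for x
  define J where "J x = q x - 2 * Re (f x)" for x
  have f_bl: "bounded_linear f"
    by (rule bounded_linear_intro[where K = K])
       (simp_all add: f_add f_scale f_bd scaleR_scaleC scaleR_conv_of_real mult.commute)
  have Jlb: "- K\<^sup>2 \<le> J x" for x
  proof -
    have "Re (f x) \<le> K * norm x" using f_bd[of x] complex_Re_le_cmod[of "f x"] by linarith
    moreover have "0 \<le> (norm x - K)\<^sup>2" by simp
    ultimately show ?thesis
      using lb[of x] by (simp add: J_def q_def power2_eq_square algebra_simps)
  qed
  define m where "m = Inf (range J)"
  have bb: "bdd_below (range J)" using Jlb by (auto intro!: bdd_belowI2)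
  have m_le: "m \<le> J x" for x unfolding m_def using bb by (simp add: cINF_lower)
  have "\<exists>x. J x < m + 1 / (real n + 1)" for n
  proof -
    have "\<exists>y\<in>range J. y < m + 1 / (real n + 1)"
      using cInf_less_iff[of "range J" "m + 1 / (real n + 1)"] bb unfolding m_def by simp
    then show ?thesis by auto
  qed
  then obtain X where X: "\<And>n. J (X n) < m + 1 / (real n + 1)" by metis
  have mid: "q (x - y) = 2 * J x + 2 * J y - 4 * J ((1/2) *\<^sub>C (x + y))" for x y
  proof -
    have half: "Re (f ((1/2) *\<^sub>C (x + y))) = (Re (f x) + Re (f y)) / 2"
      by (simp add: f_scale f_add del: scaleC_add_right)
    have q4: "4 * q ((1/2) *\<^sub>C (x + y)) = q (x + y)"
      by (simp add: q_def cinner_linear field_simps)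
    have "q (x - y) + q (x + y) = 2 * q x + 2 * q y"
      by (simp add: q_def cinner_linear)
    then show ?thesis using half q4 by (simp add: J_def)
  qed
  have close: "(norm (X n - X k))\<^sup>2 \<le> 2 / (real n + 1) + 2 / (real k + 1)" for n k
  proof -
    have "(norm (X n - X k))\<^sup>2 \<le> q (X n - X k)" unfolding q_def by (rule lb)
    also have "\<dots> \<le> 2 * J (X n) + 2 * J (X k) - 4 * m" using mid m_le by simp
    also have "\<dots> \<le> 2 * (m + 1 / (real n + 1)) + 2 * (m + 1 / (real k + 1)) - 4 * m"
      using less_imp_le[OF X[of n]] less_imp_le[OF X[of k]]
      by (intro diff_right_mono add_mono mult_left_mono) simp_all
    finally show ?thesis by (simp add: algebra_simps)
  qed
  have "Cauchy X"
  proof (rule CauchyI)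
    fix e :: real assume e: "0 < e"
    obtain M where M: "4 / e\<^sup>2 < real M" using reals_Archimedean2 by blast
    show "\<exists>M. \<forall>m\<ge>M. \<forall>n\<ge>M. norm (X m - X n) < e"
    proof (intro exI allI impI)
      fix i j assume ij: "M \<le> i" "M \<le> j"
      have "2 / (real i + 1) \<le> 2 / (real M + 1)" "2 / (real j + 1) \<le> 2 / (real M + 1)"
        using ij by (auto simp: frac_le)
      then have "(norm (X i - X j))\<^sup>2 \<le> 4 / (real M + 1)" using close[of i j] by simp
      also have "\<dots> < e\<^sup>2" using M e by (simp add: field_simps) (smt (verit) zero_less_power)
      finally show "norm (X i - X j) < e" using e by (simp add: power_less_imp_less_base)
    qed
  qed
  then obtain y where y: "X \<longlonglongrightarrow> y" using Cauchy_convergent convergent_def by blast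
  have "(\<lambda>n. J (X n)) \<longlonglongrightarrow> J y"
    unfolding J_def q_def
    by (intro tendsto_intros y bounded_linear.tendsto[OF f_bl])
  moreover have "(\<lambda>n. m + 1 / (real n + 1)) \<longlonglongrightarrow> m + 0"
    by (intro tendsto_intros) (use lim_inverse_n' LIMSEQ_inverse_real_of_nat in \<open>simp add: inverse_eq_divide add.commute\<close>)
  ultimately have "J y \<le> m"
    by (intro LIMSEQ_le[of "\<lambda>n. J (X n)" "J y" "\<lambda>n. m + 1 / (real n + 1)" m]) (auto intro: less_imp_le X)
  then have ymin: "J y \<le> J x" for x using m_le[of x] by linarith
  have Re0: "Re (cinner y (A \<cdot> z) - f z) = 0" for z
  proof -
    define d where "d = Re (cinner y (A \<cdot> z) - f z)"
    have "J (y + complex_of_real t *\<^sub>C z) = J y + 2 * t * d + t\<^sup>2 * q z" for t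
    proof -
      have "Re (cinner z (A \<cdot> y)) = Re (cinner y (A \<cdot> z))"
        by (subst Re_cinner_commute) (simp add: sa)
      then show ?thesis
        by (simp add: J_def q_def d_def cinner_linear f_add f_scale algebra_simps power2_eq_square)
    qed
    then have pos: "0 \<le> 2 * t * d + t\<^sup>2 * q z" for t using ymin[of "y + complex_of_real t *\<^sub>C z"] by simp
    have qz: "0 \<le> q z" using lb[of z] by (simp add: q_def) (meson order_trans zero_le_power2)
    have "0 \<le> 0 + 2 * Re (t * complex_of_real d) + (cmod t)\<^sup>2 * q z" for t
    proof -
      have "(Re t)\<^sup>2 * q z \<le> (cmod t)\<^sup>2 * q z"
        using qz by (intro mult_right_mono) (simp_all add: cmod_power2)
      then show ?thesis using pos[of "Re t"] by (simp add: mult.assoc)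
    qed
    then have "(cmod (complex_of_real d))\<^sup>2 \<le> 0 * q z" by (rule cauchy_schwarz_discriminant[OF _ qz])
    then show ?thesis by (simp add: d_def)
  qed
  have "f z = cinner y (A \<cdot> z)" for z
  proof -
    have "Re (\<i> * (cinner y (A \<cdot> z) - f z)) = 0"
      using Re0[of "\<i> *\<^sub>C z"] by (simp add: cinner_linear f_scale algebra_simps)
    then have "Im (cinner y (A \<cdot> z) - f z) = 0" by simp
    then show ?thesis using Re0[of z] by (simp add: complex_eq_iff)
  qed
  then show ?thesis by (rule that)
qed

lemma opbound_cinner:
  assumes "opbound C T" shows "cmod (cinner x (T \<cdot> y)) \<le> (norm x * C) * norm y"
proof -
  have "cmod (cinner x (T \<cdot> y)) \<le> norm x * norm (T \<cdot> y)" by (rule cinner_Cauchy_Schwarz)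
  also have "\<dots> \<le> norm x * (C * norm y)"
    by (rule mult_left_mono) (use assms in \<open>simp_all add: opboundD\<close>)
  finally show ?thesis by (simp only: mult.assoc)
qed

lemma adj_exists: "\<exists>S. \<forall>x y. cinner (S \<cdot> x) y = cinner x (T \<cdot> y)"
proof -
  obtain C where C: "opbound C T" using opbound_exists by blast
  have "\<exists>s. \<forall>y. cinner x (T \<cdot> y) = cinner s y" for x
  proof -
    obtain s where "\<And>y. cinner x (T \<cdot> y) = cinner s (1 \<cdot> y)"
    proof (rule coercive_form_represents[of 1 "\<lambda>y. cinner x (T \<cdot> y)" "norm x * C"])
      show "cmod (cinner x (T \<cdot> y)) \<le> (norm x * C) * norm y" for y
        by (rule opbound_cinner[OF C])
    qed (simp_all add: cinner_linear)
    then show ?thesis by auto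
  qed
  then obtain s where s: "\<And>x y. cinner x (T \<cdot> y) = cinner (s x) y" by metis
  have s': "cinner y (s x) = cinner (T \<cdot> y) x" for x y
    by (subst (1 2) cinner_commute) (simp add: s)
  have b: "norm (s x) \<le> C * norm x" for x
  proof (cases "s x = 0")
    case True then show ?thesis using C by (simp add: opbound_def)
  next
    case False
    have "norm (s x) * norm (s x) = cmod (cinner (s x) (s x))"
      by (simp add: cinner_self power2_eq_square norm_mult)
    also have "\<dots> \<le> norm (T \<cdot> s x) * norm x" unfolding s' by (rule cinner_Cauchy_Schwarz)
    also have "\<dots> \<le> C * norm (s x) * norm x" by (intro mult_right_mono opboundD(1)[OF C]) simp
    finally have "norm (s x) * norm (s x) \<le> norm (s x) * (C * norm x)" by (simp add: mult_ac)
    then show ?thesis using False by simp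
  qed
  obtain S where "\<And>v. S \<cdot> v = s v"
  proof (rule bop_exists[of s C])
    show "s (x + y) = s x + s y" for x y by (rule cinner_eqI) (simp add: s' cinner_linear)
    show "s (c *\<^sub>C x) = c *\<^sub>C s x" for c x by (rule cinner_eqI) (simp add: s' cinner_linear)
  qed (use b in auto)
  then show ?thesis using s by (intro exI[of _ S]) simp
qed

lemma adj_eqI:
  assumes "\<And>x y. cinner (S \<cdot> x) y = cinner x (T \<cdot> y)" shows "adj T = S"
  unfolding adj_def
proof (rule the_equality)
  show "\<forall>x y. cinner (S \<cdot> x) y = cinner x (T \<cdot> y)" using assms by blast
next
  fix S' assume S': "\<forall>x y. cinner (S' \<cdot> x) y = cinner x (T \<cdot> y)"
  show "S' = S"
  proof (rule bop_eqI, rule cinner_eqI)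
    fix v z
    have "cinner (S' \<cdot> v) z = cinner (S \<cdot> v) z" using S' assms by simp
    then show "cinner z (S' \<cdot> v) = cinner z (S \<cdot> v)"
      by (subst (1 2) cinner_commute) simp
  qed
qed

lemma cinner_adj_left: "cinner (adj T \<cdot> x) y = cinner x (T \<cdot> y)"
proof -
  obtain S where S: "\<And>x y. cinner (S \<cdot> x) y = cinner x (T \<cdot> y)" using adj_exists[of T] by blast
  then show ?thesis using adj_eqI[of S T] by simp
qed

lemma cinner_adj_right: "cinner x (adj T \<cdot> y) = cinner (T \<cdot> x) y"
  by (subst (1 2) cinner_commute) (simp add: cinner_adj_left)

lemma adj_adj [simp]: "adj (adj T) = T"
  by (rule adj_eqI) (simp add: cinner_adj_right)

lemma adj_simps [simp]:
  "adj (S * T) = adj T * adj S" "adj (S + T) = adj S + adj T" "adj (S - T) = adj S - adj T"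
  "adj (- S) = - adj S" "adj 0 = 0" "adj 1 = 1" "adj (c *\<^sub>C S) = cnj c *\<^sub>C adj S"
  by (rule adj_eqI; simp add: cinner_adj_left cinner_linear)+

lemma opbound_adj: "opbound C T \<Longrightarrow> opbound C (adj T)"
proof -
  assume C: "opbound C T"
  have "norm (adj T \<cdot> x) \<le> C * norm x" for x
  proof (cases "adj T \<cdot> x = 0")
    case False
    have "norm (adj T \<cdot> x) * norm (adj T \<cdot> x) = cmod (cinner (adj T \<cdot> x) (adj T \<cdot> x))"
      by (simp add: cinner_self power2_eq_square norm_mult)
    also have "\<dots> \<le> norm (T \<cdot> adj T \<cdot> x) * norm x"
      unfolding cinner_adj_right by (rule cinner_Cauchy_Schwarz)
    also have "\<dots> \<le> C * norm (adj T \<cdot> x) * norm x" by (intro mult_right_mono opboundD(1)[OF C]) simp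
    finally have "norm (adj T \<cdot> x) * norm (adj T \<cdot> x) \<le> norm (adj T \<cdot> x) * (C * norm x)"
      by (simp add: mult_ac)
    then show ?thesis using False by simp
  qed (use C in \<open>simp add: opbound_def\<close>)
  then show ?thesis using C by (simp add: opbound_def)
qed

lemma norm_bop_sq: "(norm (T \<cdot> v))\<^sup>2 = Re (cinner v ((adj T * T) \<cdot> v))"
  by (simp add: cinner_adj_right)

section \<open>Positive operators, strong limits, square roots and resolvents\<close>

definition pos :: "'h::chilbert_space bop \<Rightarrow> bool" where
  "pos T \<longleftrightarrow> adj T = T \<and> (\<forall>v. 0 \<le> Re (cinner v (T \<cdot> v)))"

lemma posD: "pos T \<Longrightarrow> adj T = T" "pos T \<Longrightarrow> 0 \<le> Re (cinner v (T \<cdot> v))"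
  by (auto simp: pos_def)

lemma pos_add: "pos S \<Longrightarrow> pos T \<Longrightarrow> pos (S + T)"
  by (auto simp: pos_def cinner_linear)

lemma pos_0 [simp]: "pos 0" and pos_1 [simp]: "pos 1"
  by (auto simp: pos_def)

lemma pos_scale: "0 \<le> r \<Longrightarrow> pos T \<Longrightarrow> pos (complex_of_real r *\<^sub>C T)"
  by (auto simp: pos_def cinner_linear)

lemma pos_conj: "pos T \<Longrightarrow> pos (adj X * T * X)"
  by (auto simp: pos_def cinner_adj_right mult.assoc)

lemma pos_adj_mult: "pos (adj X * X)"
  using pos_conj[OF pos_1] by simp

lemma pos_Cauchy_Schwarz:
  assumes T: "pos T"
  shows "(cmod (cinner v (T \<cdot> w)))\<^sup>2 \<le> Re (cinner v (T \<cdot> v)) * Re (cinner w (T \<cdot> w))"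
proof (rule cauchy_schwarz_discriminant)
  fix t
  have sa: "cinner w (T \<cdot> v) = cnj (cinner v (T \<cdot> w))"
    by (subst cinner_commute) (metis T cinner_adj_left posD(1))
  have "0 \<le> Re (cinner (v + t *\<^sub>C w) (T \<cdot> (v + t *\<^sub>C w)))"
    using T by (rule posD)
  also have "\<dots> = Re (cinner v (T \<cdot> v)) + Re (t * cinner v (T \<cdot> w)) + Re (cnj t * cinner w (T \<cdot> v))
      + Re (cnj t * (t * cinner w (T \<cdot> w)))"
    by (simp add: cinner_linear algebra_simps)
  also have "Re (cnj t * cinner w (T \<cdot> v)) = Re (t * cinner v (T \<cdot> w))"
    unfolding sa by simp
  also have "Re (cnj t * (t * cinner w (T \<cdot> w))) = (cmod t)\<^sup>2 * Re (cinner w (T \<cdot> w))"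
    unfolding cmod_power2 by (simp add: algebra_simps power2_eq_square)
  finally show "0 \<le> Re (cinner v (T \<cdot> v)) + 2 * Re (t * cinner v (T \<cdot> w)) + (cmod t)\<^sup>2 * Re (cinner w (T \<cdot> w))"
    by simp
qed (rule posD[OF T])

lemma pos_antisym:
  assumes "pos T" "pos (- T)" shows "T = 0"
proof (rule bop_eq_cinnerI)
  fix x y
  have "Re (cinner x (T \<cdot> x)) = 0"
    using posD(2)[OF assms(1), of x] posD(2)[OF assms(2), of x] by (simp add: cinner_linear)
  then show "cinner x (T \<cdot> y) = cinner x (0 \<cdot> y)"
    using pos_Cauchy_Schwarz[OF assms(1), of x y] by simp
qed

text \<open>Cauchy--Schwarz for the form of \<open>T\<close> at the vectors \<open>Tv\<close> and \<open>v\<close>.\<close>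

lemma pos_norm_le:
  assumes T: "pos T" and C: "\<And>v. Re (cinner v (T \<cdot> v)) \<le> C * (norm v)\<^sup>2" and "0 \<le> C"
  shows "(norm (T \<cdot> v))\<^sup>2 \<le> C * Re (cinner v (T \<cdot> v))" and "opbound C T"
proof -
  show A: "(norm (T \<cdot> v))\<^sup>2 \<le> C * Re (cinner v (T \<cdot> v))" for v
  proof (cases "T \<cdot> v = 0")
    case False
    have "((norm (T \<cdot> v))\<^sup>2)\<^sup>2 = (cmod (cinner (T \<cdot> v) (T \<cdot> v)))\<^sup>2"
      by (simp add: cinner_self norm_power)
    also have "\<dots> \<le> Re (cinner (T \<cdot> v) (T \<cdot> T \<cdot> v)) * Re (cinner v (T \<cdot> v))"
      by (rule pos_Cauchy_Schwarz[OF T])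
    also have "\<dots> \<le> (C * (norm (T \<cdot> v))\<^sup>2) * Re (cinner v (T \<cdot> v))"
      by (intro mult_right_mono C posD[OF T])
    finally have "(norm (T \<cdot> v))\<^sup>2 * (norm (T \<cdot> v))\<^sup>2 \<le> (norm (T \<cdot> v))\<^sup>2 * (C * Re (cinner v (T \<cdot> v)))"
      by (simp only: power2_eq_square[of "(norm (T \<cdot> v))\<^sup>2"] mult_ac)
    then show ?thesis by (rule mult_left_le_imp_le) (use False in simp)
  qed (use assms in \<open>simp add: posD\<close>)
  have "norm (T \<cdot> v) \<le> C * norm v" for v
  proof (rule power2_le_imp_le)
    have "(norm (T \<cdot> v))\<^sup>2 \<le> C * (C * (norm v)\<^sup>2)"
      using A[of v] mult_left_mono[OF C[of v] \<open>0 \<le> C\<close>] by linarith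
    then show "(norm (T \<cdot> v))\<^sup>2 \<le> (C * norm v)\<^sup>2" by (simp add: power_mult_distrib power2_eq_square mult_ac)
  qed (use assms in simp)
  then show "opbound C T" using assms by (simp add: opbound_def)
qed

lemma opbound_form_le: "opbound C T \<Longrightarrow> Re (cinner v (T \<cdot> v)) \<le> C * (norm v)\<^sup>2"
  using opbound_cinner[of C T v v] complex_Re_le_cmod[of "cinner v (T \<cdot> v)"]
  by (simp add: power2_eq_square mult_ac)

lemma opbound_adj_mult_iff:
  assumes "0 \<le> C"
  shows "opbound C T \<longleftrightarrow> pos (complex_of_real (C\<^sup>2) *\<^sub>C 1 - adj T * T)"
proof -
  have "Re (cinner v ((complex_of_real (C\<^sup>2) *\<^sub>C 1 - adj T * T) \<cdot> v)) = (C * norm v)\<^sup>2 - (norm (T \<cdot> v))\<^sup>2" for v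
    by (simp add: cinner_linear cinner_adj_right cinner_self power_mult_distrib
        flip: of_real_power of_real_mult)
  then have "pos (complex_of_real (C\<^sup>2) *\<^sub>C 1 - adj T * T) \<longleftrightarrow> (\<forall>v. (norm (T \<cdot> v))\<^sup>2 \<le> (C * norm v)\<^sup>2)"
    by (simp add: pos_def)
  then show ?thesis
    using assms by (auto simp: opbound_def abs_le_square_iff[symmetric] abs_mult)
qed

subsection \<open>Strong limits\<close>

definition strong_lim :: "(nat \<Rightarrow> 'h::chilbert_space bop) \<Rightarrow> 'h bop \<Rightarrow> bool" where
  "strong_lim X T \<longleftrightarrow> (\<forall>v. (\<lambda>n. X n \<cdot> v) \<longlonglongrightarrow> T \<cdot> v)"

lemma strong_limD: "strong_lim X T \<Longrightarrow> (\<lambda>n. X n \<cdot> v) \<longlonglongrightarrow> T \<cdot> v"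
  by (simp add: strong_lim_def)

lemma strong_lim_exists:
  assumes b: "\<And>n. opbound C (X n)" and c: "\<And>v. convergent (\<lambda>n. X n \<cdot> v)"
  obtains T where "strong_lim X T" "opbound C T"
proof -
  define f where "f v = lim (\<lambda>n. X n \<cdot> v)" for v
  have f: "(\<lambda>n. X n \<cdot> v) \<longlonglongrightarrow> f v" for v
    using c[of v] by (simp add: f_def convergent_LIMSEQ_iff)
  have sc: "(\<lambda>n. c *\<^sub>C (X n \<cdot> v)) \<longlonglongrightarrow> c *\<^sub>C f v" for c v
    using tendsto_bop[OF f[of v], of "c *\<^sub>C 1"] by simp
  have nf: "norm (f v) \<le> C * norm v" for v
    by (rule LIMSEQ_le_const2[OF tendsto_norm[OF f[of v]]]) (use b opboundD in blast)
  obtain T where T: "\<And>v. T \<cdot> v = f v"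
  proof (rule bop_exists[of f C])
    show "f (x + y) = f x + f y" for x y
      using LIMSEQ_unique[OF f[of "x + y"]] tendsto_add[OF f[of x] f[of y]] by simp
    show "f (c *\<^sub>C x) = c *\<^sub>C f x" for c x
      using LIMSEQ_unique[OF f[of "c *\<^sub>C x"]] sc[of c x] by simp
  qed (use nf in auto)
  show ?thesis
  proof
    show "strong_lim X T" using f T by (simp add: strong_lim_def)
    show "opbound C T" using b[of 0] nf T by (simp add: opbound_def)
  qed
qed

lemma strong_lim_unique: "strong_lim X S \<Longrightarrow> strong_lim X T \<Longrightarrow> S = T"
  by (rule bop_eqI) (meson LIMSEQ_unique strong_limD)

lemma strong_lim_const: "strong_lim (\<lambda>_. T) T"
  by (simp add: strong_lim_def)

lemma strong_lim_add: "strong_lim X S \<Longrightarrow> strong_lim Y T \<Longrightarrow> strong_lim (\<lambda>n. X n + Y n) (S + T)"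
  by (simp add: strong_lim_def tendsto_add)

lemma strong_lim_diff: "strong_lim X S \<Longrightarrow> strong_lim Y T \<Longrightarrow> strong_lim (\<lambda>n. X n - Y n) (S - T)"
  by (simp add: strong_lim_def tendsto_diff)

lemma strong_lim_mult_left: "strong_lim X S \<Longrightarrow> strong_lim (\<lambda>n. T * X n) (T * S)"
  by (simp add: strong_lim_def tendsto_bop)

lemma strong_lim_mult_right: "strong_lim X S \<Longrightarrow> strong_lim (\<lambda>n. X n * T) (S * T)"
  by (simp add: strong_lim_def)

lemma strong_lim_scaleC: "strong_lim X S \<Longrightarrow> strong_lim (\<lambda>n. c *\<^sub>C X n) (c *\<^sub>C S)"
  using strong_lim_mult_left[of X S "c *\<^sub>C 1"] by simp

lemma strong_lim_Suc: "strong_lim X S \<Longrightarrow> strong_lim (\<lambda>n. X (Suc n)) S"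
  unfolding strong_lim_def using LIMSEQ_Suc[of "\<lambda>n. X n \<cdot> _"] by blast

lemma strong_lim_mult:
  assumes X: "strong_lim X S" and b: "\<And>n. opbound C (X n)" and Y: "strong_lim Y T"
  shows "strong_lim (\<lambda>n. X n * Y n) (S * T)"
  unfolding strong_lim_def
proof
  fix v
  have "(\<lambda>n. X n \<cdot> (Y n \<cdot> v - T \<cdot> v)) \<longlonglongrightarrow> 0"
  proof (rule Lim_null_comparison)
    show "(\<lambda>n. C * norm (Y n \<cdot> v - T \<cdot> v)) \<longlonglongrightarrow> 0"
      using strong_limD[OF Y, of v] by (intro tendsto_mult_right_zero tendsto_norm_zero) (simp add: LIM_zero)
    show "\<forall>\<^sub>F n in sequentially. norm (X n \<cdot> (Y n \<cdot> v - T \<cdot> v)) \<le> C * norm (Y n \<cdot> v - T \<cdot> v)"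
      by (intro always_eventually allI opboundD(1) b)
  qed
  then have "(\<lambda>n. X n \<cdot> (Y n \<cdot> v - T \<cdot> v) + X n \<cdot> T \<cdot> v) \<longlonglongrightarrow> 0 + S \<cdot> T \<cdot> v"
    by (rule tendsto_add) (rule strong_limD[OF X])
  then show "(\<lambda>n. (X n * Y n) \<cdot> v) \<longlonglongrightarrow> (S * T) \<cdot> v" by simp
qed

lemma strong_lim_pos:
  assumes X: "strong_lim X T" and p: "\<And>n. pos (X n)" shows "pos T"
proof -
  have "adj T = T"
  proof (rule adj_eqI)
    fix x y
    have "(\<lambda>n. cinner (X n \<cdot> x) y) \<longlonglongrightarrow> cinner (T \<cdot> x) y"
      by (intro tendsto_intros strong_limD[OF X])
    moreover have "cinner (X n \<cdot> x) y = cinner x (X n \<cdot> y)" for n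
      by (metis p posD(1) cinner_adj_left)
    moreover have "(\<lambda>n. cinner x (X n \<cdot> y)) \<longlonglongrightarrow> cinner x (T \<cdot> y)"
      by (intro tendsto_intros strong_limD[OF X])
    ultimately show "cinner (T \<cdot> x) y = cinner x (T \<cdot> y)" using LIMSEQ_unique by auto
  qed
  moreover have "0 \<le> Re (cinner v (T \<cdot> v))" for v
  proof (rule LIMSEQ_le_const)
    show "(\<lambda>n. Re (cinner v (X n \<cdot> v))) \<longlonglongrightarrow> Re (cinner v (T \<cdot> v))"
      by (intro tendsto_intros strong_limD[OF X])
  qed (use p posD in blast)
  ultimately show ?thesis by (simp add: pos_def)
qed

text \<open>The differences \<open>D\<close> are positive contractions, so \<open>\<parallel>Dv\<parallel>\<^sup>2 \<le> \<langle>v, Dv\<rangle>\<close>, and the right-hand sides come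
  from a bounded monotone sequence of reals.\<close>

lemma monotone_strong_lim:
  assumes p: "\<And>n. pos (X n)" and le1: "\<And>n. pos (1 - X n)" and inc: "\<And>n. pos (X (Suc n) - X n)"
  obtains T where "strong_lim X T" "\<And>n. pos (T - X n)" "pos T" "pos (1 - T)"
proof -
  have mono: "pos (X (n + k) - X n)" for n k
  proof (induction k)
    case (Suc k)
    then show ?case using pos_add[OF inc[of "n + k"] Suc] by simp
  qed simp
  have le: "Re (cinner v (X n \<cdot> v)) \<le> (norm v)\<^sup>2" for n v
    using posD(2)[OF le1[of n], of v] by (simp add: cinner_linear)
  have bd: "opbound 1 (X n)" for n
    by (rule pos_norm_le(2)[OF p]) (use le in auto)
  have "Cauchy (\<lambda>n. X n \<cdot> v)" for v
  proof (rule CauchyI)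
    fix e :: real assume e: "0 < e"
    define a where "a n = Re (cinner v (X n \<cdot> v))" for n
    have "incseq a" unfolding a_def
      by (rule incseq_SucI) (use posD(2)[OF inc, of v] in \<open>simp add: cinner_linear\<close>)
    then have "convergent a"
      using incseq_convergent[of a "(norm v)\<^sup>2"] le unfolding a_def convergent_def by metis
    then have "Cauchy a" by (rule convergent_Cauchy)
    then obtain M where M: "\<And>m n. m \<ge> M \<Longrightarrow> n \<ge> M \<Longrightarrow> norm (a m - a n) < e\<^sup>2"
      using CauchyD[of a "e\<^sup>2"] e by auto
    have diff: "norm (X (n + k) \<cdot> v - X n \<cdot> v) < e" if "n \<ge> M" for n k
    proof -
      let ?D = "X (n + k) - X n"
      have "(norm (?D \<cdot> v))\<^sup>2 \<le> 1 * Re (cinner v (?D \<cdot> v))"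
      proof (rule pos_norm_le(1)[OF mono])
        show "Re (cinner w (?D \<cdot> w)) \<le> 1 * (norm w)\<^sup>2" for w
          using posD(2)[OF p[of n], of w] le[of w "n + k"] by (simp add: cinner_linear)
      qed simp
      also have "\<dots> = a (n + k) - a n" by (simp add: a_def cinner_linear)
      also have "\<dots> < e\<^sup>2" using M[of "n + k" n] that by simp
      finally show ?thesis using e by (simp add: power_less_imp_less_base)
    qed
    show "\<exists>M. \<forall>m\<ge>M. \<forall>n\<ge>M. norm (X m \<cdot> v - X n \<cdot> v) < e"
    proof (intro exI allI impI)
      fix m n assume "M \<le> m" "M \<le> n"
      then show "norm (X m \<cdot> v - X n \<cdot> v) < e"
        using diff[of n "m - n"] diff[of m "n - m"]
        by (cases "n \<le> m") (auto simp: norm_minus_commute)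
    qed
  qed
  then have "convergent (\<lambda>n. X n \<cdot> v)" for v by (rule Cauchy_convergent)
  then obtain T where T: "strong_lim X T" "opbound 1 T" using strong_lim_exists[of 1 X] bd by blast
  show ?thesis
  proof
    show "strong_lim X T" by fact
    show "pos (T - X n)" for n
    proof (rule strong_lim_pos)
      show "strong_lim (\<lambda>k. X (n + k) - X n) (T - X n)"
        using T(1) LIMSEQ_ignore_initial_segment[of "\<lambda>k. X k \<cdot> _" _ n]
        by (intro strong_lim_diff strong_lim_const) (simp add: strong_lim_def add.commute)
    qed (rule mono)
    show "pos T" by (rule strong_lim_pos[OF T(1) p])
    show "pos (1 - T)" by (rule strong_lim_pos[OF strong_lim_diff[OF strong_lim_const T(1)] le1])
  qed
qed

subsection \<open>Square roots\<close>

text \<open>For positive \<open>x\<close> these elements are positive and commute with each other. This makes the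
  iteration below monotone without the theorem that commuting positive operators have a positive
  product, which would itself need square roots.\<close>

inductive_set nonneg_poly :: "'h::chilbert_space bop \<Rightarrow> 'h bop set" for x where
  power: "x ^ n \<in> nonneg_poly x"
| add: "S \<in> nonneg_poly x \<Longrightarrow> T \<in> nonneg_poly x \<Longrightarrow> S + T \<in> nonneg_poly x"
| scale: "0 \<le> r \<Longrightarrow> T \<in> nonneg_poly x \<Longrightarrow> complex_of_real r *\<^sub>C T \<in> nonneg_poly x"

lemma nonneg_poly_mult:
  assumes "S \<in> nonneg_poly x" "T \<in> nonneg_poly x" shows "S * T \<in> nonneg_poly x"
  using assms(1)
proof induction
  case (power n)
  show ?case using assms(2)
  proof induction
    case (power m)
    show ?case by (simp add: power_add[symmetric] nonneg_poly.power)
  qed (auto simp: distrib_left intro: nonneg_poly.intros)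
qed (auto simp: distrib_right intro: nonneg_poly.intros)

lemma nonneg_poly_commute:
  assumes "S \<in> nonneg_poly x" "T * x = x * T" shows "T * S = S * T"
  using assms(1)
proof induction
  case (power n)
  show ?case by (induction n) (use assms(2) in \<open>simp_all add: mult.assoc[symmetric]\<close>, simp add: mult.assoc)
qed (auto simp: distrib_left distrib_right)

lemma power_adj: "adj (x ^ n) = adj x ^ n"
  by (induction n) (simp_all add: power_commutes)

lemma nonneg_poly_pos:
  assumes "S \<in> nonneg_poly x" "pos x" shows "pos S"
  using assms(1)
proof induction
  case (power n)
  have "pos (adj (x ^ (n div 2)) * x ^ (n mod 2) * x ^ (n div 2))"
    by (rule pos_conj) (use assms(2) in \<open>cases "even n"; simp add: mod2_eq_if\<close>)
  also have "adj (x ^ (n div 2)) * x ^ (n mod 2) * x ^ (n div 2) = x ^ n"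
    unfolding power_adj posD(1)[OF assms(2)] power_add[symmetric]
    by (rule arg_cong[where f = "(^) x"]) presburger
  finally show ?case .
qed (auto intro: pos_add pos_scale)

text \<open>The square root of a contraction \<open>1 - x\<close> is \<open>1 - y\<close> where \<open>y\<close> is the limit of the increasing
  iteration \<open>y \<mapsto> (x + y\<^sup>2) / 2\<close>.\<close>

lemma sqrt_contraction:
  assumes c: "pos c" "pos (1 - c)"
  obtains b where "pos b" "b * b = c" "\<And>T. T * c = c * T \<Longrightarrow> T * b = b * T"
proof -
  define x where "x = 1 - c"
  have x: "pos x" using c by (simp add: x_def)
  have x1: "opbound 1 x"
  proof (rule pos_norm_le(2)[OF x])
    show "Re (cinner v (x \<cdot> v)) \<le> 1 * (norm v)\<^sup>2" for v
      using posD(2)[OF c(1), of v] by (simp add: x_def cinner_linear)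
  qed simp
  define h :: complex where "h = complex_of_real (1/2)"
  define Y where "Y = rec_nat (0::'a bop) (\<lambda>_ y. h *\<^sub>C (x + y * y))"
  have Y0: "Y 0 = 0" and YS: "Y (Suc n) = h *\<^sub>C (x + Y n * Y n)" for n by (simp_all add: Y_def)
  have xN: "x \<in> nonneg_poly x" using nonneg_poly.power[of x 1] by simp
  have zN: "0 \<in> nonneg_poly x" using nonneg_poly.scale[OF _ xN, of 0] by simp
  have YN: "Y n \<in> nonneg_poly x" for n
    by (induction n) (simp_all add: Y0 YS h_def zN xN nonneg_poly_mult nonneg_poly.add nonneg_poly.scale del: of_real_divide)
  have comm: "S * T = T * S" if "S \<in> nonneg_poly x" "T \<in> nonneg_poly x" for S T
    using nonneg_poly_commute[OF that(2), of S] nonneg_poly_commute[OF that(1), of x] by simp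
  have incN: "Y (Suc n) - Y n \<in> nonneg_poly x" for n
  proof (induction n)
    case 0
    show ?case by (simp add: Y0 YS h_def xN nonneg_poly.scale del: of_real_divide)
  next
    case (Suc n)
    have sq: "S * S - T * T = (S - T) * (S + T)" if "S * T = T * S" for S T :: "'a bop"
      using that by (simp add: algebra_simps)
    have "Y (Suc (Suc n)) - Y (Suc n) = h *\<^sub>C (x + Y (Suc n) * Y (Suc n)) - h *\<^sub>C (x + Y n * Y n)"
      by (simp only: YS[of "Suc n"] YS[of n])
    also have "\<dots> = h *\<^sub>C (Y (Suc n) * Y (Suc n) - Y n * Y n)"
      by (simp only: scaleC_diff_right[symmetric] add_diff_cancel_left)
    also have "\<dots> = h *\<^sub>C ((Y (Suc n) - Y n) * (Y (Suc n) + Y n))"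
      by (simp only: sq[OF comm[OF YN[of "Suc n"] YN[of n]]])
    finally have "Y (Suc (Suc n)) - Y (Suc n) = h *\<^sub>C ((Y (Suc n) - Y n) * (Y (Suc n) + Y n))" .
    then show ?case
      using nonneg_poly_mult[OF Suc nonneg_poly.add[OF YN[of "Suc n"] YN[of n]]]
      by (simp add: h_def nonneg_poly.scale del: of_real_divide)
  qed
  have bd: "opbound 1 (Y n)" for n
  proof (induction n)
    case 0 show ?case by (simp add: Y0 opbound_def)
  next
    case (Suc n)
    have "opbound (cmod h * (1 + 1 * 1)) (Y (Suc n))"
      unfolding YS by (intro opbound_scaleC opbound_add opbound_mult x1 Suc)
    then show ?case by (simp add: h_def)
  qed
  have le1: "pos (1 - Y n)" for n
  proof -
    have "adj (Y n) = Y n" using nonneg_poly_pos[OF YN x] by (rule posD)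
    then show ?thesis
      using opbound_form_le[OF bd[of n]] by (simp add: pos_def cinner_linear)
  qed
  obtain y where y: "strong_lim Y y" "pos (1 - y)"
    using monotone_strong_lim[of Y] nonneg_poly_pos[OF YN x] le1 nonneg_poly_pos[OF incN x] by metis
  have "strong_lim (\<lambda>n. h *\<^sub>C (x + Y n * Y n)) (h *\<^sub>C (x + y * y))"
    by (intro strong_lim_scaleC strong_lim_add strong_lim_const strong_lim_mult[OF y(1) bd y(1)])
  then have fp: "y = h *\<^sub>C (x + y * y)"
    by (intro strong_lim_unique[OF strong_lim_Suc[OF y(1)]]) (simp only: YS)
  have "y + y = h *\<^sub>C (x + y * y) + h *\<^sub>C (x + y * y)"
    by (rule arg_cong2[where f = "(+)"]) (rule fp)+
  also have "\<dots> = x + y * y" by (simp add: scaleC_add_left[symmetric] h_def)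
  finally have yy: "y + y = x + y * y" .
  show ?thesis
  proof
    show "pos (1 - y)" by fact
    have "(1 - y) * (1 - y) = 1 - (y + y) + y * y" by (simp add: algebra_simps)
    then show "(1 - y) * (1 - y) = c" unfolding yy by (simp add: x_def)
    fix T assume "T * c = c * T"
    then have "T * x = x * T" by (simp add: x_def algebra_simps)
    then have "T * Y n = Y n * T" for n using nonneg_poly_commute[OF YN] by blast
    then have "strong_lim (\<lambda>n. T * Y n) (y * T)"
      using strong_lim_mult_right[OF y(1), of T] by simp
    then have "T * y = y * T"
      by (rule strong_lim_unique[OF strong_lim_mult_left[OF y(1), of T]])
    then show "T * (1 - y) = (1 - y) * T" by (simp add: algebra_simps)
  qed
qed

lemma sqrt_exists:
  assumes c: "pos c"
  obtains b where "pos b" "b * b = c" "\<And>T. T * c = c * T \<Longrightarrow> T * b = b * T"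
proof -
  obtain C where C: "opbound C c" using opbound_exists by blast
  define D where "D = C + 1"
  have D: "D > 0" "opbound D c" using C opbound_mono[OF C, of D] by (auto simp: D_def opbound_def)
  define c' where "c' = complex_of_real (1 / D) *\<^sub>C c"
  have c'_c: "c = complex_of_real D *\<^sub>C c'" using D by (simp add: c'_def)
  have "pos c'" using c D by (simp add: c'_def pos_scale del: of_real_divide)
  moreover have "pos (1 - c')"
  proof -
    have "Re (cinner v (c' \<cdot> v)) \<le> (norm v)\<^sup>2" for v
      using opbound_form_le[OF D(2), of v] D by (simp add: c'_def cinner_linear field_simps)
    then show ?thesis using \<open>pos c'\<close> by (simp add: pos_def cinner_linear)
  qed
  ultimately obtain b where b: "pos b" "b * b = c'" "\<And>T. T * c' = c' * T \<Longrightarrow> T * b = b * T"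
    using sqrt_contraction by blast
  define s where "s = complex_of_real (sqrt D)"
  have ss: "s * s = complex_of_real D" unfolding s_def of_real_mult[symmetric] using D by simp
  show ?thesis
  proof
    show "pos (s *\<^sub>C b)" unfolding s_def by (rule pos_scale[OF _ b(1)]) (use D in simp)
    show "(s *\<^sub>C b) * (s *\<^sub>C b) = c" by (simp add: ss b(2) c'_c)
    show "T * (s *\<^sub>C b) = (s *\<^sub>C b) * T" if "T * c = c * T" for T
      using b(3)[of T] that by (simp add: c'_def)
  qed
qed

subsection \<open>Resolvents\<close>

text \<open>The function \<open>y \<mapsto> 1 - (1 + y)\<^sup>-\<^sup>1\<close> is bounded, monotone and algebraic, so that it survives
  isomorphisms. It serves where spectral projections are customary.\<close>

definition resolvent :: "'h::chilbert_space bop \<Rightarrow> 'h bop" where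
  "resolvent y = (SOME k. k * (1 + y) = 1 \<and> (1 + y) * k = 1)"

lemma resolvent:
  assumes y: "pos y"
  shows "resolvent y * (1 + y) = 1" "(1 + y) * resolvent y = 1"
proof -
  have lb: "(norm v)\<^sup>2 \<le> Re (cinner v ((1 + y) \<cdot> v))" for v
    using posD(2)[OF y, of v] by (simp add: cinner_linear)
  have sa: "cinner ((1 + y) \<cdot> v) w = cinner v ((1 + y) \<cdot> w)" for v w
    by (metis adj_simps(2) adj_simps(6) cinner_adj_left posD(1) y)
  have nb: "norm v \<le> norm ((1 + y) \<cdot> v)" for v
  proof (cases "v = 0")
    case False
    have "norm v * norm v \<le> norm v * norm ((1 + y) \<cdot> v)"
      using lb[of v] complex_Re_le_cmod[of "cinner v ((1 + y) \<cdot> v)"] cinner_Cauchy_Schwarz[of v "(1 + y) \<cdot> v"]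
      by (simp add: power2_eq_square)
    then show ?thesis using False by simp
  qed simp
  have surj: "\<exists>w. (1 + y) \<cdot> w = v" for v
  proof -
    obtain w where w: "\<And>x. cinner v x = cinner w ((1 + y) \<cdot> x)"
      by (rule coercive_form_represents[of "1 + y" "\<lambda>x. cinner v x" "norm v"])
         (use sa lb in \<open>auto simp: cinner_linear cinner_Cauchy_Schwarz\<close>)
    have "(1 + y) \<cdot> w = v"
    proof (rule cinner_eqI)
      fix z
      have "cinner ((1 + y) \<cdot> w) z = cinner v z" using w[of z] sa[of w z] by simp
      then show "cinner z ((1 + y) \<cdot> w) = cinner z v" by (subst (1 2) cinner_commute) simp
    qed
    then show ?thesis by blast
  qed
  then obtain f where f: "\<And>v. (1 + y) \<cdot> f v = v" by metis
  have inj: "v = w" if "(1 + y) \<cdot> v = (1 + y) \<cdot> w" for v w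
    using nb[of "v - w"] that by (simp add: algebra_simps)
  obtain k where k: "\<And>v. k \<cdot> v = f v"
  proof (rule bop_exists[of f 1])
    show "f (v + w) = f v + f w" for v w by (rule inj) (simp only: f bop_linear_simps(1))
    show "f (c *\<^sub>C v) = c *\<^sub>C f v" for c v by (rule inj) (simp only: f bop_linear_simps(5))
    show "norm (f v) \<le> 1 * norm v" for v using nb[of "f v"] f[of v] by simp
  qed auto
  have "(1 + y) * k = 1" by (rule bop_eqI) (simp only: bop_apply_simps(1) k f bop_apply_simps(6))
  moreover have "k * (1 + y) = 1"
    by (rule bop_eqI, rule inj) (simp only: bop_apply_simps(1) k f bop_apply_simps(6))
  ultimately have "\<exists>k. k * (1 + y) = 1 \<and> (1 + y) * k = 1" by blast
  then have "resolvent y * (1 + y) = 1 \<and> (1 + y) * resolvent y = 1"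
    unfolding resolvent_def by (rule someI_ex)
  then show "resolvent y * (1 + y) = 1" "(1 + y) * resolvent y = 1" by auto
qed

lemma resolvent_commute:
  assumes "pos y" "T * y = y * T" shows "T * resolvent y = resolvent y * T"
proof -
  have "T * (1 + y) = (1 + y) * T" using assms by (simp add: algebra_simps)
  then have "resolvent y * (T * (1 + y)) * resolvent y = resolvent y * ((1 + y) * T) * resolvent y" by simp
  then have "resolvent y * T * ((1 + y) * resolvent y) = (resolvent y * (1 + y)) * T * resolvent y"
    by (simp only: mult.assoc)
  then show ?thesis by (simp only: resolvent[OF assms(1)] mult_1_left mult_1_right)
qed

lemma resolvent_adj:
  assumes "pos y" shows "adj (resolvent y) = resolvent y"
proof -
  have "adj (resolvent y) * (1 + y) = 1"
    using arg_cong[OF resolvent(2)[OF assms], of adj] posD(1)[OF assms] by simp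
  then have "adj (resolvent y) * ((1 + y) * resolvent y) = 1 * resolvent y" by (simp only: mult.assoc[symmetric])
  then show ?thesis by (simp only: resolvent[OF assms] mult_1_left mult_1_right)
qed

lemma resolvent_pos:
  assumes "pos y" shows "pos (resolvent y)"
proof -
  have "resolvent y = adj (resolvent y) * (1 + y) * resolvent y"
    by (simp only: resolvent_adj[OF assms] resolvent[OF assms] mult_1_left)
  also have "pos \<dots>" by (intro pos_conj pos_add pos_1 assms)
  finally show ?thesis .
qed

lemma resolvent_compl:
  assumes "pos y"
  shows "1 - resolvent y = y * resolvent y" "y * resolvent y = resolvent y * y"
    and "1 - resolvent y = adj (resolvent y) * y * resolvent y + adj (y * resolvent y) * (y * resolvent y)"
    and "y - (1 - resolvent y) = adj y * resolvent y * y"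
proof -
  let ?k = "resolvent y"
  show a: "1 - ?k = y * ?k" using resolvent(2)[OF assms] by (simp add: algebra_simps)
  show b: "y * ?k = ?k * y" by (rule resolvent_commute[OF assms]) simp
  have "y * ?k = (?k * (1 + y)) * (y * ?k)" by (simp only: resolvent[OF assms] mult_1_left)
  also have "\<dots> = ?k * y * ?k + (?k * y) * (y * ?k)" by (simp add: algebra_simps)
  finally show "1 - ?k = adj ?k * y * ?k + adj (y * ?k) * (y * ?k)"
    by (simp add: a resolvent_adj posD(1) assms)
  have "y - (1 - ?k) = y * (1 - ?k)" unfolding a
    by (simp only: a[symmetric] right_diff_distrib mult_1_right)
  also have "\<dots> = y * (?k * y)" by (simp only: a b)
  finally show "y - (1 - ?k) = adj y * ?k * y"
    by (simp only: posD(1)[OF assms] mult.assoc)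
qed

lemma resolvent_compl_pos:
  assumes "pos y" shows "pos (1 - resolvent y)"
  unfolding resolvent_compl(3)[OF assms] by (intro pos_add pos_conj pos_adj_mult assms)

text \<open>With \<open>k = (1 + y)\<^sup>-\<^sup>1\<close> and \<open>l = (1 + y + d)\<^sup>-\<^sup>1\<close> the difference \<open>k - l = l d k\<close> equals
  \<open>l d l + (d l)\<^sup>* k (d l)\<close>, because \<open>k = l + k d l\<close>.\<close>

lemma resolvent_antimono:
  assumes y: "pos y" and d: "pos d"
  shows "pos (resolvent y - resolvent (y + d))"
proof -
  let ?k = "resolvent y" and ?l = "resolvent (y + d)"
  have yd: "pos (y + d)" using assms by (rule pos_add)
  have "?l * d * ?k = ?l * ((1 + (y + d)) - (1 + y)) * ?k" by simp
  also have "\<dots> = (?l * (1 + (y + d))) * ?k - ?l * ((1 + y) * ?k)"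
    by (simp only: right_diff_distrib left_diff_distrib mult.assoc)
  also have "\<dots> = ?k - ?l" by (simp only: resolvent[OF yd] resolvent[OF y] mult_1_left mult_1_right)
  finally have 1: "?k - ?l = ?l * d * ?k" by simp
  have "?k * d * ?l = adj (?l * d * ?k)"
    by (simp add: resolvent_adj y yd posD(1)[OF d] mult.assoc)
  also have "\<dots> = ?k - ?l" unfolding 1[symmetric] by (simp add: resolvent_adj y yd)
  finally have 2: "?k = ?l + ?k * d * ?l" by simp
  have "?l * d * ?k = ?l * d * ?l + ?l * d * (?k * d * ?l)"
    using arg_cong[OF 2, of "\<lambda>z. ?l * d * z"] by (simp only: distrib_left)
  also have "\<dots> = adj ?l * d * ?l + adj (d * ?l) * ?k * (d * ?l)"
    by (simp add: resolvent_adj y yd posD(1)[OF d] mult.assoc)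
  finally have 3: "?k - ?l = adj ?l * d * ?l + adj (d * ?l) * ?k * (d * ?l)" unfolding 1 .
  show ?thesis unfolding 3 by (rule pos_add; rule pos_conj) (use d resolvent_pos[OF y] in auto)
qed

section \<open>Von Neumann algebras with a faithful normal trace\<close>

lemma projectionD: "projection p \<Longrightarrow> adj p = p" "projection p \<Longrightarrow> p * p = p"
  by (auto simp: projection_def)

lemma projection_1 [simp]: "projection 1"
  by (simp add: projection_def)

lemma projection_bounds:
  assumes "projection p" shows "opbound 1 p" "pos p" "pos (1 - p)"
proof -
  have sq: "Re (cinner v (p \<cdot> v)) = (norm (p \<cdot> v))\<^sup>2" for v
    using norm_bop_sq[of p v] by (simp add: projectionD[OF assms])
  then show pp: "pos p" by (simp add: pos_def projectionD[OF assms])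
  have le: "norm (p \<cdot> v) \<le> norm v" for v
  proof (cases "p \<cdot> v = 0")
    case False
    have "norm (p \<cdot> v) * norm (p \<cdot> v) \<le> norm v * norm (p \<cdot> v)"
      using sq[of v] complex_Re_le_cmod[of "cinner v (p \<cdot> v)"] cinner_Cauchy_Schwarz[of v "p \<cdot> v"]
      by (simp add: power2_eq_square)
    then show ?thesis using False by simp
  qed simp
  then show "opbound 1 p" by (simp add: opbound_def)
  show "pos (1 - p)"
    using le by (auto simp: pos_def projectionD[OF assms] cinner_linear sq power_mono)
qed

lemma commutantD:
  assumes "T \<in> commutant p X"
  shows "p * T * p = T" "x \<in> X \<Longrightarrow> T * x = x * T"
  using assms by (auto simp: commutant_def)

lemma commutant_unit:
  assumes "T \<in> commutant p X" "p * p = p" shows "p * T = T" "T * p = T"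
  using commutantD(1)[OF assms(1)] assms(2) by (metis mult.assoc)+

lemma commutant_closed:
  assumes p: "p * p = p" and S: "S \<in> commutant p X" and T: "T \<in> commutant p X"
  shows "S + T \<in> commutant p X" "S - T \<in> commutant p X" "S * T \<in> commutant p X" "c *\<^sub>C S \<in> commutant p X"
proof -
  have "p * (S * T) * p = S * T"
    using commutant_unit[OF S p] commutant_unit[OF T p] by (metis mult.assoc)
  moreover have "(S * T) * x = x * (S * T)" if "x \<in> X" for x
    using commutantD(2)[OF S that] commutantD(2)[OF T that] by (metis mult.assoc)
  ultimately show "S * T \<in> commutant p X" by (simp add: commutant_def)
qed (use S T in \<open>auto simp: commutant_def distrib_left distrib_right left_diff_distrib right_diff_distrib\<close>)

lemma commutant_strong_lim:
  assumes "strong_lim X T" "\<And>n. X n \<in> commutant p Y" shows "T \<in> commutant p Y"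
proof -
  have "strong_lim (\<lambda>n. p * X n * p) (p * T * p)"
    by (intro strong_lim_mult_left strong_lim_mult_right assms)
  then have 1: "p * T * p = T"
    using strong_lim_unique assms commutantD(1)[OF assms(2)] by auto
  have "T * x = x * T" if "x \<in> Y" for x
  proof -
    have "strong_lim (\<lambda>n. X n * x) (x * T)"
      using strong_lim_mult_left[OF assms(1), of x] commutantD(2)[OF assms(2) that] by simp
    then show ?thesis by (rule strong_lim_unique[OF strong_lim_mult_right[OF assms(1), of x]])
  qed
  with 1 show ?thesis by (simp add: commutant_def)
qed

lemma commutant_adj:
  assumes "T \<in> commutant p X" "adj p = p" "adj ` X \<subseteq> X" shows "adj T \<in> commutant p X"
proof -
  have "p * adj T * p = adj T"
    using arg_cong[OF commutantD(1)[OF assms(1)], of adj] assms(2) by (simp add: mult.assoc)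
  moreover have "adj T * x = x * adj T" if "x \<in> X" for x
  proof -
    have "adj x \<in> X" using that assms(3) by blast
    from arg_cong[OF commutantD(2)[OF assms(1) this], of adj] show ?thesis by simp
  qed
  ultimately show ?thesis by (simp add: commutant_def)
qed

context
  fixes p :: "'h::chilbert_space bop" and A :: "'h bop set"
  assumes vN: "von_neumann_algebra p A"
begin

lemma vN_projection: "projection p" and vN_bicommutant: "commutant p (commutant p A) = A"
  and vN_adj: "x \<in> A \<Longrightarrow> adj x \<in> A"
  using vN by (auto simp: von_neumann_algebra_def)

lemma vN_pp: "p * p = p" "adj p = p"
  using vN_projection by (auto simp: projectionD)

lemma vN_closed:
  "x \<in> A \<Longrightarrow> y \<in> A \<Longrightarrow> x + y \<in> A" "x \<in> A \<Longrightarrow> y \<in> A \<Longrightarrow> x - y \<in> A" "x \<in> A \<Longrightarrow> y \<in> A \<Longrightarrow> x * y \<in> A"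
  "x \<in> A \<Longrightarrow> c *\<^sub>C x \<in> A"
proof -
  note c = commutant_closed[OF vN_pp(1), of _ "commutant p A", unfolded vN_bicommutant]
  show "x \<in> A \<Longrightarrow> y \<in> A \<Longrightarrow> x + y \<in> A" by (rule c(1))
  show "x \<in> A \<Longrightarrow> y \<in> A \<Longrightarrow> x - y \<in> A" by (rule c(2))
  show "x \<in> A \<Longrightarrow> y \<in> A \<Longrightarrow> x * y \<in> A" by (rule c(3))
  show "x \<in> A \<Longrightarrow> c *\<^sub>C x \<in> A" by (rule c(4))
qed

lemma vN_unit: "x \<in> A \<Longrightarrow> p * x = x" "x \<in> A \<Longrightarrow> x * p = x"
  using commutant_unit[of x p "commutant p A"] vN_bicommutant vN_pp by auto

lemma vN_unit_mem: "p \<in> A"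
proof -
  have "p \<in> commutant p (commutant p A)"
    using commutant_unit[of _ p A] vN_pp by (auto simp: commutant_def[of p "commutant p A"])
  then show ?thesis by (simp add: vN_bicommutant)
qed

lemma vN_0: "0 \<in> A"
  using vN_closed(4)[OF vN_unit_mem, of 0] by simp

lemma vN_strong_lim: "strong_lim X T \<Longrightarrow> (\<And>n. X n \<in> A) \<Longrightarrow> T \<in> A"
  using commutant_strong_lim[of X T p "commutant p A"] vN_bicommutant by simp

lemma vN_memI: "p * T * p = T \<Longrightarrow> (\<And>S. S \<in> commutant p A \<Longrightarrow> S * T = T * S) \<Longrightarrow> T \<in> A"
  using vN_bicommutant by (auto simp: commutant_def[of p "commutant p A"])

lemma vN_sqrt:
  assumes "c \<in> A" "pos c" obtains b where "b \<in> A" "pos b" "b * b = c"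
proof -
  obtain b where b: "pos b" "b * b = c" "\<And>T. T * c = c * T \<Longrightarrow> T * b = b * T"
    using sqrt_exists[OF assms(2)] by blast
  \<comment> \<open>The square root lives on the subspace of \<open>p\<close> because its square does.\<close>
  have "b * (1 - p) = 0"
  proof (rule bop_eqI)
    fix v
    have "(norm ((b * (1 - p)) \<cdot> v))\<^sup>2 = Re (cinner v ((adj (1 - p) * (b * b) * (1 - p)) \<cdot> v))"
      unfolding norm_bop_sq by (simp add: posD(1)[OF b(1)] mult.assoc)
    also have "b * b * (1 - p) = 0" using vN_unit[OF assms(1)] b(2) by (simp add: right_diff_distrib)
    then have "adj (1 - p) * (b * b) * (1 - p) = 0" by (simp only: mult.assoc mult_zero_right)
    finally show "(b * (1 - p)) \<cdot> v = 0 \<cdot> v" by simp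
  qed
  then have bp: "b * p = b" by (simp add: right_diff_distrib)
  then have pb: "p * b = b" using b(3)[of p] vN_unit[OF assms(1)] by simp
  have "b \<in> A"
  proof (rule vN_memI)
    show "p * b * p = b" by (simp add: pb bp)
    show "S * b = b * S" if "S \<in> commutant p A" for S
      using b(3)[of S] commutantD(2)[OF that assms(1)] by simp
  qed
  with b that show ?thesis by blast
qed

end

lemma vN_resolvent:
  assumes "von_neumann_algebra 1 A" "y \<in> A" "pos y" shows "resolvent y \<in> A"
  by (rule vN_memI[OF assms(1)]) (use resolvent_commute[OF assms(3)] commutantD(2)[OF _ assms(2)] in auto)

subsection \<open>Isomorphisms\<close>

lemma star_isoD:
  assumes "star_iso A B \<phi>"
  shows "bij_betw \<phi> A B" "x \<in> A \<Longrightarrow> \<phi> x \<in> B"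
    "x \<in> A \<Longrightarrow> y \<in> A \<Longrightarrow> \<phi> (x + y) = \<phi> x + \<phi> y" "x \<in> A \<Longrightarrow> \<phi> (c *\<^sub>C x) = c *\<^sub>C \<phi> x"
    "x \<in> A \<Longrightarrow> y \<in> A \<Longrightarrow> \<phi> (x * y) = \<phi> x * \<phi> y" "x \<in> A \<Longrightarrow> \<phi> (adj x) = adj (\<phi> x)"
    "x \<in> A \<Longrightarrow> y \<in> A \<Longrightarrow> \<phi> x = \<phi> y \<longleftrightarrow> x = y" "\<phi> ` A = B"
  using assms by (auto simp: star_iso_def bij_betw_def inj_on_eq_iff)

lemma star_iso_comp: "star_iso A B \<phi> \<Longrightarrow> star_iso B C \<psi> \<Longrightarrow> star_iso A C (\<lambda>x. \<psi> (\<phi> x))"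
  unfolding star_iso_def
  by (auto intro: bij_betw_trans[unfolded comp_def] simp: bij_betwE)

lemma star_iso_cong: "star_iso A B \<phi> \<Longrightarrow> von_neumann_algebra p A \<Longrightarrow> (\<And>x. x \<in> A \<Longrightarrow> \<psi> x = \<phi> x) \<Longrightarrow> star_iso A B \<psi>"
  unfolding star_iso_def by (auto simp: vN_closed vN_adj cong: bij_betw_cong)

context
  fixes p p' :: "'h::chilbert_space bop" and A B :: "'h bop set" and \<phi> :: "'h bop \<Rightarrow> 'h bop"
  assumes A: "von_neumann_algebra p A" and B: "von_neumann_algebra p' B" and iso: "star_iso A B \<phi>"
begin

lemma star_iso_0: "\<phi> 0 = 0"
  using star_isoD(4)[OF iso vN_unit_mem[OF A], of 0] by simp

lemma star_iso_diff: "x \<in> A \<Longrightarrow> y \<in> A \<Longrightarrow> \<phi> (x - y) = \<phi> x - \<phi> y"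
  using star_isoD(3)[OF iso, of "x - y" y] vN_closed[OF A] by simp

lemma star_iso_unit: "\<phi> p = p'"
proof -
  obtain q where q: "q \<in> A" "\<phi> q = p'" using star_isoD(8)[OF iso] vN_unit_mem[OF B] by blast
  have "\<phi> p = \<phi> p * \<phi> q" using vN_unit(2)[OF B star_isoD(2)[OF iso vN_unit_mem[OF A]]] q by simp
  also have "\<dots> = \<phi> q" using star_isoD(5)[OF iso vN_unit_mem[OF A] q(1)] vN_unit[OF A q(1)] by simp
  finally show ?thesis using q by simp
qed

lemma star_iso_pos: "x \<in> A \<Longrightarrow> pos x \<Longrightarrow> pos (\<phi> x)"
proof -
  assume x: "x \<in> A" "pos x"
  obtain b where b: "b \<in> A" "pos b" "b * b = x" using vN_sqrt[OF A x] by blast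
  have "\<phi> x = adj (\<phi> b) * \<phi> b"
    using star_isoD(5,6)[OF iso] b posD(1)[OF b(2)] by metis
  then show "pos (\<phi> x)" by (simp add: pos_adj_mult)
qed

lemma star_iso_inv: "star_iso B A (inv_into A \<phi>)"
proof -
  let ?g = "inv_into A \<phi>"
  have bij: "bij_betw ?g B A" by (rule bij_betw_inv_into[OF star_isoD(1)[OF iso]])
  have g: "?g y \<in> A" "\<phi> (?g y) = y" if "y \<in> B" for y
    using star_isoD(8)[OF iso] that by (auto intro: inv_into_into f_inv_into_f)
  have gI: "?g y = x" if "x \<in> A" "\<phi> x = y" for x y
    using bij_betw_inv_into_left[OF star_isoD(1)[OF iso] that(1)] that(2) by simp
  show ?thesis unfolding star_iso_def
  proof (intro conjI ballI allI)
    show "bij_betw ?g B A" by fact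
  qed (rule gI; simp add: g vN_closed[OF A] vN_adj[OF A] star_isoD(3-6)[OF iso])+
qed

end

lemma star_iso_opbound:
  assumes A: "von_neumann_algebra 1 A" and B: "von_neumann_algebra p B" and iso: "star_iso A B \<phi>"
    and x: "x \<in> A" "opbound C x"
  shows "opbound C (\<phi> x)"
proof -
  have C: "0 \<le> C" using x by (simp add: opbound_def)
  let ?c = "complex_of_real (C\<^sup>2)"
  have 1: "1 \<in> A" by (rule vN_unit_mem[OF A])
  have m: "?c *\<^sub>C 1 \<in> A" "adj x * x \<in> A" using vN_closed[OF A] vN_adj[OF A] 1 x by auto
  have "pos (\<phi> (?c *\<^sub>C 1 - adj x * x))"
    by (rule star_iso_pos[OF A B iso]) (use m x opbound_adj_mult_iff[OF C, of x] vN_closed[OF A] in auto)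
  also have "\<phi> (?c *\<^sub>C 1 - adj x * x) = ?c *\<^sub>C p - adj (\<phi> x) * \<phi> x"
    using m 1 x vN_adj[OF A] by (simp only: star_iso_diff[OF A B iso] star_isoD(4-6)[OF iso] star_iso_unit[OF A B iso])
  finally have "pos (?c *\<^sub>C p - adj (\<phi> x) * \<phi> x)" .
  moreover have "pos (?c *\<^sub>C (1 - p))"
    by (intro pos_scale projection_bounds vN_projection[OF B]) simp
  ultimately have "pos ((?c *\<^sub>C p - adj (\<phi> x) * \<phi> x) + ?c *\<^sub>C (1 - p))" by (rule pos_add)
  then show ?thesis
    unfolding opbound_adj_mult_iff[OF C] by (simp add: scaleC_diff_right)
qed

subsection \<open>Traces\<close>

locale tracial =
  fixes A :: "'h::chilbert_space bop set" and \<tau> :: "'h bop \<Rightarrow> complex"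
  assumes vN: "von_neumann_algebra 1 A" and trace: "normal_trace 1 A \<tau>"
begin

lemmas mem_closed [simp, intro] = vN_closed[OF vN] vN_adj[OF vN] vN_unit_mem[OF vN] vN_0[OF vN]
  vN_resolvent[OF vN]

lemma tr_add: "x \<in> A \<Longrightarrow> y \<in> A \<Longrightarrow> \<tau> (x + y) = \<tau> x + \<tau> y"
  and tr_scale: "x \<in> A \<Longrightarrow> \<tau> (c *\<^sub>C x) = c * \<tau> x"
  and tr_1 [simp]: "\<tau> 1 = 1"
  and tr_nonneg: "x \<in> A \<Longrightarrow> \<tau> (adj x * x) \<in> \<real>\<^sub>\<ge>\<^sub>0"
  and tr_faithful: "x \<in> A \<Longrightarrow> \<tau> (adj x * x) = 0 \<Longrightarrow> x = 0"
  and tr_commute: "x \<in> A \<Longrightarrow> y \<in> A \<Longrightarrow> \<tau> (x * y) = \<tau> (y * x)"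
  and tr_uw: "ultraweakly_continuous_on A \<tau>"
proof -
  have h: "\<forall>x\<in>A. \<forall>y\<in>A. \<tau> (x + y) = \<tau> x + \<tau> y" "\<forall>c. \<forall>x\<in>A. \<tau> (c *\<^sub>C x) = c * \<tau> x" "\<tau> 1 = 1"
    "\<forall>x\<in>A. \<tau> (adj x * x) \<in> \<real>\<^sub>\<ge>\<^sub>0" "\<forall>x\<in>A. \<tau> (adj x * x) = 0 \<longrightarrow> x = 0"
    "\<forall>x\<in>A. \<forall>y\<in>A. \<tau> (x * y) = \<tau> (y * x)" "ultraweakly_continuous_on A \<tau>"
    using trace unfolding normal_trace_def by - (elim conjE; assumption)+
  show "x \<in> A \<Longrightarrow> y \<in> A \<Longrightarrow> \<tau> (x + y) = \<tau> x + \<tau> y" by (rule h(1)[rule_format])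
  show "x \<in> A \<Longrightarrow> \<tau> (c *\<^sub>C x) = c * \<tau> x" by (rule h(2)[rule_format])
  show "\<tau> 1 = 1" by (rule h(3))
  show "x \<in> A \<Longrightarrow> \<tau> (adj x * x) \<in> \<real>\<^sub>\<ge>\<^sub>0" by (rule h(4)[rule_format])
  show "x \<in> A \<Longrightarrow> \<tau> (adj x * x) = 0 \<Longrightarrow> x = 0" by (rule h(5)[rule_format])
  show "x \<in> A \<Longrightarrow> y \<in> A \<Longrightarrow> \<tau> (x * y) = \<tau> (y * x)" by (rule h(6)[rule_format])
  show "ultraweakly_continuous_on A \<tau>" by (rule h(7))
qed

lemma tr_0 [simp]: "\<tau> 0 = 0"
  using tr_scale[of 1 0] by simp

lemma tr_diff: "x \<in> A \<Longrightarrow> y \<in> A \<Longrightarrow> \<tau> (x - y) = \<tau> x - \<tau> y"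
  using tr_add[of "x - y" y] by simp

text \<open>The square of the 2-norm.\<close>

definition tn :: "'h bop \<Rightarrow> real" where
  "tn x = Re (\<tau> (adj x * x))"

lemma tn_nonneg: "x \<in> A \<Longrightarrow> 0 \<le> tn x" and tr_tn: "x \<in> A \<Longrightarrow> \<tau> (adj x * x) = complex_of_real (tn x)"
  using tr_nonneg[of x] by (auto simp: tn_def complex_nonneg_Reals_iff complex_eq_iff)

lemma tn_0_iff: assumes "x \<in> A" shows "tn x = 0 \<longleftrightarrow> x = 0"
proof
  assume "tn x = 0"
  then have "\<tau> (adj x * x) = 0" by (simp only: tr_tn[OF assms]) simp
  then show "x = 0" by (rule tr_faithful[OF assms])
qed (simp add: tn_def)

lemma tr_pos: "x \<in> A \<Longrightarrow> pos x \<Longrightarrow> 0 \<le> Re (\<tau> x)" and tr_pos_0: "x \<in> A \<Longrightarrow> pos x \<Longrightarrow> Re (\<tau> x) = 0 \<Longrightarrow> x = 0"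
proof -
  assume x: "x \<in> A" "pos x"
  obtain b where b: "b \<in> A" "pos b" "b * b = x" using vN_sqrt[OF vN x] by blast
  then have e: "Re (\<tau> x) = tn b" using posD(1)[OF b(2)] by (simp add: tn_def)
  show "0 \<le> Re (\<tau> x)" using e tn_nonneg[OF b(1)] by simp
  show "x = 0" if "Re (\<tau> x) = 0" using e that tn_0_iff[OF b(1)] b by simp
qed

text \<open>The hermitian symmetry of \<open>\<tau>(x\<^sup>*y)\<close> follows from the fact that all \<open>\<tau>(z\<^sup>*z)\<close> are real, by polarisation.\<close>

lemma tn_expand:
  assumes "x \<in> A" "y \<in> A"
  shows "tn (x + t *\<^sub>C y) = tn x + 2 * Re (t * \<tau> (adj x * y)) + (cmod t)\<^sup>2 * tn y"
    and "\<tau> (adj y * x) = cnj (\<tau> (adj x * y))"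
proof -
  have ex: "\<tau> (adj (x + t *\<^sub>C y) * (x + t *\<^sub>C y)) = complex_of_real (tn x) + t * \<tau> (adj x * y) + cnj t * \<tau> (adj y * x)
      + cnj t * t * complex_of_real (tn y)" for t
    using assms by (simp add: distrib_left distrib_right tr_add tr_scale tr_tn)
  have re: "Im (\<tau> (adj (x + t *\<^sub>C y) * (x + t *\<^sub>C y))) = 0" for t
    using tr_tn[of "x + t *\<^sub>C y"] assms by simp
  show c: "\<tau> (adj y * x) = cnj (\<tau> (adj x * y))"
    using re[of 1] re[of \<i>] unfolding ex by (simp add: complex_eq_iff)
  have "Re (\<tau> (adj (x + t *\<^sub>C y) * (x + t *\<^sub>C y))) = tn x + 2 * Re (t * \<tau> (adj x * y)) + (cmod t)\<^sup>2 * tn y"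
    unfolding ex c cmod_power2 by (simp add: algebra_simps power2_eq_square)
  then show "tn (x + t *\<^sub>C y) = tn x + 2 * Re (t * \<tau> (adj x * y)) + (cmod t)\<^sup>2 * tn y"
    by (simp add: tn_def)
qed

lemma tr_Cauchy_Schwarz:
  assumes "x \<in> A" "y \<in> A" shows "(cmod (\<tau> (adj x * y)))\<^sup>2 \<le> tn x * tn y"
proof (rule cauchy_schwarz_discriminant)
  show "0 \<le> tn x + 2 * Re (t * \<tau> (adj x * y)) + (cmod t)\<^sup>2 * tn y" for t
    using tn_expand(1)[OF assms, of t] tn_nonneg[of "x + t *\<^sub>C y"] assms by simp
qed (use assms tn_nonneg in auto)

lemma tn_parallelogram:
  assumes "x \<in> A" "y \<in> A" shows "tn (x + y) + tn (x - y) = 2 * tn x + 2 * tn y"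
  using tn_expand(1)[OF assms, of 1] tn_expand(1)[OF assms, of "-1"] by (simp add: scaleC_minus_left)

lemma tn_scale: "x \<in> A \<Longrightarrow> tn (c *\<^sub>C x) = (cmod c)\<^sup>2 * tn x"
  using tn_expand(1)[of 0 x c] by (simp add: tn_def)

lemma tn_add_le: "x \<in> A \<Longrightarrow> y \<in> A \<Longrightarrow> tn (x + y) \<le> 2 * tn x + 2 * tn y"
  using tn_parallelogram[of x y] tn_nonneg[of "x - y"] by simp

lemma tn_commute: "x \<in> A \<Longrightarrow> y \<in> A \<Longrightarrow> tn (x - y) = tn (y - x)"
  using tn_scale[of "x - y" "-1"] by (simp add: scaleC_minus_left)

lemma tn_adj: "x \<in> A \<Longrightarrow> tn (adj x) = tn x"
  by (simp add: tn_def tr_commute)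

lemma tn_mult_left:
  assumes "opbound C b" "b \<in> A" "x \<in> A" shows "tn (b * x) \<le> C\<^sup>2 * tn x"
proof -
  have "pos (adj x * (complex_of_real (C\<^sup>2) *\<^sub>C 1 - adj b * b) * x)"
    using opbound_adj_mult_iff[of C b] opboundD(2)[OF assms(1)] assms by (intro pos_conj) auto
  moreover have e: "adj x * (complex_of_real (C\<^sup>2) *\<^sub>C 1 - adj b * b) * x
      = complex_of_real (C\<^sup>2) *\<^sub>C (adj x * x) - adj (b * x) * (b * x)"
    by (simp add: left_diff_distrib right_diff_distrib mult.assoc)
  ultimately have "0 \<le> Re (\<tau> (complex_of_real (C\<^sup>2) *\<^sub>C (adj x * x) - adj (b * x) * (b * x)))"
    using assms by (intro tr_pos) auto
  then show ?thesis using assms by (simp add: tr_diff tr_scale tn_def)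
qed

lemma tn_mult_right:
  assumes "opbound C b" "b \<in> A" "x \<in> A" shows "tn (x * b) \<le> C\<^sup>2 * tn x"
  using tn_mult_left[OF opbound_adj[OF assms(1)], of "adj x"] assms tn_adj[of "x * b"] tn_adj[of x] by simp

lemma tr_le_tn: "x \<in> A \<Longrightarrow> (cmod (\<tau> x))\<^sup>2 \<le> tn x"
  using tr_Cauchy_Schwarz[of 1 x] by (simp add: tn_def)

lemma tendsto_tr:
  assumes "(\<lambda>n. tn (X n - x)) \<longlonglongrightarrow> 0" "\<And>n. X n \<in> A" "x \<in> A" "b \<in> A"
  shows "(\<lambda>n. \<tau> (X n * b)) \<longlonglongrightarrow> \<tau> (x * b)"
proof -
  obtain C where C: "opbound C b" using opbound_exists by blast
  have "(\<lambda>n. (cmod (\<tau> (X n * b) - \<tau> (x * b)))\<^sup>2) \<longlonglongrightarrow> 0"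
  proof (rule Lim_null_comparison)
    show "(\<lambda>n. C\<^sup>2 * tn (X n - x)) \<longlonglongrightarrow> 0" using assms(1) by (rule tendsto_mult_right_zero)
    have "norm ((cmod (\<tau> (X n * b) - \<tau> (x * b)))\<^sup>2) \<le> C\<^sup>2 * tn (X n - x)" for n
      using tr_le_tn[of "X n * b - x * b"] tn_mult_right[OF C, of "X n - x"] assms
      by (simp add: tr_diff left_diff_distrib)
    then show "\<forall>\<^sub>F n in sequentially. norm ((cmod (\<tau> (X n * b) - \<tau> (x * b)))\<^sup>2) \<le> C\<^sup>2 * tn (X n - x)" by simp
  qed
  then have "(\<lambda>n. sqrt ((cmod (\<tau> (X n * b) - \<tau> (x * b)))\<^sup>2)) \<longlonglongrightarrow> sqrt 0"
    by (rule tendsto_real_sqrt)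
  then have "(\<lambda>n. cmod (\<tau> (X n * b) - \<tau> (x * b))) \<longlonglongrightarrow> 0" by simp
  then show ?thesis by (simp add: tendsto_norm_zero_iff LIM_zero_iff)
qed

text \<open>Dominated convergence in the series that represents the trace.\<close>

lemma tr_strong_lim:
  assumes X: "strong_lim X T" "\<And>n. opbound C (X n)" "\<And>n. X n \<in> A"
  shows "(\<lambda>n. \<tau> (X n)) \<longlonglongrightarrow> \<tau> T"
proof -
  obtain \<xi> \<eta> where s: "summable (\<lambda>n::nat. (norm (\<xi> n))\<^sup>2)" "summable (\<lambda>n. (norm (\<eta> n))\<^sup>2)"
    and t: "\<And>x. x \<in> A \<Longrightarrow> (\<lambda>n. cinner (\<xi> n) (x \<cdot> \<eta> n)) sums \<tau> x"
    using tr_uw unfolding ultraweakly_continuous_on_def by blast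
  have T: "T \<in> A" using vN_strong_lim[OF vN X(1)] X(3) by blast
  have C: "0 \<le> C" using X(2)[of 0] by (simp add: opbound_def)
  define M where "M k = C * ((norm (\<xi> k))\<^sup>2 + (norm (\<eta> k))\<^sup>2)" for k
  have "summable M" unfolding M_def by (intro summable_mult summable_add s)
  have b: "norm (cinner (\<xi> k) (X n \<cdot> \<eta> k)) \<le> M k" for k n
  proof -
    have "norm (cinner (\<xi> k) (X n \<cdot> \<eta> k)) \<le> C * (norm (\<xi> k) * norm (\<eta> k))"
      using opbound_cinner[OF X(2)[of n], of "\<xi> k" "\<eta> k"] by (simp add: mult_ac)
    also have "norm (\<xi> k) * norm (\<eta> k) \<le> (norm (\<xi> k))\<^sup>2 + (norm (\<eta> k))\<^sup>2"
      using sum_squares_bound[of "norm (\<xi> k)" "norm (\<eta> k)"]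
        mult_nonneg_nonneg[OF norm_ge_zero[of "\<xi> k"] norm_ge_zero[of "\<eta> k"]] by linarith
    finally show ?thesis using C by (simp add: M_def mult_left_mono)
  qed
  have "((\<lambda>n. \<Sum>k. cinner (\<xi> k) (X n \<cdot> \<eta> k)) \<longlonglongrightarrow> (\<Sum>k. cinner (\<xi> k) (T \<cdot> \<eta> k)))"
  proof -
    have "\<forall>\<^sub>F (k, n) in at_top \<times>\<^sub>F sequentially. norm (cinner (\<xi> k) (X n \<cdot> \<eta> k)) \<le> M k"
      using b by (simp add: case_prod_unfold)
    then show ?thesis
      using tannerys_theorem[of "\<lambda>k n. cinner (\<xi> k) (X n \<cdot> \<eta> k)" "\<lambda>k. cinner (\<xi> k) (T \<cdot> \<eta> k)" sequentially M]
        \<open>summable M\<close> tendsto_cinner[OF tendsto_const strong_limD[OF X(1)]] by simp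
  qed
  then show ?thesis using t X(3) T by (simp add: sums_iff)
qed

end

subsection \<open>Isomorphisms are normal\<close>

lemma pos_contraction: "pos T \<Longrightarrow> pos (1 - T) \<Longrightarrow> opbound 1 T"
  by (rule pos_norm_le(2)) (use posD(2)[of "1 - T"] in \<open>auto simp: cinner_linear\<close>)

context tracial
begin

text \<open>Otherwise there are uniformly bounded \<open>X\<^sub>n\<close> with summable squared 2-norms whose images do not tend to
  0 at \<open>v\<close>. The operators \<open>g\<^sub>m\<^sub>,\<^sub>k = 1 - (1 + X\<^sub>m\<^sup>*X\<^sub>m + \<dots>)\<^sup>-\<^sup>1\<close>, with \<open>k\<close> summands \<open>X\<^sub>i\<^sup>*X\<^sub>i\<close>, increase with \<open>k\<close> to some
  \<open>G\<^sub>m\<close> of small trace, and \<open>G\<^sub>m\<close> decreases to 0. An isomorphism preserves the order in both directions and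
  hence this infimum, so \<open>\<phi>(G\<^sub>m)\<close> tends strongly to 0, and \<open>g\<^sub>n\<^sub>,\<^sub>1 \<le> G\<^sub>n\<close> controls \<open>X\<^sub>n\<close>.\<close>

lemma star_iso_normal:
  assumes S: "von_neumann_algebra p S" and iso: "star_iso A S \<phi>" and e: "0 < e"
  shows "\<exists>\<delta>>0. \<forall>x\<in>A. opbound C x \<longrightarrow> tn x < \<delta> \<longrightarrow> norm (\<phi> x \<cdot> v) < e"
proof (rule ccontr)
  assume "\<not> ?thesis"
  then have "\<exists>x. x \<in> A \<and> opbound C x \<and> tn x < (1/2) ^ n \<and> e \<le> norm (\<phi> x \<cdot> v)" for n
    by (metis not_le zero_less_divide_1_iff zero_less_numeral zero_less_power)
  then obtain X where X: "\<And>n. X n \<in> A" "\<And>n. opbound C (X n)" "\<And>n. tn (X n) < (1/2) ^ n"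
    "\<And>n. e \<le> norm (\<phi> (X n) \<cdot> v)" by metis
  define h where "h n = adj (X n) * X n" for n
  have h: "h n \<in> A" "pos (h n)" for n using X by (auto simp: h_def pos_adj_mult)
  define y where "y m k = (\<Sum>n\<in>{m..<m + k}. h n)" for m k
  have y0: "y m 0 = 0" and yS: "y m (Suc k) = y m k + h (m + k)" for m k by (simp_all add: y_def)
  have yS': "y m (Suc k) = y (Suc m) k + h m" for m k
    unfolding y_def by (simp add: sum.atLeast_Suc_lessThan add.commute)
  have yA: "y m k \<in> A" "pos (y m k)" for m k
    by (induction k) (use h in \<open>auto simp: y0 yS intro: pos_add\<close>)
  have tr_y: "Re (\<tau> (y m k)) \<le> 2 * (1/2) ^ m - 2 * (1/2) ^ (m + k)" for m k
  proof (induction k)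
    case (Suc k)
    have "Re (\<tau> (h (m + k))) < (1/2) ^ (m + k)" using X(3)[of "m + k"] by (simp add: h_def tn_def)
    then show ?case using Suc h yA by (simp add: yS tr_add)
  qed (simp add: y0)
  define g where "g m k = 1 - resolvent (y m k)" for m k
  have gA: "g m k \<in> A" for m k using yA by (simp add: g_def)
  have g1: "1 - g m k = resolvent (y m k)" for m k by (simp add: g_def)
  have g_pos: "pos (g m k)" "pos (1 - g m k)" for m k
    unfolding g1 using resolvent_compl_pos[OF yA(2)] resolvent_pos[OF yA(2)] by (auto simp: g_def)
  have g_inc: "pos (g m (Suc k) - g m k)" "pos (g m (Suc k) - g (Suc m) k)" for m k
    using resolvent_antimono[OF yA(2)[of m k] h(2)[of "m + k"]]
      resolvent_antimono[OF yA(2)[of "Suc m" k] h(2)[of m]] by (simp_all add: g_def yS[symmetric] yS'[symmetric])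
  have "\<exists>T. strong_lim (g m) T \<and> (\<forall>k. pos (T - g m k)) \<and> pos T \<and> pos (1 - T)" for m
    by (rule monotone_strong_lim[of "g m"]) (use g_pos g_inc in auto)
  then obtain G where G: "\<And>m. strong_lim (g m) (G m)" "\<And>m k. pos (G m - g m k)"
    "\<And>m. pos (G m)" "\<And>m. pos (1 - G m)" by metis
  have GA: "G m \<in> A" for m using vN_strong_lim[OF vN G(1)] gA by blast
  have tr_G: "Re (\<tau> (G m)) \<le> 2 * (1/2) ^ m" for m
  proof (rule LIMSEQ_le_const2)
    show "(\<lambda>k. Re (\<tau> (g m k))) \<longlonglongrightarrow> Re (\<tau> (G m))"
      by (intro tendsto_Re tr_strong_lim[OF G(1), of 1] pos_contraction g_pos gA)
    have "Re (\<tau> (g m k)) \<le> 2 * (1/2) ^ m" for k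
    proof -
      have "pos (y m k - g m k)"
        unfolding g_def resolvent_compl(4)[OF yA(2)] by (intro pos_conj resolvent_pos yA)
      then have "0 \<le> Re (\<tau> (y m k - g m k))" using yA gA by (intro tr_pos) auto
      then have "Re (\<tau> (g m k)) \<le> Re (\<tau> (y m k))" using yA gA by (simp add: tr_diff)
      also have "\<dots> \<le> 2 * (1/2) ^ m" using tr_y[of m k] by (smt (verit) zero_le_power zero_le_divide_1_iff)
      finally show ?thesis .
    qed
    then show "\<exists>N. \<forall>n\<ge>N. Re (\<tau> (g m n)) \<le> 2 * (1/2) ^ m" by blast
  qed
  have G_dec: "pos (G m - G (Suc m))" for m
    by (rule strong_lim_pos[OF strong_lim_diff[OF strong_lim_Suc[OF G(1)] G(1)]]) (rule g_inc)
  \<comment> \<open>The infimum of the \<open>G m\<close> is \<open>1 - L\<close>; it has trace 0.\<close>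
  obtain L where L: "strong_lim (\<lambda>m. 1 - G m) L" "\<And>m. pos (L - (1 - G m))" "pos (1 - L)"
    using monotone_strong_lim[of "\<lambda>m. 1 - G m"] G(3,4) G_dec by (simp add: algebra_simps) metis
  have LA: "L \<in> A" using vN_strong_lim[OF vN L(1)] GA by simp
  have "1 - L = 0"
  proof (rule tr_pos_0)
    have le: "Re (\<tau> (1 - L)) \<le> 2 * (1/2) ^ m" for m
    proof -
      have "0 \<le> Re (\<tau> (L - (1 - G m)))" by (rule tr_pos) (use LA GA L in auto)
      then show ?thesis using tr_G[of m] LA GA by (simp add: tr_diff)
    qed
    have "(\<lambda>m. 2 * (1/2::real) ^ m) \<longlonglongrightarrow> 0"
      by (intro tendsto_mult_right_zero LIMSEQ_realpow_zero) auto
    then have "Re (\<tau> (1 - L)) \<le> 0" by (rule LIMSEQ_le_const) (use le in blast)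
    moreover have "0 \<le> Re (\<tau> (1 - L))" by (rule tr_pos) (use LA L in auto)
    ultimately show "Re (\<tau> (1 - L)) = 0" by simp
  qed (use LA L in auto)
  then have L1: "L = 1" by simp
  note \<phi>_pos = star_iso_pos[OF vN S iso] and \<phi>_diff = star_iso_diff[OF vN S iso] and \<phi>_1 = star_iso_unit[OF vN S iso]
    and \<phi>_mem = star_isoD(2)[OF iso]
  have \<phi>G: "pos (\<phi> (1 - G m))" "\<phi> (1 - G m) = p - \<phi> (G m)" for m
    using \<phi>_pos[of "1 - G m"] G GA \<phi>_diff[of 1 "G m"] \<phi>_1 by auto
  have "pos (1 - \<phi> (1 - G m))" for m
    using pos_add[OF projection_bounds(3)[OF vN_projection[OF S]] \<phi>_pos[OF GA G(3)], of m]
    by (simp add: \<phi>G(2) algebra_simps)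
  moreover have "pos (\<phi> (1 - G (Suc m)) - \<phi> (1 - G m))" for m
    using \<phi>_pos[OF _ G_dec, of m] GA \<phi>_diff[of "G m" "G (Suc m)"] by (simp add: \<phi>G(2))
  ultimately obtain K where K: "strong_lim (\<lambda>m. \<phi> (1 - G m)) K" "\<And>m. pos (K - \<phi> (1 - G m))" "pos K"
    using monotone_strong_lim[of "\<lambda>m. \<phi> (1 - G m)"] \<phi>G(1) by metis
  have KS: "K \<in> S" using vN_strong_lim[OF S K(1)] \<phi>_mem GA by simp
  have pK: "pos (p - K)"
    by (rule strong_lim_pos[OF strong_lim_diff[OF strong_lim_const K(1)]])
       (use \<phi>_pos[OF GA G(3)] in \<open>simp add: \<phi>G(2)\<close>)
  define \<psi> where "\<psi> = inv_into A \<phi>"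
  have iso': "star_iso S A \<psi>" unfolding \<psi>_def by (rule star_iso_inv[OF vN S iso])
  have \<psi>\<phi>: "\<psi> (\<phi> x) = x" if "x \<in> A" for x
    unfolding \<psi>_def by (rule bij_betw_inv_into_left[OF star_isoD(1)[OF iso] that])
  \<comment> \<open>Pulling the supremum \<open>K\<close> back along \<open>\<phi>\<close> gives an upper bound of the \<open>1 - G m\<close>.\<close>
  have "pos (\<psi> K - (1 - G m))" for m
    using star_iso_pos[OF S vN iso' _ K(2)[of m]] star_iso_diff[OF S vN iso' KS, of "\<phi> (1 - G m)"]
      vN_closed(2)[OF S KS \<phi>_mem, of "1 - G m"] GA \<phi>_mem by (simp add: \<psi>\<phi>)
  then have "pos (\<psi> K - L)"
    by (intro strong_lim_pos[OF strong_lim_diff[OF strong_lim_const L(1)]])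
  moreover have "pos (1 - \<psi> K)"
    using star_iso_pos[OF S vN iso' _ pK] star_iso_diff[OF S vN iso' vN_unit_mem[OF S] KS]
      vN_closed(2)[OF S vN_unit_mem[OF S] KS] star_iso_unit[OF S vN iso'] by simp
  ultimately have "\<psi> K - 1 = 0" by (intro pos_antisym) (simp_all add: L1)
  then have "\<psi> K = \<psi> (\<phi> 1)" by (simp add: \<psi>\<phi>)
  then have "K = \<phi> 1" using star_isoD(7)[OF iso' KS \<phi>_mem, of 1] by simp
  then have Kp: "K = p" by (simp add: \<phi>_1)
  define t where "t n = Re (cinner v (\<phi> (g n 1) \<cdot> v))" for n
  have t0: "t \<longlonglongrightarrow> 0"
  proof (rule tendsto_sandwich)
    show "(\<lambda>_. 0) \<longlonglongrightarrow> (0::real)" by simp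
    show "(\<lambda>n. Re (cinner v (p \<cdot> v - \<phi> (1 - G n) \<cdot> v))) \<longlonglongrightarrow> 0"
      using tendsto_Re[OF tendsto_cinner[OF tendsto_const tendsto_diff[OF tendsto_const strong_limD[OF K(1), of v]]], of v "p \<cdot> v"]
      by (simp add: Kp)
    show "\<forall>\<^sub>F n in sequentially. 0 \<le> t n"
      unfolding t_def using posD(2)[OF \<phi>_pos[OF gA g_pos(1)]] by simp
    have "t n \<le> Re (cinner v (p \<cdot> v - \<phi> (1 - G n) \<cdot> v))" for n
      using posD(2)[OF \<phi>_pos[OF _ G(2)], of n 1 v] GA gA \<phi>_diff[of "G n" "g n 1"]
      by (simp add: t_def \<phi>G(2) cinner_linear)
    then show "\<forall>\<^sub>F n in sequentially. t n \<le> Re (cinner v (p \<cdot> v - \<phi> (1 - G n) \<cdot> v))" by simp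
  qed
  have C: "0 \<le> C" using X(2)[of 0] by (simp add: opbound_def)
  have bound: "e \<le> (1 + C) * sqrt (t n)" for n
  proof -
    let ?k = "resolvent (h n)"
    have k: "?k \<in> A" "adj ?k = ?k" using h resolvent_adj[OF h(2)] by auto
    have m: "X n * ?k \<in> A" "h n * ?k \<in> A" "adj (X n * ?k) \<in> A" "adj (h n * ?k) \<in> A" using X k h by auto
    have "g n 1 = adj ?k * h n * ?k + adj (h n * ?k) * (h n * ?k)"
      using resolvent_compl(3)[OF h(2)[of n]] by (simp add: g_def y_def)
    also have "adj ?k * h n * ?k = adj (X n * ?k) * (X n * ?k)" by (simp add: h_def mult.assoc)
    finally have "\<phi> (g n 1) = adj (\<phi> (X n * ?k)) * \<phi> (X n * ?k) + adj (\<phi> (h n * ?k)) * \<phi> (h n * ?k)"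
      using m by (simp only: star_isoD(3,5,6)[OF iso] mem_closed)
    then have t: "t n = (norm (\<phi> (X n * ?k) \<cdot> v))\<^sup>2 + (norm (\<phi> (h n * ?k) \<cdot> v))\<^sup>2"
      unfolding t_def norm_bop_sq by (simp add: cinner_linear)
    have "X n = X n * ?k + X n * (1 - ?k)" by (simp add: right_diff_distrib)
    also have "1 - ?k = h n * ?k" by (rule resolvent_compl(1)[OF h(2)])
    finally have "\<phi> (X n) = \<phi> (X n * ?k + X n * (h n * ?k))" by (rule arg_cong)
    also have "\<dots> = \<phi> (X n * ?k) + \<phi> (X n) * \<phi> (h n * ?k)"
      using star_isoD(3)[OF iso m(1), of "X n * (h n * ?k)"] star_isoD(5)[OF iso X(1) m(2)] X m by simp
    finally have "\<phi> (X n) \<cdot> v = (\<phi> (X n * ?k) + \<phi> (X n) * \<phi> (h n * ?k)) \<cdot> v"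
      by (rule arg_cong)
    then have "\<phi> (X n) \<cdot> v = \<phi> (X n * ?k) \<cdot> v + \<phi> (X n) \<cdot> (\<phi> (h n * ?k) \<cdot> v)"
      by (simp only: bop_apply_simps)
    then have "e \<le> norm (\<phi> (X n * ?k) \<cdot> v) + norm (\<phi> (X n) \<cdot> (\<phi> (h n * ?k) \<cdot> v))"
      using X(4)[of n] norm_triangle_ineq by (metis order_trans)
    also have "norm (\<phi> (X n) \<cdot> (\<phi> (h n * ?k) \<cdot> v)) \<le> C * norm (\<phi> (h n * ?k) \<cdot> v)"
      by (rule opboundD[OF star_iso_opbound[OF vN S iso X(1,2)]])
    also have "norm (\<phi> (h n * ?k) \<cdot> v) \<le> sqrt (t n)" by (rule real_le_rsqrt) (simp add: t)
    also have "norm (\<phi> (X n * ?k) \<cdot> v) \<le> sqrt (t n)" by (rule real_le_rsqrt) (simp add: t)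
    finally show ?thesis using C by (simp add: mult_left_mono distrib_right)
  qed
  have "(\<lambda>n. (1 + C) * sqrt (t n)) \<longlonglongrightarrow> (1 + C) * sqrt 0"
    by (intro tendsto_mult tendsto_const tendsto_real_sqrt t0)
  then have "e \<le> 0" using bound by (intro LIMSEQ_le_const[of "\<lambda>n. (1 + C) * sqrt (t n)"]) auto
  then show False using e by simp
qed

lemma star_iso_id: "star_iso A A (\<lambda>x. x)"
  by (simp add: star_iso_def bij_betw_def)

lemma tn_null_strong:
  assumes S: "von_neumann_algebra p S" and iso: "star_iso A S \<phi>"
    and X: "\<And>n. X n \<in> A" "\<And>n. opbound C (X n)" "T \<in> A" and lim: "(\<lambda>n. tn (X n - T)) \<longlonglongrightarrow> 0"
  shows "strong_lim (\<lambda>n. \<phi> (X n)) (\<phi> T)"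
  unfolding strong_lim_def
proof
  fix v
  obtain D where D: "opbound D T" using opbound_exists by blast
  show "(\<lambda>n. \<phi> (X n) \<cdot> v) \<longlonglongrightarrow> \<phi> T \<cdot> v"
  proof (rule LIMSEQ_I)
    fix r :: real assume "0 < r"
    then obtain \<delta> where \<delta>: "0 < \<delta>" "\<forall>x\<in>A. opbound (C + D) x \<longrightarrow> tn x < \<delta> \<longrightarrow> norm (\<phi> x \<cdot> v) < r"
      using star_iso_normal[OF S iso] by blast
    obtain N where N: "\<And>n. n \<ge> N \<Longrightarrow> norm (tn (X n - T) - 0) < \<delta>" using LIMSEQ_D[OF lim \<delta>(1)] by blast
    have "norm (\<phi> (X n) \<cdot> v - \<phi> T \<cdot> v) < r" if "n \<ge> N" for n
    proof -
      have "tn (X n - T) < \<delta>" using N[OF that] by auto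
      then have "norm (\<phi> (X n - T) \<cdot> v) < r" using \<delta>(2) X opbound_diff[OF X(2) D] by blast
      then show ?thesis using star_iso_diff[OF vN S iso X(1) X(3)] by simp
    qed
    then show "\<exists>N. \<forall>n\<ge>N. norm (\<phi> (X n) \<cdot> v - \<phi> T \<cdot> v) < r" by blast
  qed
qed

text \<open>By the continuity of the identity isomorphism the sequence is strongly Cauchy; its strong limit is
  also the limit for the 2-norm since the trace is normal.\<close>

lemma tn_complete:
  assumes X: "\<And>n. X n \<in> A" "\<And>n. opbound C (X n)"
    and cau: "\<And>e. 0 < e \<Longrightarrow> \<exists>M. \<forall>m\<ge>M. \<forall>n\<ge>M. tn (X m - X n) < e"
  obtains T where "T \<in> A" "(\<lambda>n. tn (X n - T)) \<longlonglongrightarrow> 0"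
proof -
  have "Cauchy (\<lambda>n. X n \<cdot> v)" for v
  proof (rule CauchyI)
    fix e :: real assume "0 < e"
    then obtain \<delta> where \<delta>: "0 < \<delta>" "\<forall>x\<in>A. opbound (C + C) x \<longrightarrow> tn x < \<delta> \<longrightarrow> norm (x \<cdot> v) < e"
      using star_iso_normal[OF vN star_iso_id] by blast
    obtain M where "\<forall>m\<ge>M. \<forall>n\<ge>M. tn (X m - X n) < \<delta>" using cau[OF \<delta>(1)] by blast
    then have "\<forall>m\<ge>M. \<forall>n\<ge>M. norm ((X m - X n) \<cdot> v) < e"
      using \<delta>(2) X opbound_diff[OF X(2) X(2)] by blast
    then show "\<exists>M. \<forall>m\<ge>M. \<forall>n\<ge>M. norm (X m \<cdot> v - X n \<cdot> v) < e" by auto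
  qed
  then have "convergent (\<lambda>n. X n \<cdot> v)" for v by (rule Cauchy_convergent)
  then obtain T where T: "strong_lim X T" "opbound C T" using strong_lim_exists[of C X] X(2) by blast
  have TA: "T \<in> A" using vN_strong_lim[OF vN T(1)] X(1) by blast
  have le: "tn (X n - T) \<le> e" if "\<forall>m\<ge>M. \<forall>n\<ge>M. tn (X m - X n) < e" "n \<ge> M" "0 < e" for e M n
  proof -
    let ?t = "tn (X n - T)" and ?b = "adj (X n - T)"
    have bb: "opbound (C + C) ?b" by (intro opbound_adj opbound_diff X T)
    have "(\<lambda>m. \<tau> (?b * (X n - X m))) \<longlonglongrightarrow> \<tau> (?b * (X n - T))"
    proof (rule tr_strong_lim)
      show "strong_lim (\<lambda>m. ?b * (X n - X m)) (?b * (X n - T))"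
        by (intro strong_lim_mult_left strong_lim_diff strong_lim_const T)
      show "opbound ((C + C) * (C + C)) (?b * (X n - X m))" for m
        by (intro opbound_mult bb opbound_diff X)
    qed (use X TA in auto)
    then have "(\<lambda>m. (cmod (\<tau> (?b * (X n - X m))))\<^sup>2) \<longlonglongrightarrow> (cmod (\<tau> (?b * (X n - T))))\<^sup>2"
      by (intro tendsto_power tendsto_norm)
    moreover have "\<exists>N. \<forall>m\<ge>N. (cmod (\<tau> (?b * (X n - X m))))\<^sup>2 \<le> ?t * e"
    proof (intro exI allI impI)
      fix m assume "M \<le> m"
      then have "tn (X n - X m) \<le> e" using that by (simp add: less_imp_le)
      then show "(cmod (\<tau> (?b * (X n - X m))))\<^sup>2 \<le> ?t * e"
        using tr_Cauchy_Schwarz[of "X n - T" "X n - X m"] X TA tn_nonneg[of "X n - T"]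
        by (meson mem_closed(2) mult_left_mono order_trans)
    qed
    ultimately have "(cmod (\<tau> (?b * (X n - T))))\<^sup>2 \<le> ?t * e" by (rule LIMSEQ_le_const2)
    moreover have "(cmod (\<tau> (?b * (X n - T))))\<^sup>2 = ?t * ?t"
      using tr_tn[of "X n - T"] X TA by (simp add: power2_eq_square del: adj_simps)
    ultimately have "?t * ?t \<le> ?t * e" by simp
    then show ?thesis
      using tn_nonneg[of "X n - T"] X TA that(3) by (cases "?t = 0") auto
  qed
  have "(\<lambda>n. tn (X n - T)) \<longlonglongrightarrow> 0"
  proof (rule LIMSEQ_I)
    fix r :: real assume r: "0 < r"
    then obtain M where M: "\<forall>m\<ge>M. \<forall>n\<ge>M. tn (X m - X n) < r / 2" using cau[of "r / 2"] by auto
    have "norm (tn (X n - T) - 0) < r" if "n \<ge> M" for n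
      using le[OF M that] r tn_nonneg[of "X n - T"] X TA by auto
    then show "\<exists>M. \<forall>n\<ge>M. norm (tn (X n - T) - 0) < r" by blast
  qed
  with TA that show ?thesis by blast
qed

end

subsection \<open>Averaging over unitaries\<close>

lemma unitariesD:
  assumes "u \<in> unitaries A" shows "u \<in> A" "adj u * u = 1" "u * adj u = 1"
  using assms by (auto simp: unitaries_def)

lemma unitaries_adj: "adj ` A \<subseteq> A \<Longrightarrow> u \<in> unitaries A \<Longrightarrow> adj u \<in> unitaries A"
  by (auto simp: unitaries_def)

lemma unitary_opbound: "adj u * u = 1 \<Longrightarrow> opbound 1 u"
  using opbound_adj_mult_iff[of 1 u] by simp

text \<open>Midpoints take the place of all convex combinations: they are what the parallelogram identity
  needs, and proofs about the hull become inductions.\<close>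

inductive_set orbit_hull :: "'h::chilbert_space bop set \<Rightarrow> 'h bop \<Rightarrow> 'h bop set" for G x where
  base: "x \<in> orbit_hull G x"
| conj: "u \<in> G \<Longrightarrow> y \<in> orbit_hull G x \<Longrightarrow> u * y * adj u \<in> orbit_hull G x"
| mid: "y \<in> orbit_hull G x \<Longrightarrow> z \<in> orbit_hull G x \<Longrightarrow> (1/2) *\<^sub>C (y + z) \<in> orbit_hull G x"

context tracial
begin

lemma tn_unitary_conj:
  assumes "u \<in> unitaries A" "y \<in> A" shows "tn (u * y * adj u) = tn y"
proof -
  note u = unitariesD[OF assms(1)]
  have "adj (u * y * adj u) * (u * y * adj u) = u * (adj y * ((adj u * u) * (y * adj u)))"
    by (simp add: mult.assoc)
  then have "\<tau> (adj (u * y * adj u) * (u * y * adj u)) = \<tau> (u * (adj y * (y * adj u)))"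
    using u by simp
  also have "\<dots> = \<tau> ((adj y * (y * adj u)) * u)" using u assms by (intro tr_commute) auto
  also have "(adj y * (y * adj u)) * u = adj y * y" using u by (simp add: mult.assoc)
  finally show ?thesis by (simp add: tn_def)
qed

text \<open>The closed hull of the orbit has a unique element of least 2-norm, which the group must fix.\<close>

lemma averaging:
  assumes G: "G \<subseteq> unitaries A" and x: "x \<in> A"
  obtains X C z where "\<And>n. X n \<in> orbit_hull G x" "\<And>n. X n \<in> A" "\<And>n. opbound C (X n)" "z \<in> A"
    "(\<lambda>n. tn (X n - z)) \<longlonglongrightarrow> 0" "\<And>u. u \<in> G \<Longrightarrow> u * z = z * u"
proof -
  let ?K = "orbit_hull G x"
  obtain C where C: "opbound C x" using opbound_exists by blast
  have KA: "y \<in> A" if "y \<in> ?K" for y using that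
    by induction (use x G in \<open>auto dest: unitariesD\<close>)
  have KC: "opbound C y" if "y \<in> ?K" for y using that
  proof induction
    case (conj u y)
    then have "u \<in> unitaries A" using G by blast
    then have "opbound 1 u" using unitariesD unitary_opbound by blast
    then show ?case using opbound_mult[OF opbound_mult[OF _ conj.IH] opbound_adj, of 1 u 1 u] by simp
  next
    case (mid y z)
    then show ?case using opbound_scaleC[OF opbound_add[OF mid.IH], of "1/2"] by simp
  qed (rule C)
  define d where "d = Inf (tn ` ?K)"
  have bb: "bdd_below (tn ` ?K)" using KA tn_nonneg by (auto intro!: bdd_belowI2)
  have d_le: "d \<le> tn y" if "y \<in> ?K" for y unfolding d_def using bb that by (simp add: cINF_lower)
  have "\<exists>y\<in>?K. tn y < d + 1 / (real n + 1)" for n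
    using cInf_less_iff[of "tn ` ?K" "d + 1 / (real n + 1)"] bb orbit_hull.base[of x G] unfolding d_def by auto
  then obtain X where X: "\<And>n. X n \<in> ?K" "\<And>n. tn (X n) < d + 1 / (real n + 1)" by metis
  have close: "tn (y - z) \<le> 2 * a + 2 * b"
    if "y \<in> ?K" "z \<in> ?K" "tn y < d + a" "tn z < d + b" for y z a b
  proof -
    have "4 * d \<le> 4 * tn ((1/2) *\<^sub>C (y + z))" using d_le[OF orbit_hull.mid[OF that(1,2)]] by simp
    also have "\<dots> = tn (y + z)" using that KA by (simp add: tn_scale power2_eq_square del: scaleC_add_right)
    finally show ?thesis using tn_parallelogram[of y z] that KA by simp
  qed
  have inv0: "(\<lambda>n. 1 / (real n + 1)) \<longlonglongrightarrow> 0"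
    using LIMSEQ_inverse_real_of_nat by (simp add: inverse_eq_divide add.commute)
  have cau: "\<exists>M. \<forall>m\<ge>M. \<forall>n\<ge>M. tn (X m - X n) < e" if "0 < e" for e
  proof -
    have "0 < e / 4" using that by simp
    then obtain M where M: "\<And>n. n \<ge> M \<Longrightarrow> norm (1 / (real n + 1) - 0) < e / 4"
      using LIMSEQ_D[OF inv0] by blast
    have "tn (X m - X n) < e" if "m \<ge> M" "n \<ge> M" for m n
      using close[OF X(1) X(1) X(2) X(2), of m n] M[OF that(1)] M[OF that(2)] by simp
    then show ?thesis by blast
  qed
  have XA: "X n \<in> A" "opbound C (X n)" for n using X KA KC by auto
  obtain z where z: "z \<in> A" "(\<lambda>n. tn (X n - z)) \<longlonglongrightarrow> 0"
    using tn_complete[OF XA cau] by blast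
  have "u * z = z * u" if u: "u \<in> G" for u
  proof -
    have uu: "u \<in> unitaries A" using u G by blast
    note u' = unitariesD[OF uu]
    have mA: "u * y * adj u \<in> A" if "y \<in> A" for y using that u' by auto
    have "tn (u * z * adj u - z) \<le> 2 * (2 * tn (X n - z) + 2 * (4 * (1 / (real n + 1)))) + 2 * tn (X n - z)" for n
    proof -
      let ?Y = "u * X n * adj u"
      have YK: "?Y \<in> ?K" by (rule orbit_hull.conj[OF u X(1)])
      have 1: "tn (?Y - X n) \<le> 4 * (1 / (real n + 1))"
        using close[OF YK X(1), of "1 / (real n + 1)" n "1 / (real n + 1)"] X(2)[of n]
          tn_unitary_conj[OF uu XA(1)[of n]] by simp
      have "u * (z - X n) * adj u = u * z * adj u - ?Y" by (simp add: left_diff_distrib right_diff_distrib)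
      then have 2: "tn (u * z * adj u - ?Y) = tn (X n - z)"
        using tn_unitary_conj[OF uu, of "z - X n"] z(1) XA(1) tn_commute[of z "X n"] by simp
      have "tn (u * z * adj u - z) = tn (((u * z * adj u - ?Y) + (?Y - X n)) + (X n - z))" by simp
      also have "\<dots> \<le> 2 * tn ((u * z * adj u - ?Y) + (?Y - X n)) + 2 * tn (X n - z)"
        by (rule tn_add_le) (use z XA mA KA[OF YK] in auto)
      also have "tn ((u * z * adj u - ?Y) + (?Y - X n)) \<le> 2 * tn (u * z * adj u - ?Y) + 2 * tn (?Y - X n)"
        by (rule tn_add_le) (use z XA mA KA[OF YK] in auto)
      finally show ?thesis using 1 2 by simp
    qed
    moreover have "(\<lambda>n. 2 * (2 * tn (X n - z) + 2 * (4 * (1 / (real n + 1)))) + 2 * tn (X n - z)) \<longlonglongrightarrow> 2 * (2 * 0 + 2 * (4 * 0)) + 2 * 0"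
      by (intro tendsto_intros z inv0)
    ultimately have "tn (u * z * adj u - z) \<le> 0" by (intro LIMSEQ_le_const) auto
    then have "u * z * adj u - z = 0" using tn_0_iff[of "u * z * adj u - z"] tn_nonneg[of "u * z * adj u - z"] mA z by auto
    then have "u * z * adj u * u = z * u" by simp
    then show ?thesis using u' by (simp add: mult.assoc)
  qed
  then show ?thesis using that[of X C z] X XA z by blast
qed

end

text \<open>Commuting with the Cayley transform of a self-adjoint \<open>h\<close> amounts to commuting with \<open>h\<close>. The
  transform is \<open>u = a + ib\<close> with \<open>a = 2r - 1\<close> and \<open>b = 2hr\<close>, where \<open>r = (1 + h\<^sup>2)\<^sup>-\<^sup>1\<close>.\<close>

lemma commute_unitaries:
  assumes A: "von_neumann_algebra 1 A" and z: "\<And>u. u \<in> unitaries A \<Longrightarrow> u * z = z * u" and a: "a \<in> A"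
  shows "a * z = z * a"
proof -
  note cl = vN_closed[OF A] vN_adj[OF A] vN_unit_mem[OF A] vN_resolvent[OF A]
  have sa: "h * z = z * h" if h: "h \<in> A" "adj h = h" for h
  proof -
    define r where "r = resolvent (h * h)"
    have hh: "pos (h * h)" using pos_adj_mult[of h] h by simp
    have rA: "r \<in> A" "adj r = r" using cl h hh resolvent_adj[OF hh] by (auto simp: r_def)
    have hr: "h * r = r * h" unfolding r_def by (rule resolvent_commute[OF hh]) (simp add: mult.assoc)
    have hhr: "h * h * r = 1 - r" unfolding r_def by (rule resolvent_compl(1)[OF hh, symmetric])
    define a where "a = r + r - 1"
    define b where "b = h * r + h * r"
    have ab: "adj a = a" "adj b = b" "a \<in> A" "b \<in> A"
      using rA h hr cl by (auto simp: a_def b_def)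
    have comm: "a * b = b * a"
      using hr by (simp add: a_def b_def algebra_simps)
    have hrr: "h * r * (h * r) = r - r * r"
    proof -
      have "h * r * (h * r) = h * (r * h) * r" by (simp only: mult.assoc)
      also have "\<dots> = (h * h * r) * r" by (simp only: hr[symmetric] mult.assoc)
      also have "\<dots> = r - r * r" by (simp only: hhr left_diff_distrib mult_1_left)
      finally show ?thesis .
    qed
    have "b * b = (r - r * r) + (r - r * r) + ((r - r * r) + (r - r * r))"
      by (simp only: b_def distrib_left distrib_right hrr)
    moreover have "a * a = r * r + r * r + (r * r + r * r) - (r + r) - (r + r) + 1"
      by (simp add: a_def algebra_simps)
    ultimately have 1: "a * a + b * b = 1" by simp
    define u where "u = a + \<i> *\<^sub>C b"
    have adju: "adj u = a - \<i> *\<^sub>C b" using ab by (simp add: u_def scaleC_minus_left)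
    have uu: "u * adj u = a * a + b * b" "adj u * u = a * a + b * b"
      unfolding adju unfolding u_def
      by (simp_all add: distrib_left distrib_right left_diff_distrib right_diff_distrib comm scaleC_minus_left
          scaleC_add_right scaleC_diff_right)
    have uA: "u \<in> unitaries A" using 1 uu ab cl by (simp add: unitaries_def u_def)
    have 2: "u * z = z * u" "adj u * z = z * adj u"
      using z[OF uA] z[OF unitaries_adj[OF _ uA]] vN_adj[OF A] by auto
    have aa: "a + a = u + adj u" unfolding adju unfolding u_def by simp
    have "(a + a) * z = z * (a + a)" unfolding aa using 2 by (simp add: distrib_left distrib_right)
    moreover have "a + a = 4 *\<^sub>C r - 2 *\<^sub>C 1"
      using scaleC_add_left[of 2 2 r] scaleC_add_left[of 1 1 r] scaleC_add_left[of 1 1 "1::'a bop"]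
      by (simp add: a_def)
    ultimately have "4 *\<^sub>C (r * z) = 4 *\<^sub>C (z * r)" by (simp add: left_diff_distrib right_diff_distrib)
    then have rz: "r * z = z * r" by (rule scaleC_cancel[rotated]) simp
    have bb: "(2 * \<i>) *\<^sub>C b = u - adj u"
      using scaleC_add_left[of \<i> \<i> b] unfolding adju unfolding u_def by simp
    have "((2 * \<i>) *\<^sub>C b) * z = z * ((2 * \<i>) *\<^sub>C b)"
      unfolding bb using 2 by (simp only: left_diff_distrib right_diff_distrib)
    then have "(2 * \<i>) *\<^sub>C (b * z) = (2 * \<i>) *\<^sub>C (z * b)" by simp
    then have "b * z = z * b" by (rule scaleC_cancel[rotated]) simp
    moreover have "b = 2 *\<^sub>C (h * r)" using scaleC_add_left[of 1 1 "h * r"] by (simp add: b_def)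
    ultimately have "2 *\<^sub>C (h * r * z) = 2 *\<^sub>C (z * (h * r))" by simp
    then have hrz: "h * r * z = z * (h * r)" by (rule scaleC_cancel[rotated]) simp
    have "h * z * r = z * h * r" using hrz rz by (simp only: mult.assoc)
    then have "h * z * (r * (1 + h * h)) = z * h * (r * (1 + h * h))" by (simp only: mult.assoc[symmetric])
    then show ?thesis unfolding r_def by (simp only: resolvent[OF hh] mult_1_right)
  qed
  define b where "b = a + adj a"
  define c where "c = \<i> *\<^sub>C (a - adj a)"
  have "b * z = z * b" "c * z = z * c"
    using sa[of b] sa[of c] a cl
    by (simp_all add: b_def c_def add.commute scaleC_minus_left scaleC_diff_right)
  moreover have "2 *\<^sub>C a = b - \<i> *\<^sub>C c"
    using scaleC_add_left[of 1 1 a] by (simp add: b_def c_def scaleC_minus_left scaleC_diff_right)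
  ultimately have "(2 *\<^sub>C a) * z = z * (2 *\<^sub>C a)"
    by (simp only: left_diff_distrib right_diff_distrib bop_scaleC_mult)
  then have "2 *\<^sub>C (a * z) = 2 *\<^sub>C (z * a)" by simp
  then show ?thesis by (rule scaleC_cancel[rotated]) simp
qed

subsection \<open>Factors\<close>

locale tracial_factor = tracial +
  assumes center: "A \<inter> commutant 1 A = range (\<lambda>c. c *\<^sub>C 1)"
begin

lemma central_scalar:
  assumes "z \<in> A" "\<And>a. a \<in> A \<Longrightarrow> z * a = a * z" shows "z = \<tau> z *\<^sub>C 1"
proof -
  have "z \<in> A \<inter> commutant 1 A" using assms by (auto simp: commutant_def)
  then obtain c where "z = c *\<^sub>C 1" unfolding center by blast
  then show ?thesis using tr_scale[of 1 c] by simp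
qed

lemma dixmier:
  assumes x: "x \<in> A"
  obtains X C where "\<And>n. X n \<in> orbit_hull (unitaries A) x" "\<And>n. X n \<in> A" "\<And>n. opbound C (X n)"
    "(\<lambda>n. tn (X n - \<tau> x *\<^sub>C 1)) \<longlonglongrightarrow> 0"
proof -
  obtain X C z where X: "\<And>n. X n \<in> orbit_hull (unitaries A) x" "\<And>n. X n \<in> A" "\<And>n. opbound C (X n)"
    and z: "z \<in> A" "(\<lambda>n. tn (X n - z)) \<longlonglongrightarrow> 0" "\<And>u. u \<in> unitaries A \<Longrightarrow> u * z = z * u"
    using averaging[OF subset_refl x] by metis
  have zc: "z = \<tau> z *\<^sub>C 1" by (rule central_scalar[OF z(1)]) (metis commute_unitaries[OF vN z(3)])
  have "y \<in> A \<and> \<tau> y = \<tau> x" if "y \<in> orbit_hull (unitaries A) x" for y using that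
  proof induction
    case (conj u y)
    note u = unitariesD[OF conj(1)]
    have "\<tau> (u * y * adj u) = \<tau> (adj u * (u * y))" using u conj by (intro tr_commute) auto
    also have "adj u * (u * y) = y" using u by (simp add: mult.assoc[symmetric])
    finally show ?case using conj u by auto
  next
    case (mid y z)
    then show ?case by (simp add: tr_add tr_scale del: scaleC_add_right)
  qed (use x in simp)
  then have "\<tau> (X n) = \<tau> x" for n using X by blast
  then have "\<tau> z = \<tau> x"
    using LIMSEQ_unique[OF tendsto_tr[OF z(2) X(2) z(1), of 1]] by fastforce
  then show ?thesis using that[of X C] X z zc by simp
qed

text \<open>Such a functional is constant along the averages of \<open>x\<close>, which tend to the scalar \<open>\<tau> x\<close>.\<close>

lemma invariant_functional:
  assumes add: "\<And>x y. x \<in> A \<Longrightarrow> y \<in> A \<Longrightarrow> f (x + y) = f x + f y"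
    and scale: "\<And>c x. x \<in> A \<Longrightarrow> f (c *\<^sub>C x) = c * f x"
    and inv: "\<And>u x. u \<in> unitaries A \<Longrightarrow> x \<in> A \<Longrightarrow> f (u * x * adj u) = f x"
    and bd: "\<And>x. x \<in> A \<Longrightarrow> (cmod (f x))\<^sup>2 \<le> K * tn x" and x: "x \<in> A"
  shows "f x = \<tau> x * f 1"
proof -
  obtain X C where X: "\<And>n. X n \<in> orbit_hull (unitaries A) x" "\<And>n. X n \<in> A"
    "(\<lambda>n. tn (X n - \<tau> x *\<^sub>C 1)) \<longlonglongrightarrow> 0" using dixmier[OF x] by metis
  have "y \<in> A \<and> f y = f x" if "y \<in> orbit_hull (unitaries A) x" for y using that
    by induction (use x in \<open>auto simp: inv add scale dest: unitariesD simp del: scaleC_add_right\<close>)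
  then have fX: "f (X n) = f x" for n using X by blast
  have "(cmod (f x - \<tau> x * f 1))\<^sup>2 \<le> K * tn (X n - \<tau> x *\<^sub>C 1)" for n
  proof -
    have "f (X n - \<tau> x *\<^sub>C 1) = f x - \<tau> x * f 1"
      using add[of "X n - \<tau> x *\<^sub>C 1" "\<tau> x *\<^sub>C 1"] scale[of 1] fX X(2) by simp
    then show ?thesis using bd[of "X n - \<tau> x *\<^sub>C 1"] X by simp
  qed
  then have "(cmod (f x - \<tau> x * f 1))\<^sup>2 \<le> 0"
    using tendsto_mult_right_zero[OF X(3), of K] by (intro LIMSEQ_le_const) auto
  then show ?thesis by simp
qed

text \<open>The images of the averages of \<open>x\<close> have constant trace, and they tend strongly to the scalar \<open>\<tau> x\<close>
  because isomorphisms are normal. With the identity for \<open>\<phi>\<close> this is the uniqueness of the trace; for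
  automorphisms it is their invariance of the trace.\<close>

lemma star_iso_trace:
  assumes B: "tracial B \<tau>'" and iso: "star_iso A B \<phi>" and x: "x \<in> A"
  shows "\<tau>' (\<phi> x) = \<tau> x"
proof -
  interpret B: tracial B \<tau>' by fact
  obtain X C where X: "\<And>n. X n \<in> orbit_hull (unitaries A) x" "\<And>n. X n \<in> A" "\<And>n. opbound C (X n)"
    "(\<lambda>n. tn (X n - \<tau> x *\<^sub>C 1)) \<longlonglongrightarrow> 0" using dixmier[OF x] by metis
  note iso' = star_isoD[OF iso] and \<phi>1 = star_iso_unit[OF vN B.vN iso]
  have "y \<in> A \<and> \<tau>' (\<phi> y) = \<tau>' (\<phi> x)" if "y \<in> orbit_hull (unitaries A) x" for y using that
  proof induction
    case (conj u y)
    note u = unitariesD[OF conj(1)]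
    have y: "y \<in> A" using conj by simp
    have "\<tau>' (\<phi> (u * y * adj u)) = \<tau>' ((\<phi> u * \<phi> y) * \<phi> (adj u))"
      using u y by (simp add: iso'(5))
    also have "\<dots> = \<tau>' (\<phi> (adj u) * (\<phi> u * \<phi> y))"
      using u y iso'(2) by (intro B.tr_commute) auto
    also have "\<phi> (adj u) * (\<phi> u * \<phi> y) = \<phi> (adj u * u * y)"
      using u(1) y iso'(5)[of "adj u * u" y] iso'(5)[of "adj u" u] by (simp add: mult.assoc)
    finally show ?case using u conj by simp
  next
    case (mid y z)
    then show ?case
      using iso'(2) by (simp add: iso'(3,4) B.tr_add B.tr_scale del: scaleC_add_right)
  qed (use x in simp)
  then have c: "\<tau>' (\<phi> (X n)) = \<tau>' (\<phi> x)" for n using X by blast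
  have "strong_lim (\<lambda>n. \<phi> (X n)) (\<phi> (\<tau> x *\<^sub>C 1))"
    by (rule tn_null_strong[OF B.vN iso X(2,3) _ X(4)]) auto
  then have "(\<lambda>n. \<tau>' (\<phi> (X n))) \<longlonglongrightarrow> \<tau>' (\<phi> (\<tau> x *\<^sub>C 1))"
    using star_iso_opbound[OF vN B.vN iso X(2,3)] iso'(2) X(2) by (intro B.tr_strong_lim[of _ _ C]) auto
  then have "\<tau>' (\<phi> x) = \<tau>' (\<phi> (\<tau> x *\<^sub>C 1))" unfolding c by (simp add: LIMSEQ_const_iff)
  then show ?thesis using iso'(4)[of 1 "\<tau> x"] by (simp add: \<phi>1 B.tr_scale)
qed

end

lemma tracial_subalgebra:
  assumes "tracial R \<tau>" "von_neumann_algebra 1 Q" "Q \<subseteq> R"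
  shows "tracial Q \<tau>"
proof
  have "ultraweakly_continuous_on Q \<tau>"
    using tracial.tr_uw[OF assms(1)] assms(3) unfolding ultraweakly_continuous_on_def by (meson subsetD)
  then show "normal_trace 1 Q \<tau>"
    using tracial.trace[OF assms(1)] assms(3) unfolding normal_trace_def
    by (elim conjE, intro conjI) (simp_all add: subset_iff)
qed fact

text \<open>For fixed \<open>b\<close> the functional \<open>y \<mapsto> \<tau>(yb)\<close> is invariant under conjugation by unitaries of \<open>Q\<close>.\<close>

lemma trace_independent:
  assumes R: "tracial R \<tau>" and Q: "tracial_factor Q \<tau>" "Q \<subseteq> R"
    and y: "y \<in> Q" and b: "b \<in> R" "\<And>x. x \<in> Q \<Longrightarrow> b * x = x * b"
  shows "\<tau> (y * b) = \<tau> y * \<tau> b"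
proof -
  interpret R: tracial R \<tau> by fact
  interpret Q: tracial_factor Q \<tau> by fact
  have QR: "x \<in> R" if "x \<in> Q" for x using that Q by blast
  obtain C where C: "opbound C b" using opbound_exists by blast
  have "\<tau> (y * b) = \<tau> y * \<tau> (1 * b)"
  proof (rule Q.invariant_functional[where f = "\<lambda>y. \<tau> (y * b)" and K = "C\<^sup>2"])
    show "\<tau> ((u * x * adj u) * b) = \<tau> (x * b)" if u: "u \<in> unitaries Q" and x: "x \<in> Q" for u x
    proof -
      note u' = unitariesD[OF u]
      have "(u * x * adj u) * b = u * (x * (adj u * b))" by (simp only: mult.assoc)
      also have "\<tau> \<dots> = \<tau> ((x * (adj u * b)) * u)" using u' x QR b by (intro R.tr_commute) auto
      also have "(x * (adj u * b)) * u = x * (adj u * (u * b))" using b(2)[OF u'(1)] by (simp only: mult.assoc)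
      also have "\<dots> = x * b" using u' by (simp add: mult.assoc[symmetric])
      finally show ?thesis .
    qed
    show "(cmod (\<tau> (x * b)))\<^sup>2 \<le> C\<^sup>2 * Q.tn x" if x: "x \<in> Q" for x
      using R.tr_le_tn[of "x * b"] R.tn_mult_right[OF C b(1) QR[OF x]] QR[OF x] b
      by (simp add: R.tn_def Q.tn_def)
  qed (use y b QR in \<open>auto simp: distrib_right R.tr_add R.tr_scale\<close>)
  then show ?thesis by simp
qed

section \<open>The basic construction\<close>

lemma compress_unit:
  assumes "p * T * p = T" "p * p = (p::'h::chilbert_space bop)" shows "p * T = T" "T * p = T"
  using assms by (metis mult.assoc)+

lemma mult_apply: "S * T = U \<Longrightarrow> S \<cdot> T \<cdot> v = U \<cdot> (v::'h::chilbert_space)"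
  by (simp flip: bop_apply_simps(1))

text \<open>One step of the tower. The trace \<open>\<tau>\<close> comes with the basic construction, whereas \<open>\<tau>\<^sub>R\<close> stems from a later
  step; hence the two parameters.\<close>

locale basic_step = Q: tracial_factor Q \<tau> + P: tracial_factor P \<tau> + R: tracial R \<tau>\<^sub>R
  for P Q R :: "'h::chilbert_space bop set" and \<tau> \<tau>\<^sub>R :: "'h bop \<Rightarrow> complex" +
  fixes p :: "'h bop" and \<Lambda> :: "'h bop \<Rightarrow> 'h" and \<pi> E :: "'h bop \<Rightarrow> 'h bop"
    and e q :: "'h bop" and \<phi> :: "'h bop \<Rightarrow> 'h bop"
  assumes PQ: "P \<subseteq> Q" and QR: "Q \<subseteq> R" and eR: "e \<in> R"
    and L2: "L2_realisation Q \<tau> p \<Lambda> \<pi>"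
    and E: "conditional_expectation \<tau> Q P E"
    and pqp: "p * q * p = q" and q_\<Lambda>: "\<And>x. x \<in> Q \<Longrightarrow> q \<cdot> \<Lambda> x = \<Lambda> (E x)"
    and iso: "star_iso R (commutant p (commutant p (insert q (\<pi> ` Q)))) \<phi>"
    and \<phi>_\<pi>: "\<And>x. x \<in> Q \<Longrightarrow> \<phi> x = \<pi> x" and \<phi>_e: "\<phi> e = q"
begin

lemma mem_Q [simp]: "x \<in> P \<Longrightarrow> x \<in> Q" and mem_R [simp]: "x \<in> Q \<Longrightarrow> x \<in> R"
  using PQ QR by auto

subsection \<open>The conditional expectation\<close>

lemma E_mem [simp]: "x \<in> Q \<Longrightarrow> E x \<in> P" and E_tr: "x \<in> Q \<Longrightarrow> y \<in> P \<Longrightarrow> \<tau> (E x * y) = \<tau> (x * y)"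
  using E unfolding conditional_expectation_def by (elim ballE conjE; simp)+

lemma E_unique:
  assumes x: "x \<in> Q" and z: "z \<in> P" and eq: "\<And>y. y \<in> P \<Longrightarrow> \<tau> (z * y) = \<tau> (x * y)"
  shows "E x = z"
proof -
  let ?d = "z - E x"
  have d: "?d \<in> P" using x z by simp
  have "\<tau> (?d * adj ?d) = \<tau> (z * adj ?d) - \<tau> (E x * adj ?d)"
    using d x z by (simp only: left_diff_distrib) (rule P.tr_diff; simp del: adj_simps)
  also have "\<dots> = 0" using eq[of "adj ?d"] E_tr[OF x, of "adj ?d"] d by (simp del: adj_simps)
  finally have "\<tau> (adj ?d * ?d) = 0" using P.tr_commute[of ?d "adj ?d"] d by (simp del: adj_simps)
  then have "?d = 0" by (rule P.tr_faithful[OF d])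
  then show ?thesis by simp
qed

lemma E_id: "x \<in> P \<Longrightarrow> E x = x"
  by (rule E_unique) auto

lemma E_right: "x \<in> Q \<Longrightarrow> b \<in> P \<Longrightarrow> E (x * b) = E x * b"
  by (rule E_unique) (auto simp: mult.assoc E_tr)

lemma E_left: "x \<in> Q \<Longrightarrow> b \<in> P \<Longrightarrow> E (b * x) = b * E x"
proof (rule E_unique)
  fix y assume x: "x \<in> Q" and b: "b \<in> P" and y: "y \<in> P"
  have "\<tau> (b * E x * y) = \<tau> ((E x * y) * b)" using P.tr_commute[of b "E x * y"] x b y by (simp add: mult.assoc)
  also have "\<dots> = \<tau> ((x * y) * b)" using E_tr[OF x, of "y * b"] b y by (simp add: mult.assoc)
  also have "\<dots> = \<tau> (b * x * y)" using Q.tr_commute[of b "x * y"] x b y by (simp add: mult.assoc)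
  finally show "\<tau> (b * E x * y) = \<tau> (b * x * y)" .
qed auto

lemma E_commute_iso:
  assumes \<theta>: "star_iso Q Q \<theta>" "\<theta> ` P = P" and x: "x \<in> Q" shows "E (\<theta> x) = \<theta> (E x)"
proof (rule E_unique)
  have tr: "\<tau> (\<theta> z) = \<tau> z" if "z \<in> Q" for z
    by (rule Q.star_iso_trace[OF Q.tracial_axioms \<theta>(1) that])
  fix y assume "y \<in> P"
  then obtain y' where y': "y' \<in> P" "y = \<theta> y'" using \<theta>(2) by blast
  have "\<tau> (\<theta> (E x) * y) = \<tau> (\<theta> (E x * y'))" using star_isoD(5)[OF \<theta>(1)] x y' by simp
  also have "\<dots> = \<tau> (\<theta> (x * y'))" using x y' by (simp add: tr E_tr)
  also have "\<dots> = \<tau> (\<theta> x * y)" using star_isoD(5)[OF \<theta>(1)] x y' by simp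
  finally show "\<tau> (\<theta> (E x) * y) = \<tau> (\<theta> x * y)" .
qed (use x \<theta>(2) E_mem[OF x] star_isoD(2)[OF \<theta>(1)] in auto)

subsection \<open>The standard representation\<close>

lemma \<Lambda>_add: "x \<in> Q \<Longrightarrow> y \<in> Q \<Longrightarrow> \<Lambda> (x + y) = \<Lambda> x + \<Lambda> y"
  and \<Lambda>_scale: "x \<in> Q \<Longrightarrow> \<Lambda> (c *\<^sub>C x) = c *\<^sub>C \<Lambda> x"
  and \<Lambda>_cinner: "x \<in> Q \<Longrightarrow> y \<in> Q \<Longrightarrow> cinner (\<Lambda> x) (\<Lambda> y) = \<tau> (adj x * y)"
  and p_proj: "projection p" and range_p: "range (bop_apply p) = closure (\<Lambda> ` Q)"
  and \<pi>_p: "x \<in> Q \<Longrightarrow> p * \<pi> x * p = \<pi> x" and \<pi>_\<Lambda>: "x \<in> Q \<Longrightarrow> y \<in> Q \<Longrightarrow> \<pi> x \<cdot> \<Lambda> y = \<Lambda> (x * y)"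
proof -
  have h: "\<forall>x\<in>Q. \<forall>y\<in>Q. \<Lambda> (x + y) = \<Lambda> x + \<Lambda> y" "\<forall>c. \<forall>x\<in>Q. \<Lambda> (c *\<^sub>C x) = c *\<^sub>C \<Lambda> x"
    "\<forall>x\<in>Q. \<forall>y\<in>Q. cinner (\<Lambda> x) (\<Lambda> y) = \<tau> (adj x * y)" "projection p" "range (bop_apply p) = closure (\<Lambda> ` Q)"
    "\<forall>x\<in>Q. p * \<pi> x * p = \<pi> x \<and> (\<forall>y\<in>Q. \<pi> x \<cdot> \<Lambda> y = \<Lambda> (x * y))"
    using L2 unfolding L2_realisation_def by - (elim conjE; assumption)+
  show "x \<in> Q \<Longrightarrow> y \<in> Q \<Longrightarrow> \<Lambda> (x + y) = \<Lambda> x + \<Lambda> y" by (rule h(1)[rule_format])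
  show "x \<in> Q \<Longrightarrow> \<Lambda> (c *\<^sub>C x) = c *\<^sub>C \<Lambda> x" by (rule h(2)[rule_format])
  show "x \<in> Q \<Longrightarrow> y \<in> Q \<Longrightarrow> cinner (\<Lambda> x) (\<Lambda> y) = \<tau> (adj x * y)" by (rule h(3)[rule_format])
  show "projection p" by (rule h(4))
  show "range (bop_apply p) = closure (\<Lambda> ` Q)" by (rule h(5))
  show "x \<in> Q \<Longrightarrow> p * \<pi> x * p = \<pi> x" using h(6) by blast
  show "x \<in> Q \<Longrightarrow> y \<in> Q \<Longrightarrow> \<pi> x \<cdot> \<Lambda> y = \<Lambda> (x * y)" using h(6) by blast
qed

lemma pp [simp]: "p * p = p" "adj p = p"
  using p_proj by (auto simp: projectionD)

lemma \<Lambda>_diff: "x \<in> Q \<Longrightarrow> y \<in> Q \<Longrightarrow> \<Lambda> (x - y) = \<Lambda> x - \<Lambda> y"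
  using \<Lambda>_add[of "x - y" y] by simp

lemma norm_\<Lambda>: "x \<in> Q \<Longrightarrow> (norm (\<Lambda> x))\<^sup>2 = Q.tn x"
  using \<Lambda>_cinner[of x x] Re_cinner_self[of "\<Lambda> x"] by (simp add: Q.tn_def)

lemma p_\<Lambda> [simp]: "x \<in> Q \<Longrightarrow> p \<cdot> \<Lambda> x = \<Lambda> x"
proof -
  assume "x \<in> Q"
  then have "\<Lambda> x \<in> closure (\<Lambda> ` Q)" by (intro subsetD[OF closure_subset] imageI)
  then have "\<Lambda> x \<in> range (bop_apply p)" by (simp only: range_p)
  then obtain v where v: "\<Lambda> x = p \<cdot> v" by (rule rangeE)
  show ?thesis unfolding v by (rule mult_apply) (rule pp(1))
qed

lemma \<phi>_\<Lambda>: "x \<in> Q \<Longrightarrow> y \<in> Q \<Longrightarrow> \<phi> x \<cdot> \<Lambda> y = \<Lambda> (x * y)"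
  by (simp add: \<phi>_\<pi> \<pi>_\<Lambda>)

lemma dense: "\<exists>xs. (\<forall>n. xs n \<in> Q) \<and> (\<lambda>n. \<Lambda> (xs n)) \<longlonglongrightarrow> p \<cdot> v"
proof -
  have "p \<cdot> v \<in> closure (\<Lambda> ` Q)" unfolding range_p[symmetric] by simp
  then obtain ys where ys: "\<And>n. ys n \<in> \<Lambda> ` Q" "ys \<longlonglongrightarrow> p \<cdot> v" unfolding closure_sequential by blast
  then have "\<forall>n. \<exists>x. x \<in> Q \<and> ys n = \<Lambda> x" by blast
  then obtain xs where xs: "\<And>n. xs n \<in> Q" "\<And>n. ys n = \<Lambda> (xs n)" by metis
  have "ys = (\<lambda>n. \<Lambda> (xs n))" using xs by auto
  with xs(1) ys(2) show ?thesis by auto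
qed

lemma dense_zero:
  assumes "\<And>x. x \<in> Q \<Longrightarrow> T \<cdot> \<Lambda> x = 0" shows "T \<cdot> p \<cdot> v = 0"
proof -
  obtain xs where xs: "\<And>n. xs n \<in> Q" "(\<lambda>n. \<Lambda> (xs n)) \<longlonglongrightarrow> p \<cdot> v" using dense[of v] by blast
  from tendsto_bop[OF xs(2), of T] show ?thesis by (simp add: assms xs(1) LIMSEQ_const_iff)
qed

lemma dense_eqI:
  assumes "S * p = S" "T * p = T" "\<And>x. x \<in> Q \<Longrightarrow> S \<cdot> \<Lambda> x = T \<cdot> \<Lambda> x" shows "S = T"
proof (rule bop_eqI)
  fix v
  have "(S - T) \<cdot> p \<cdot> v = 0" by (rule dense_zero) (simp add: assms(3))
  then show "S \<cdot> v = T \<cdot> v"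
    by (simp add: mult_apply[OF assms(1)] mult_apply[OF assms(2)])
qed

lemma dense_orthogonal:
  assumes "\<And>x. x \<in> Q \<Longrightarrow> cinner (\<Lambda> x) w = 0" "p \<cdot> w = w" shows "w = 0"
proof -
  obtain xs where xs: "\<And>n. xs n \<in> Q" "(\<lambda>n. \<Lambda> (xs n)) \<longlonglongrightarrow> p \<cdot> w" using dense[of w] by blast
  have "(\<lambda>n. cinner (\<Lambda> (xs n)) w) \<longlonglongrightarrow> cinner (p \<cdot> w) w" by (intro tendsto_intros xs)
  then have "cinner w w = 0" by (simp add: assms xs(1) LIMSEQ_const_iff)
  then show ?thesis by simp
qed

lemma dense_cinner_eqI:
  assumes S: "p * S * p = S" and T: "p * T * p = T"
    and eq: "\<And>x y. x \<in> Q \<Longrightarrow> y \<in> Q \<Longrightarrow> cinner (\<Lambda> x) (S \<cdot> \<Lambda> y) = cinner (\<Lambda> x) (T \<cdot> \<Lambda> y)"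
  shows "S = T"
proof (rule dense_eqI)
  have ST: "p * S = S" "S * p = S" "p * T = T" "T * p = T"
    by (rule compress_unit[OF S pp(1)] compress_unit[OF T pp(1)])+
  show "S * p = S" "T * p = T" by fact+
  fix y assume y: "y \<in> Q"
  have "S \<cdot> \<Lambda> y - T \<cdot> \<Lambda> y = 0"
  proof (rule dense_orthogonal)
    show "cinner (\<Lambda> x) (S \<cdot> \<Lambda> y - T \<cdot> \<Lambda> y) = 0" if "x \<in> Q" for x
      using eq[OF that y] by (simp add: cinner_linear)
    show "p \<cdot> (S \<cdot> \<Lambda> y - T \<cdot> \<Lambda> y) = S \<cdot> \<Lambda> y - T \<cdot> \<Lambda> y"
      by (simp add: mult_apply[OF ST(1)] mult_apply[OF ST(3)])
  qed
  then show "S \<cdot> \<Lambda> y = T \<cdot> \<Lambda> y" by simp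
qed

lemma extend_to_L2:
  assumes F_add: "\<And>x y. x \<in> Q \<Longrightarrow> y \<in> Q \<Longrightarrow> F (x + y) = F x + F y"
    and F_scale: "\<And>c x. x \<in> Q \<Longrightarrow> F (c *\<^sub>C x) = c *\<^sub>C F x"
    and F_bd: "\<And>x. x \<in> Q \<Longrightarrow> norm (F x) \<le> C * norm (\<Lambda> x)" and C: "0 \<le> C"
    and F_p: "\<And>x. x \<in> Q \<Longrightarrow> p \<cdot> F x = F x"
  obtains V where "\<And>x. x \<in> Q \<Longrightarrow> V \<cdot> \<Lambda> x = F x" "V * p = V" "p * V = V"
proof -
  have F_diff: "F (x - y) = F x - F y" if "x \<in> Q" "y \<in> Q" for x y
    using F_add[of "x - y" y] that by simp
  have same: "(\<lambda>n. F (xs n)) \<longlonglongrightarrow> l"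
    if "\<And>n. xs n \<in> Q" "\<And>n. ys n \<in> Q" "(\<lambda>n. \<Lambda> (xs n)) \<longlonglongrightarrow> v" "(\<lambda>n. \<Lambda> (ys n)) \<longlonglongrightarrow> v" "(\<lambda>n. F (ys n)) \<longlonglongrightarrow> l"
    for xs ys v l
  proof -
    have "(\<lambda>n. F (xs n) - F (ys n)) \<longlonglongrightarrow> 0"
    proof (rule Lim_null_comparison)
      have "(\<lambda>n. C * norm (\<Lambda> (xs n) - \<Lambda> (ys n))) \<longlonglongrightarrow> C * norm (v - v)"
        by (intro tendsto_intros that)
      then show "(\<lambda>n. C * norm (\<Lambda> (xs n) - \<Lambda> (ys n))) \<longlonglongrightarrow> 0" by simp
      have "norm (F (xs n) - F (ys n)) \<le> C * norm (\<Lambda> (xs n) - \<Lambda> (ys n))" for n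
        using F_bd[of "xs n - ys n"] that(1,2) by (simp add: F_diff \<Lambda>_diff)
      then show "\<forall>\<^sub>F n in sequentially. norm (F (xs n) - F (ys n)) \<le> C * norm (\<Lambda> (xs n) - \<Lambda> (ys n))" by simp
    qed
    from tendsto_add[OF this that(5)] show ?thesis by simp
  qed
  have "\<exists>l xs. (\<forall>n. xs n \<in> Q) \<and> (\<lambda>n. \<Lambda> (xs n)) \<longlonglongrightarrow> p \<cdot> v \<and> (\<lambda>n. F (xs n)) \<longlonglongrightarrow> l" for v
  proof -
    obtain xs where xs: "\<And>n. xs n \<in> Q" "(\<lambda>n. \<Lambda> (xs n)) \<longlonglongrightarrow> p \<cdot> v" using dense[of v] by blast
    have "Cauchy (\<lambda>n. F (xs n))"
    proof (rule CauchyI)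
      fix r :: real assume r: "0 < r"
      have "0 < r / (C + 1)" using r C by simp
      then obtain M where M: "\<forall>m\<ge>M. \<forall>n\<ge>M. norm (\<Lambda> (xs m) - \<Lambda> (xs n)) < r / (C + 1)"
        using CauchyD[OF LIMSEQ_imp_Cauchy[OF xs(2)]] by blast
      have "norm (F (xs m) - F (xs n)) < r" if "m \<ge> M" "n \<ge> M" for m n
      proof -
        have "norm (F (xs m) - F (xs n)) \<le> C * norm (\<Lambda> (xs m) - \<Lambda> (xs n))"
          using F_bd[of "xs m - xs n"] xs(1) by (simp add: F_diff \<Lambda>_diff)
        also have "\<dots> \<le> (C + 1) * norm (\<Lambda> (xs m) - \<Lambda> (xs n))" by (intro mult_right_mono) simp_all
        also have "\<dots> < (C + 1) * (r / (C + 1))" using M that C by (intro mult_strict_left_mono) auto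
        also have "\<dots> = r" using C by simp
        finally show ?thesis .
      qed
      then show "\<exists>M. \<forall>m\<ge>M. \<forall>n\<ge>M. norm (F (xs m) - F (xs n)) < r" by blast
    qed
    then show ?thesis using xs Cauchy_convergent convergent_def by metis
  qed
  then obtain f X where fX: "\<And>v n. X v n \<in> Q" "\<And>v. (\<lambda>n. \<Lambda> (X v n)) \<longlonglongrightarrow> p \<cdot> v" "\<And>v. (\<lambda>n. F (X v n)) \<longlonglongrightarrow> f v"
    by metis
  have fI: "f v = l" if "\<And>n. xs n \<in> Q" "(\<lambda>n. \<Lambda> (xs n)) \<longlonglongrightarrow> p \<cdot> v" "(\<lambda>n. F (xs n)) \<longlonglongrightarrow> l" for v xs l
    using LIMSEQ_unique[OF same[OF that(1) fX(1) that(2) fX(2) fX(3)] that(3)] .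
  have sc: "(\<lambda>n. c *\<^sub>C w n) \<longlonglongrightarrow> c *\<^sub>C l" if "w \<longlonglongrightarrow> l" for c w and l :: 'h
    using tendsto_bop[OF that, of "c *\<^sub>C 1"] by simp
  obtain V where V: "\<And>v. V \<cdot> v = f v"
  proof (rule bop_exists[of f C])
    show "f (v + w) = f v + f w" for v w
      by (rule fI[of "\<lambda>n. X v n + X w n"])
         (use tendsto_add[OF fX(2)[of v] fX(2)[of w]] tendsto_add[OF fX(3)[of v] fX(3)[of w]]
          in \<open>simp_all add: fX(1) \<Lambda>_add F_add\<close>)
    show "f (c *\<^sub>C v) = c *\<^sub>C f v" for c v
      by (rule fI[of "\<lambda>n. c *\<^sub>C X v n"])
         (use sc[OF fX(2)[of v], of c] sc[OF fX(3)[of v], of c] in \<open>simp_all add: fX(1) \<Lambda>_scale F_scale\<close>)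
    show "norm (f v) \<le> C * norm v" for v
    proof -
      have "norm (f v) \<le> C * norm (p \<cdot> v)"
        by (rule LIMSEQ_le[OF tendsto_norm[OF fX(3)] tendsto_mult[OF tendsto_const tendsto_norm[OF fX(2)]]])
           (use F_bd fX(1) in blast)
      also have "\<dots> \<le> C * norm v"
        using opboundD(1)[OF projection_bounds(1)[OF p_proj], of v] C by (simp add: mult_left_mono)
      finally show ?thesis .
    qed
  qed auto
  show ?thesis
  proof (rule that)
    show "V \<cdot> \<Lambda> x = F x" if "x \<in> Q" for x unfolding V by (rule fI[of "\<lambda>_. x"]) (use that in auto)
    have fp: "f (p \<cdot> v) = f v" for v
      by (rule fI[OF fX(1)[of v] _ fX(3)]) (use fX(2)[of v] in \<open>simp add: mult_apply[OF pp(1)]\<close>)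
    show "V * p = V" by (rule bop_eqI) (simp add: V fp)
    show "p * V = V"
    proof (rule bop_eqI)
      fix v
      have "(\<lambda>n. p \<cdot> F (X v n)) \<longlonglongrightarrow> p \<cdot> f v" by (rule tendsto_bop[OF fX(3)])
      then have "(\<lambda>n. F (X v n)) \<longlonglongrightarrow> p \<cdot> f v" by (simp add: F_p fX(1))
      then have "p \<cdot> f v = f v" by (rule LIMSEQ_unique[OF _ fX(3)])
      then show "(p * V) \<cdot> v = V \<cdot> v" by (simp add: V)
    qed
  qed
qed

subsection \<open>The algebra generated by left multiplications and the Jones projection\<close>

abbreviation "gens \<equiv> insert q (\<pi> ` Q)"
abbreviation "S \<equiv> commutant p (commutant p gens)"

lemma pq [simp]: "p * q = q" "q * p = q"
  by (rule compress_unit[OF pqp pp(1)])+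

lemma E_adj: "x \<in> Q \<Longrightarrow> E (adj x) = adj (E x)"
proof (rule E_unique)
  fix y assume x: "x \<in> Q" and y: "y \<in> P"
  have "\<tau> (adj (E x) * y) = cnj (\<tau> (adj y * E x))"
    using Q.tn_expand(2)[of y "E x"] x y by simp
  also have "\<tau> (adj y * E x) = \<tau> (E x * adj y)" using x y by (intro P.tr_commute) auto
  also have "\<dots> = \<tau> (x * adj y)" using x y by (intro E_tr) auto
  also have "\<dots> = \<tau> (adj y * x)" using x y by (intro Q.tr_commute) auto
  also have "cnj \<dots> = \<tau> (adj x * y)" using Q.tn_expand(2)[of y x] x y by simp
  finally show "\<tau> (adj (E x) * y) = \<tau> (adj x * y)" .
qed auto

lemma q_adj [simp]: "adj q = q"
proof (rule dense_cinner_eqI)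
  have "p * adj q * p = adj (p * q * p)" by (simp add: mult.assoc del: pq)
  then show "p * adj q * p = adj q" by (simp only: pqp)
  fix x y assume x: "x \<in> Q" and y: "y \<in> Q"
  have "cinner (\<Lambda> x) (adj q \<cdot> \<Lambda> y) = \<tau> (adj (E x) * y)"
    using x y by (simp add: cinner_adj_right q_\<Lambda> \<Lambda>_cinner)
  also have "\<dots> = \<tau> (y * E (adj x))" using x y by (simp add: E_adj Q.tr_commute)
  also have "\<dots> = \<tau> (E y * E (adj x))" using x y by (simp add: E_tr)
  also have "\<dots> = \<tau> (E (adj x) * E y)" using x y by (simp add: P.tr_commute)
  also have "\<dots> = \<tau> (adj x * E y)" using x y by (simp add: E_tr)
  finally show "cinner (\<Lambda> x) (adj q \<cdot> \<Lambda> y) = cinner (\<Lambda> x) (q \<cdot> \<Lambda> y)"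
    using x y by (simp add: q_\<Lambda> \<Lambda>_cinner)
qed (rule pqp)

lemma qq: "q * q = q"
  by (rule dense_eqI) (simp_all add: mult.assoc q_\<Lambda> E_id)

lemma gens_S: "x \<in> gens \<Longrightarrow> x \<in> S"
  using pqp \<pi>_p commutantD(2)[of _ p gens x] by (auto simp: commutant_def[of p "commutant p gens"])

lemma S_commute: "s \<in> S \<Longrightarrow> T \<in> commutant p gens \<Longrightarrow> s * T = T * s"
  by (rule commutantD(2))

lemma \<pi>_adj: "x \<in> Q \<Longrightarrow> \<pi> (adj x) = adj (\<pi> x)"
  using star_isoD(6)[OF iso, of x] \<phi>_\<pi>[of x] \<phi>_\<pi>[of "adj x"] by simp

lemma S_vN: "von_neumann_algebra p S"
proof -
  have self: "adj ` gens \<subseteq> gens" by (auto simp: \<pi>_adj[symmetric])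
  have self': "adj ` commutant p gens \<subseteq> commutant p gens" by (auto intro: commutant_adj[OF _ pp(2) self])
  have 1: "adj ` S \<subseteq> S" by (auto intro: commutant_adj[OF _ pp(2) self'])
  have "commutant p S = commutant p gens"
  proof
    show "commutant p S \<subseteq> commutant p gens"
      using commutantD(1)[of _ p S] commutantD(2)[of _ p S, OF _ gens_S]
      unfolding commutant_def[of p gens] by blast
    show "commutant p gens \<subseteq> commutant p S"
      using commutantD(1)[of _ p gens] S_commute[symmetric] unfolding commutant_def[of p S] by blast
  qed
  with 1 p_proj show ?thesis by (simp add: von_neumann_algebra_def)
qed

lemmas iso_diff = star_iso_diff[OF R.vN S_vN iso] and iso_unit = star_iso_unit[OF R.vN S_vN iso]
  and isoD = star_isoD[OF iso]

lemma \<phi>_p [simp]: "x \<in> R \<Longrightarrow> p * \<phi> x = \<phi> x" "x \<in> R \<Longrightarrow> \<phi> x * p = \<phi> x"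
  using vN_unit[OF S_vN isoD(2)] by auto

lemma \<phi>_inj: "x \<in> R \<Longrightarrow> y \<in> R \<Longrightarrow> \<phi> x = \<phi> y \<Longrightarrow> x = y"
  using isoD(7) by blast

lemma e_proj: "adj e = e" "e * e = e"
  by (rule \<phi>_inj; simp add: eR isoD(5,6) \<phi>_e qq)+

lemma e_compress: "x \<in> Q \<Longrightarrow> e * x * e = E x * e"
proof (rule \<phi>_inj)
  assume x: "x \<in> Q"
  have "q * \<phi> x * q = \<phi> (E x) * q"
    by (rule dense_eqI) (use x in \<open>simp_all add: mult.assoc q_\<Lambda> \<phi>_\<Lambda> E_right E_id\<close>)
  then show "\<phi> (e * x * e) = \<phi> (E x * e)" using x by (simp add: isoD(5) eR \<phi>_e)
qed (use eR in auto)

lemma e_commute: "b \<in> P \<Longrightarrow> e * b = b * e"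
proof (rule \<phi>_inj)
  assume b: "b \<in> P"
  have "q * \<phi> b = \<phi> b * q"
    by (rule dense_eqI) (use b in \<open>simp_all add: mult.assoc q_\<Lambda> \<phi>_\<Lambda> E_left\<close>)
  then show "\<phi> (e * b) = \<phi> (b * e)" using b by (simp add: isoD(5) eR \<phi>_e)
qed (use eR in auto)

lemma E_1: "E 1 = 1" by (simp add: E_id)

lemma q_vacuum: "q \<cdot> \<Lambda> 1 = \<Lambda> 1" by (simp add: q_\<Lambda> E_1)

lemma vacuum_norm: "cinner (\<Lambda> 1) (\<Lambda> 1) = 1" by (simp add: \<Lambda>_cinner)

lemma e_trace_pos: "0 < Re (\<tau>\<^sub>R e)" "\<tau>\<^sub>R e = complex_of_real (Re (\<tau>\<^sub>R e))"
proof -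
  have "e \<noteq> 0"
  proof
    assume "e = 0"
    then have "q = 0" using \<phi>_e star_iso_0[OF R.vN S_vN iso] by simp
    then show False using q_vacuum vacuum_norm by simp
  qed
  then show "0 < Re (\<tau>\<^sub>R e)" "\<tau>\<^sub>R e = complex_of_real (Re (\<tau>\<^sub>R e))"
    using R.tn_0_iff[OF eR] R.tn_nonneg[OF eR] R.tr_tn[OF eR] by (simp_all add: e_proj R.tn_def)
qed

subsection \<open>Right multiplications and central vectors\<close>

text \<open>The right action of \<open>P\<close> on \<open>L\<^sup>2(Q)\<close>. It commutes with left multiplications and with the Jones
  projection, hence with the algebra that they generate.\<close>

definition rmult :: "'h bop \<Rightarrow> 'h bop" where
  "rmult b = (SOME V. (\<forall>x\<in>Q. V \<cdot> \<Lambda> x = \<Lambda> (x * b)) \<and> V * p = V \<and> p * V = V)"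

lemma rmult:
  assumes b: "b \<in> P"
  shows "x \<in> Q \<Longrightarrow> rmult b \<cdot> \<Lambda> x = \<Lambda> (x * b)" "rmult b * p = rmult b" "p * rmult b = rmult b"
proof -
  obtain C where C: "opbound C b" using opbound_exists by blast
  obtain V where "\<And>x. x \<in> Q \<Longrightarrow> V \<cdot> \<Lambda> x = \<Lambda> (x * b)" "V * p = V" "p * V = V"
  proof (rule extend_to_L2[of "\<lambda>x. \<Lambda> (x * b)" C])
    show "norm (\<Lambda> (x * b)) \<le> C * norm (\<Lambda> x)" if "x \<in> Q" for x
    proof (rule power2_le_imp_le)
      show "(norm (\<Lambda> (x * b)))\<^sup>2 \<le> (C * norm (\<Lambda> x))\<^sup>2"
        using Q.tn_mult_right[OF C, of x] that b by (simp add: norm_\<Lambda> power_mult_distrib)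
    qed (use opboundD(2)[OF C] in simp)
  qed (use b opboundD(2)[OF C] in \<open>auto simp: distrib_right \<Lambda>_add \<Lambda>_scale\<close>)
  then have "\<exists>V. (\<forall>x\<in>Q. V \<cdot> \<Lambda> x = \<Lambda> (x * b)) \<and> V * p = V \<and> p * V = V" by blast
  from someI_ex[OF this]
  show "x \<in> Q \<Longrightarrow> rmult b \<cdot> \<Lambda> x = \<Lambda> (x * b)" "rmult b * p = rmult b" "p * rmult b = rmult b"
    unfolding rmult_def by blast+
qed

lemma rmult_commutant: "b \<in> P \<Longrightarrow> rmult b \<in> commutant p gens"
proof -
  assume b: "b \<in> P"
  have "rmult b * q = q * rmult b"
    by (rule dense_eqI) (use b in \<open>simp_all add: mult.assoc rmult q_\<Lambda> E_right\<close>)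
  moreover have "rmult b * \<phi> x = \<phi> x * rmult b" if "x \<in> Q" for x
    by (rule dense_eqI) (use b that in \<open>simp_all add: mult.assoc rmult \<phi>_\<Lambda>\<close>)
  ultimately show ?thesis using rmult(2,3)[OF b] \<phi>_\<pi> by (auto simp: commutant_def)
qed

lemma rmult_adj: "b \<in> P \<Longrightarrow> adj (rmult b) = rmult (adj b)"
proof (rule dense_cinner_eqI)
  assume b: "b \<in> P"
  show "p * adj (rmult b) * p = adj (rmult b)"
    using arg_cong[OF rmult(2)[OF b], of adj] arg_cong[OF rmult(3)[OF b], of adj] by simp
  show "p * rmult (adj b) * p = rmult (adj b)" using b by (simp add: rmult)
  fix x y assume x: "x \<in> Q" and y: "y \<in> Q"
  have "cinner (\<Lambda> x) (adj (rmult b) \<cdot> \<Lambda> y) = \<tau> (adj b * (adj x * y))"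
    using b x y by (simp add: cinner_adj_right rmult \<Lambda>_cinner mult.assoc)
  also have "\<dots> = \<tau> ((adj x * y) * adj b)" using b x y by (intro Q.tr_commute) auto
  finally show "cinner (\<Lambda> x) (adj (rmult b) \<cdot> \<Lambda> y) = cinner (\<Lambda> x) (rmult (adj b) \<cdot> \<Lambda> y)"
    using b x y by (simp add: rmult \<Lambda>_cinner mult.assoc)
qed

lemma rmult_S: "s \<in> S \<Longrightarrow> b \<in> P \<Longrightarrow> s \<cdot> rmult b \<cdot> v = rmult b \<cdot> s \<cdot> v"
  using arg_cong[OF S_commute[OF _ rmult_commutant], of s b "\<lambda>T. T \<cdot> v"] by simp

text \<open>The vector \<open>T \<Lambda>(1)\<close> lies in the closure of \<open>\<Lambda>(P)\<close> and commutes with \<open>P\<close>. Its inner product with \<open>\<Lambda>(x)\<close>,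
  for \<open>x\<close> in \<open>P\<close>, is therefore an invariant functional of \<open>x\<close>, and \<open>P\<close> is a factor.\<close>

lemma central_vector:
  assumes T: "T \<in> S" and comm: "\<And>b. b \<in> P \<Longrightarrow> T * \<phi> b = \<phi> b * T" and qT: "q \<cdot> T \<cdot> \<Lambda> 1 = T \<cdot> \<Lambda> 1"
  shows "T \<cdot> \<Lambda> 1 = cinner (\<Lambda> 1) (T \<cdot> \<Lambda> 1) *\<^sub>C \<Lambda> 1"
proof -
  define \<zeta> where "\<zeta> = T \<cdot> \<Lambda> 1"
  have inv: "cinner \<zeta> (\<Lambda> (u * x * adj u)) = cinner \<zeta> (\<Lambda> x)" if u: "u \<in> unitaries P" and x: "x \<in> P" for u x
  proof -
    note u' = unitariesD[OF u]
    have au: "adj u \<in> P" using u' by simp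
    have "\<Lambda> (u * x * adj u) = \<phi> u \<cdot> rmult (adj u) \<cdot> \<Lambda> x"
      using u' au x by (simp add: rmult \<phi>_\<Lambda> mult.assoc)
    then have "cinner \<zeta> (\<Lambda> (u * x * adj u)) = cinner (rmult u \<cdot> adj (\<phi> u) \<cdot> \<zeta>) (\<Lambda> x)"
      using rmult_adj[OF au] cinner_adj_left[of "rmult (adj u)" "adj (\<phi> u) \<cdot> \<zeta>" "\<Lambda> x"]
        cinner_adj_left[of "\<phi> u" \<zeta> "rmult (adj u) \<cdot> \<Lambda> x"] by simp
    also have "rmult u \<cdot> adj (\<phi> u) \<cdot> \<zeta> = \<zeta>"
    proof -
      have "adj (\<phi> u) \<cdot> \<zeta> = (\<phi> (adj u) * T) \<cdot> \<Lambda> 1"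
        using isoD(6)[of u] u'(1) by (simp add: \<zeta>_def)
      also have "\<dots> = T \<cdot> \<phi> (adj u) \<cdot> \<Lambda> 1"
        by (simp only: comm[OF au, symmetric]) (simp only: bop_apply_simps(1))
      also have "\<dots> = T \<cdot> \<Lambda> (adj u)" using au by (simp add: \<phi>_\<Lambda>)
      finally have "rmult u \<cdot> adj (\<phi> u) \<cdot> \<zeta> = T \<cdot> rmult u \<cdot> \<Lambda> (adj u)"
        using rmult_S[OF T u'(1)] by simp
      also have "\<dots> = \<zeta>" using u' au by (simp add: rmult \<zeta>_def)
      finally show ?thesis .
    qed
    finally show ?thesis .
  qed
  have f: "cinner \<zeta> (\<Lambda> x) = \<tau> x * cinner \<zeta> (\<Lambda> 1)" if "x \<in> P" for x
  proof (rule P.invariant_functional[where f = "\<lambda>x. cinner \<zeta> (\<Lambda> x)" and K = "(norm \<zeta>)\<^sup>2"])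
    show "(cmod (cinner \<zeta> (\<Lambda> x)))\<^sup>2 \<le> (norm \<zeta>)\<^sup>2 * P.tn x" if "x \<in> P" for x
      using power_mono[OF cinner_Cauchy_Schwarz[of \<zeta> "\<Lambda> x"], of 2] that
      by (simp add: power_mult_distrib norm_\<Lambda>)
  qed (use that inv in \<open>auto simp: \<Lambda>_add \<Lambda>_scale cinner_linear\<close>)
  define d where "d = \<zeta> - cinner (\<Lambda> 1) \<zeta> *\<^sub>C \<Lambda> 1"
  have qd: "q \<cdot> d = d" using qT by (simp add: d_def \<zeta>_def q_vacuum)
  have "d = 0"
  proof (rule dense_orthogonal)
    show "p \<cdot> d = d" using qd mult_apply[OF pq(1), of d] by metis
    fix x assume x: "x \<in> Q"
    have c: "cinner (\<Lambda> 1) \<zeta> = cnj (cinner \<zeta> (\<Lambda> 1))" by (rule cinner_commute)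
    have "cinner (\<Lambda> x) d = cinner (\<Lambda> (E x)) d"
      using x qd cinner_adj_left[of q "\<Lambda> x" d] by (simp add: q_\<Lambda>)
    also have "\<dots> = cnj (cinner d (\<Lambda> (E x)))" by (rule cinner_commute)
    also have "cinner d (\<Lambda> (E x)) = 0"
      using f[of "E x"] x by (simp add: d_def cinner_linear \<Lambda>_cinner c)
    finally show "cinner (\<Lambda> x) d = 0" by simp
  qed
  then show ?thesis by (simp add: d_def \<zeta>_def)
qed

end

context basic_step
begin

lemma phi_one_\<Lambda>: "x \<in> Q \<Longrightarrow> \<phi> x \<cdot> \<Lambda> 1 = \<Lambda> x"
  by (simp add: \<phi>_\<Lambda>)

lemma \<phi>_scalar: "\<phi> (c *\<^sub>C 1) = c *\<^sub>C p"
  using isoD(4)[of 1 c] iso_unit by simp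

subsection \<open>The basic construction of a factor is a factor\<close>

text \<open>A central element of the algebra on \<open>L\<^sup>2(Q)\<close> sends the vacuum to a central vector of \<open>P\<close>, which is
  scalar, and it is determined by this vector because it commutes with left multiplications.\<close>

lemma R_factor: "tracial_factor R \<tau>\<^sub>R"
proof
  show "R \<inter> commutant 1 R = range (\<lambda>c. c *\<^sub>C 1)"
  proof
    show "range (\<lambda>c. c *\<^sub>C 1) \<subseteq> R \<inter> commutant 1 R" by (auto simp: commutant_def)
    show "R \<inter> commutant 1 R \<subseteq> range (\<lambda>c. c *\<^sub>C 1)"
    proof
      fix z assume "z \<in> R \<inter> commutant 1 R"
      then have z: "z \<in> R" "\<And>y. y \<in> R \<Longrightarrow> z * y = y * z" using commutantD(2)[of z 1 R] by auto
      have comm: "\<phi> z * \<phi> y = \<phi> y * \<phi> z" if "y \<in> R" for y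
        using arg_cong[OF z(2)[OF that], of \<phi>] z(1) that by (simp add: isoD(5))
      define c where "c = cinner (\<Lambda> 1) (\<phi> z \<cdot> \<Lambda> 1)"
      have "q \<cdot> \<phi> z \<cdot> \<Lambda> 1 = \<phi> z \<cdot> q \<cdot> \<Lambda> 1"
        using arg_cong[OF comm[OF eR], of "\<lambda>T. T \<cdot> \<Lambda> 1"] by (simp add: \<phi>_e)
      then have vac: "\<phi> z \<cdot> \<Lambda> 1 = c *\<^sub>C \<Lambda> 1"
        unfolding c_def by (intro central_vector isoD(2) z(1)) (auto simp: comm q_vacuum)
      have "\<phi> z = \<phi> (c *\<^sub>C 1)"
      proof (rule dense_eqI)
        show "\<phi> z * p = \<phi> z" "\<phi> (c *\<^sub>C 1) * p = \<phi> (c *\<^sub>C 1)" using z by simp_all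
        fix x assume x: "x \<in> Q"
        have "\<phi> z \<cdot> \<phi> x \<cdot> \<Lambda> 1 = \<phi> x \<cdot> \<phi> z \<cdot> \<Lambda> 1"
          using arg_cong[OF comm[of x], of "\<lambda>T. T \<cdot> \<Lambda> 1"] x by simp
        then show "\<phi> z \<cdot> \<Lambda> x = \<phi> (c *\<^sub>C 1) \<cdot> \<Lambda> x"
          using x by (simp add: \<phi>_scalar vac phi_one_\<Lambda>)
      qed
      then have "z = c *\<^sub>C 1" using \<phi>_inj z(1) by simp
      then show "z \<in> range (\<lambda>c. c *\<^sub>C 1)" by blast
    qed
  qed
qed

subsection \<open>The trace of the corner of the Jones projection\<close>

text \<open>Average \<open>eze\<close> over the unitaries of \<open>P\<close>. The limit lies in the corner \<open>eRe\<close> and commutes with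
  \<open>P\<close>, so it is a multiple of \<open>e\<close> by the lemma on central vectors. Both the trace and the vacuum
  state are constant along the averages; this identifies them on the corner.\<close>

lemma trace_vector_state:
  assumes z: "z \<in> R"
  shows "\<tau>\<^sub>R (e * z * e) = \<tau>\<^sub>R e * cinner (\<Lambda> 1) (\<phi> z \<cdot> \<Lambda> 1)"
proof -
  let ?x = "e * z * e" and ?G = "unitaries P"
  let ?v = "\<lambda>y. cinner (\<Lambda> 1) (\<phi> y \<cdot> \<Lambda> 1)"
  have x: "?x \<in> R" using z eR by simp
  have GR: "?G \<subseteq> unitaries R" by (auto simp: unitaries_def)
  obtain X C w where X: "\<And>n. X n \<in> orbit_hull ?G ?x" "\<And>n. X n \<in> R" "\<And>n. opbound C (X n)" "w \<in> R"
    "(\<lambda>n. R.tn (X n - w)) \<longlonglongrightarrow> 0" "\<And>u. u \<in> ?G \<Longrightarrow> u * w = w * u"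
    using R.averaging[OF GR x] by metis
  have hull: "y \<in> R \<and> e * y * e = y \<and> \<tau>\<^sub>R y = \<tau>\<^sub>R ?x \<and> ?v y = ?v ?x" if "y \<in> orbit_hull ?G ?x" for y
    using that
  proof induction
    case base
    have "e * ?x * e = (e * e) * z * (e * e)" by (simp only: mult.assoc)
    then show ?case using x by (simp only: e_proj)
  next
    case (conj u y)
    note u = unitariesD[OF conj(1)]
    have uR: "u \<in> R" "adj u \<in> R" "adj u \<in> P" using u by auto
    have y: "y \<in> R" "e * y * e = y" using conj by auto
    have "e * (u * y * adj u) * e = (e * u) * y * (adj u * e)" by (simp only: mult.assoc)
    also have "\<dots> = u * (e * y * e) * adj u"
      using e_commute[OF u(1)] e_commute[OF uR(3)] by (simp only: mult.assoc)
    also have "\<dots> = u * y * adj u" by (simp only: y)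
    finally have 1: "e * (u * y * adj u) * e = u * y * adj u" .
    have "\<tau>\<^sub>R (u * y * adj u) = \<tau>\<^sub>R (adj u * (u * y))" using uR y by (intro R.tr_commute) auto
    also have "adj u * (u * y) = y" using u by (simp add: mult.assoc[symmetric])
    finally have 2: "\<tau>\<^sub>R (u * y * adj u) = \<tau>\<^sub>R y" .
    have r: "\<phi> (adj u) \<cdot> \<Lambda> 1 = rmult (adj u) \<cdot> \<Lambda> 1" using uR by (simp add: \<phi>_\<Lambda> rmult)
    have "?v (u * y * adj u) = cinner (\<Lambda> 1) (\<phi> u \<cdot> \<phi> y \<cdot> \<phi> (adj u) \<cdot> \<Lambda> 1)"
      using uR y by (simp add: isoD(5))
    also have "\<dots> = cinner (\<phi> (adj u) \<cdot> \<Lambda> 1) (\<phi> y \<cdot> \<phi> (adj u) \<cdot> \<Lambda> 1)"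
      using isoD(6)[OF uR(1)] by (simp add: cinner_adj_left)
    also have "\<dots> = cinner (rmult (adj u) \<cdot> \<Lambda> 1) (rmult (adj u) \<cdot> \<phi> y \<cdot> \<Lambda> 1)"
      unfolding r using rmult_S[OF isoD(2)[OF y(1)] uR(3)] by simp
    also have "\<dots> = cinner (rmult u \<cdot> rmult (adj u) \<cdot> \<Lambda> 1) (\<phi> y \<cdot> \<Lambda> 1)"
      using cinner_adj_left[of "rmult (adj u)" "rmult (adj u) \<cdot> \<Lambda> 1" "\<phi> y \<cdot> \<Lambda> 1"]
        rmult_adj[OF uR(3)] by simp
    also have "rmult u \<cdot> rmult (adj u) \<cdot> \<Lambda> 1 = \<Lambda> 1" using u uR by (simp add: rmult)
    finally have 3: "?v (u * y * adj u) = ?v y" .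
    show ?case using 1 2 3 conj uR by simp
  next
    case (mid y y')
    have "e * (y + y') * e = y + y'" using mid by (simp add: distrib_left distrib_right)
    then show ?case
      using mid by (simp add: R.tr_add R.tr_scale isoD(3,4) cinner_linear del: scaleC_add_right)
  qed
  have strong: "strong_lim (\<lambda>n. \<phi> (X n)) (\<phi> w)"
    by (rule R.tn_null_strong[OF S_vN iso X(2,3,4,5)])
  have "q * \<phi> (X n) * q = \<phi> (X n)" for n
    using hull[OF X(1)[of n]] isoD(5)[of "e * X n" e] isoD(5)[of e "X n"] eR X(2) by (simp add: \<phi>_e)
  then have "strong_lim (\<lambda>n. \<phi> (X n)) (q * \<phi> w * q)"
    using strong_lim_mult_right[OF strong_lim_mult_left[OF strong, of q], of q] by simp
  then have qwq: "q * \<phi> w * q = \<phi> w" by (rule strong_lim_unique[OF _ strong])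
  note qw = compress_unit[OF qwq qq]
  have w_comm: "w * b = b * w" if "b \<in> P" for b
    using commute_unitaries[OF P.vN X(6) that] by simp
  define c where "c = ?v w"
  have vac: "\<phi> w \<cdot> \<Lambda> 1 = c *\<^sub>C \<Lambda> 1"
    unfolding c_def
  proof (rule central_vector)
    show "\<phi> w * \<phi> b = \<phi> b * \<phi> w" if "b \<in> P" for b
      using arg_cong[OF w_comm[OF that], of \<phi>] X(4) that by (simp add: isoD(5))
    show "q \<cdot> \<phi> w \<cdot> \<Lambda> 1 = \<phi> w \<cdot> \<Lambda> 1" by (rule mult_apply[OF qw(1)])
  qed (rule isoD(2)[OF X(4)])
  have "\<phi> w = c *\<^sub>C q"
  proof (rule dense_eqI)
    show "\<phi> w * p = \<phi> w" "(c *\<^sub>C q) * p = c *\<^sub>C q" using X(4) by simp_all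
    fix x assume x: "x \<in> Q"
    have "\<phi> w \<cdot> \<Lambda> x = \<phi> w \<cdot> q \<cdot> \<Lambda> x" by (rule mult_apply[OF qw(2), symmetric])
    also have "\<dots> = \<phi> w \<cdot> rmult (E x) \<cdot> \<Lambda> 1" using x by (simp add: q_\<Lambda> rmult)
    also have "\<dots> = rmult (E x) \<cdot> \<phi> w \<cdot> \<Lambda> 1" using x by (intro rmult_S isoD(2) X(4)) simp
    also have "\<dots> = c *\<^sub>C (q \<cdot> \<Lambda> x)" using x by (simp add: vac q_\<Lambda> rmult)
    finally show "\<phi> w \<cdot> \<Lambda> x = (c *\<^sub>C q) \<cdot> \<Lambda> x" by simp
  qed
  also have "\<dots> = \<phi> (c *\<^sub>C e)" using isoD(4)[OF eR] \<phi>_e by simp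
  finally have wce: "w = c *\<^sub>C e" using \<phi>_inj[OF X(4)] eR by simp
  have "(\<lambda>n. ?v (X n)) \<longlonglongrightarrow> ?v w" by (intro tendsto_intros strong_limD[OF strong])
  then have "?v w = ?v ?x" using hull[OF X(1)] by (simp add: LIMSEQ_const_iff)
  also have "?v ?x = cinner (q \<cdot> \<Lambda> 1) (\<phi> z \<cdot> q \<cdot> \<Lambda> 1)"
    using isoD(5)[of "e * z" e] isoD(5)[of e z] eR z cinner_adj_left[of q "\<Lambda> 1"] by (simp add: \<phi>_e)
  finally have c: "c = ?v z" by (simp add: c_def q_vacuum)
  have "(\<lambda>n. \<tau>\<^sub>R (X n * 1)) \<longlonglongrightarrow> \<tau>\<^sub>R (w * 1)" by (rule R.tendsto_tr[OF X(5,2,4)]) simp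
  then have "\<tau>\<^sub>R w = \<tau>\<^sub>R ?x" using hull[OF X(1)] by (simp add: LIMSEQ_const_iff)
  then show ?thesis using wce c R.tr_scale[OF eR] by (simp add: mult.commute)
qed

subsection \<open>Extension of automorphisms\<close>

text \<open>The matrix coefficient of \<open>\<phi>(z)\<close> at \<open>\<Lambda>(a)\<close> and \<open>\<Lambda>(b)\<close> is, up to a factor, the trace of \<open>e a\<^sup>* z b e\<close>, and
  \<open>\<psi>\<close> preserves the trace.\<close>

lemma iso_fixing_unique:
  assumes \<psi>: "star_iso R R \<psi>" "\<And>x. x \<in> Q \<Longrightarrow> \<psi> x = x" "\<psi> e = e" and z: "z \<in> R"
  shows "\<psi> z = z"
proof -
  have tr: "\<tau>\<^sub>R (\<psi> y) = \<tau>\<^sub>R y" if "y \<in> R" for y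
    by (rule tracial_factor.star_iso_trace[OF R_factor R.tracial_axioms \<psi>(1) that])
  have \<psi>z: "\<psi> z \<in> R" using star_isoD(2)[OF \<psi>(1) z] .
  have form: "\<tau>\<^sub>R e * cinner (\<Lambda> a) (\<phi> y \<cdot> \<Lambda> b) = \<tau>\<^sub>R (e * (adj a * y * b) * e)"
    if "a \<in> Q" "b \<in> Q" "y \<in> R" for a b y
  proof -
    have "cinner (\<Lambda> a) (\<phi> y \<cdot> \<Lambda> b) = cinner (\<phi> a \<cdot> \<Lambda> 1) (\<phi> y \<cdot> \<phi> b \<cdot> \<Lambda> 1)"
      using that by (simp add: phi_one_\<Lambda>)
    also have "\<dots> = cinner (\<Lambda> 1) (\<phi> (adj a * y * b) \<cdot> \<Lambda> 1)"
      using that by (simp add: isoD(5,6) cinner_adj_right)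
    finally show ?thesis using trace_vector_state[of "adj a * y * b"] that by simp
  qed
  have "\<phi> (\<psi> z) = \<phi> z"
  proof (rule dense_cinner_eqI)
    show "p * \<phi> (\<psi> z) * p = \<phi> (\<psi> z)" "p * \<phi> z * p = \<phi> z" using z \<psi>z by simp_all
    fix a b assume ab: "a \<in> Q" "b \<in> Q"
    have "\<psi> (e * (adj a * z * b) * e) = e * (adj a * \<psi> z * b) * e"
      using ab z eR by (simp add: star_isoD(5)[OF \<psi>(1)] \<psi>(2,3))
    then have "\<tau>\<^sub>R (e * (adj a * \<psi> z * b) * e) = \<tau>\<^sub>R (e * (adj a * z * b) * e)"
      using tr[of "e * (adj a * z * b) * e"] ab z eR by simp
    then have "\<tau>\<^sub>R e * cinner (\<Lambda> a) (\<phi> (\<psi> z) \<cdot> \<Lambda> b) = \<tau>\<^sub>R e * cinner (\<Lambda> a) (\<phi> z \<cdot> \<Lambda> b)"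
      using form[OF ab z] form[OF ab \<psi>z] by simp
    moreover have "\<tau>\<^sub>R e \<noteq> 0" using e_trace_pos(1) by auto
    ultimately show "cinner (\<Lambda> a) (\<phi> (\<psi> z) \<cdot> \<Lambda> b) = cinner (\<Lambda> a) (\<phi> z \<cdot> \<Lambda> b)" by simp
  qed
  then show ?thesis by (rule \<phi>_inj[OF \<psi>z z])
qed

lemma unitary_implementation:
  assumes \<theta>: "star_iso Q Q \<theta>" "\<theta> ` P = P"
  obtains U where "\<And>x. x \<in> Q \<Longrightarrow> U \<cdot> \<Lambda> x = \<Lambda> (\<theta> x)" "U * p = U" "p * U = U" "U * q = q * U"
    "\<And>x. x \<in> Q \<Longrightarrow> U * \<phi> x = \<phi> (\<theta> x) * U"
proof -
  note \<theta>D = star_isoD[OF \<theta>(1)]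
  have tr: "\<tau> (\<theta> z) = \<tau> z" if "z \<in> Q" for z
    by (rule Q.star_iso_trace[OF Q.tracial_axioms \<theta>(1) that])
  obtain U where U: "\<And>x. x \<in> Q \<Longrightarrow> U \<cdot> \<Lambda> x = \<Lambda> (\<theta> x)" "U * p = U" "p * U = U"
  proof (rule extend_to_L2[of "\<lambda>x. \<Lambda> (\<theta> x)" 1])
    show "norm (\<Lambda> (\<theta> x)) \<le> 1 * norm (\<Lambda> x)" if x: "x \<in> Q" for x
    proof (rule power2_le_imp_le)
      have "Q.tn (\<theta> x) = Q.tn x"
        using tr[of "adj x * x"] x by (simp add: Q.tn_def \<theta>D(5,6))
      then show "(norm (\<Lambda> (\<theta> x)))\<^sup>2 \<le> (1 * norm (\<Lambda> x))\<^sup>2" using x \<theta>D(2) by (simp add: norm_\<Lambda>)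
    qed simp
  qed (auto simp: \<Lambda>_add \<Lambda>_scale \<theta>D)
  show ?thesis
  proof (rule that[of U])
    show "U * q = q * U"
      by (rule dense_eqI) (use U in \<open>simp_all add: mult.assoc q_\<Lambda> \<theta>D(2) E_commute_iso[OF \<theta>]\<close>)
    show "U * \<phi> x = \<phi> (\<theta> x) * U" if "x \<in> Q" for x
      by (rule dense_eqI) (use U that in \<open>simp_all add: mult.assoc \<phi>_\<Lambda> \<theta>D(2,5)\<close>)
  qed (use U in auto)
qed

text \<open>Conjugation by the unitary \<open>U\<close> of \<open>L\<^sup>2(Q)\<close> that implements \<open>\<theta>\<close> preserves the generators of the algebra,
  since \<open>\<theta>\<close> commutes with the conditional expectation.\<close>

lemma iso_extends:
  assumes \<theta>: "star_iso Q Q \<theta>" "\<theta> ` P = P"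
  obtains \<psi> where "star_iso R R \<psi>" "\<And>x. x \<in> Q \<Longrightarrow> \<psi> x = \<theta> x" "\<psi> e = e"
proof -
  define \<theta>' where "\<theta>' = inv_into Q \<theta>"
  note \<theta>D = star_isoD[OF \<theta>(1)]
  have \<theta>': "star_iso Q Q \<theta>'" unfolding \<theta>'_def by (rule star_iso_inv[OF Q.vN Q.vN \<theta>(1)])
  have \<theta>'\<theta>: "\<theta>' (\<theta> x) = x" if "x \<in> Q" for x
    unfolding \<theta>'_def by (rule bij_betw_inv_into_left[OF \<theta>D(1) that])
  have \<theta>\<theta>': "\<theta> (\<theta>' x) = x" if "x \<in> Q" for x
    unfolding \<theta>'_def by (rule bij_betw_inv_into_right[OF \<theta>D(1) that])
  have "\<theta>' ` (\<theta> ` P) = P" using \<theta>'\<theta> by (simp add: image_comp)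
  then have \<theta>'P: "\<theta>' ` P = P" by (simp only: \<theta>(2))
  note \<theta>'D = star_isoD[OF \<theta>']
  have tr: "\<tau> (\<theta> z) = \<tau> z" if "z \<in> Q" for z
    by (rule Q.star_iso_trace[OF Q.tracial_axioms \<theta>(1) that])
  obtain U where U: "\<And>x. x \<in> Q \<Longrightarrow> U \<cdot> \<Lambda> x = \<Lambda> (\<theta> x)" "U * p = U" "p * U = U" "U * q = q * U"
    "\<And>x. x \<in> Q \<Longrightarrow> U * \<phi> x = \<phi> (\<theta> x) * U" by (rule unitary_implementation[OF \<theta>]) blast
  obtain V where V: "\<And>x. x \<in> Q \<Longrightarrow> V \<cdot> \<Lambda> x = \<Lambda> (\<theta>' x)" "V * p = V" "p * V = V" "V * q = q * V"
    "\<And>x. x \<in> Q \<Longrightarrow> V * \<phi> x = \<phi> (\<theta>' x) * V" by (rule unitary_implementation[OF \<theta>' \<theta>'P]) blast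
  have UV: "U * V = p" by (rule dense_eqI) (simp_all add: mult.assoc U V \<theta>'D(2) \<theta>\<theta>')
  have VU: "V * U = p" by (rule dense_eqI) (simp_all add: mult.assoc U V \<theta>D(2) \<theta>'\<theta>)
  have adjU: "adj U = V"
  proof (rule dense_cinner_eqI)
    have "p * adj U * p = adj (p * U * p)" by (simp add: mult.assoc)
    then show "p * adj U * p = adj U" by (simp add: U)
    show "p * V * p = V" by (simp add: V)
    fix x y assume xy: "x \<in> Q" "y \<in> Q"
    have "cinner (\<Lambda> x) (adj U \<cdot> \<Lambda> y) = \<tau> (adj (\<theta> x) * y)"
      using xy by (simp add: cinner_adj_right U \<Lambda>_cinner \<theta>D(2))
    also have "\<dots> = \<tau> (\<theta> (adj x * \<theta>' y))" using xy by (simp add: \<theta>D(5,6) \<theta>'D(2) \<theta>\<theta>')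
    also have "\<dots> = \<tau> (adj x * \<theta>' y)" using xy \<theta>'D(2) by (intro tr) auto
    finally show "cinner (\<Lambda> x) (adj U \<cdot> \<Lambda> y) = cinner (\<Lambda> x) (V \<cdot> \<Lambda> y)"
      using xy by (simp add: V \<Lambda>_cinner \<theta>'D(2))
  qed
  then have adjV: "adj V = U" by (metis adjU adj_adj)
  have comm: "W' * c * W \<in> commutant p gens"
    if W: "W * p = W" "p * W' = W'" "W * q = q * W" "W' * q = q * W'"
      "\<And>x. x \<in> Q \<Longrightarrow> W * \<phi> x = \<phi> (\<eta> x) * W" "\<And>x. x \<in> Q \<Longrightarrow> W' * \<phi> (\<eta> x) = \<phi> x * W'"
      "\<And>x. x \<in> Q \<Longrightarrow> \<eta> x \<in> Q" and c: "c \<in> commutant p gens" for W W' c \<eta>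
  proof -
    have "(W' * c * W) * q = q * (W' * c * W)"
    proof -
      have "(W' * c * W) * q = W' * c * (W * q)" by (simp only: mult.assoc)
      also have "\<dots> = W' * (c * q) * W" by (simp only: W(3) mult.assoc)
      also have "c * q = q * c" by (rule commutantD(2)[OF c]) simp
      also have "W' * (q * c) * W = (W' * q) * c * W" by (simp only: mult.assoc)
      also have "\<dots> = q * (W' * c * W)" by (simp only: W(4) mult.assoc)
      finally show ?thesis .
    qed
    moreover have "(W' * c * W) * \<pi> x = \<pi> x * (W' * c * W)" if x: "x \<in> Q" for x
    proof -
      have "(W' * c * W) * \<phi> x = W' * c * (W * \<phi> x)" by (simp only: mult.assoc)
      also have "\<dots> = W' * (c * \<phi> (\<eta> x)) * W" by (simp only: W(5)[OF x] mult.assoc)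
      also have "c * \<phi> (\<eta> x) = \<phi> (\<eta> x) * c" by (rule commutantD(2)[OF c]) (use W(7)[OF x] \<phi>_\<pi> in simp)
      also have "W' * (\<phi> (\<eta> x) * c) * W = (W' * \<phi> (\<eta> x)) * c * W" by (simp only: mult.assoc)
      also have "\<dots> = \<phi> x * (W' * c * W)" by (simp only: W(6)[OF x] mult.assoc)
      finally show ?thesis using x by (simp add: \<phi>_\<pi>)
    qed
    moreover have "p * (W' * c * W) * p = (p * W') * c * (W * p)" by (simp only: mult.assoc)
    ultimately show ?thesis using W(1,2) by (auto simp: commutant_def)
  qed
  have UcV: "U * c * V \<in> commutant p gens" "V * c * U \<in> commutant p gens" if "c \<in> commutant p gens" for c
  proof -
    have 1: "U * \<phi> (\<theta>' x) = \<phi> x * U" "V * \<phi> (\<theta> x) = \<phi> x * V" if "x \<in> Q" for x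
      using U(5)[OF \<theta>'D(2)[OF that]] V(5)[OF \<theta>D(2)[OF that]] \<theta>\<theta>'[OF that] \<theta>'\<theta>[OF that] by auto
    show "U * c * V \<in> commutant p gens"
      by (rule comm[of V U \<theta>', OF V(2) U(3) V(4) U(4) V(5) 1(1) \<theta>'D(2) that])
    show "V * c * U \<in> commutant p gens"
      by (rule comm[of U V \<theta>, OF U(2) V(3) U(4) V(4) U(5) 1(2) \<theta>D(2) that])
  qed
  have absorb: "p * T = T" "T * p = T" if "T \<in> commutant p Y" for T Y
    using commutant_unit[OF that pp(1)] by auto
  have inS: "W * T * W' \<in> S"
    if T: "T \<in> S" and W: "p * W = W" "W' * p = W'" "W * W' = p"
      and c: "\<And>c. c \<in> commutant p gens \<Longrightarrow> W' * c * W \<in> commutant p gens" for T W W'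
  proof -
    have "(W * T * W') * c = c * (W * T * W')" if c': "c \<in> commutant p gens" for c
    proof -
      have "(W * T * W') * c = W * T * (W' * (c * (W * W')))"
        by (simp only: W(3) absorb[OF c'] mult.assoc)
      also have "\<dots> = W * (T * (W' * c * W)) * W'" by (simp only: mult.assoc)
      also have "T * (W' * c * W) = (W' * c * W) * T" by (rule S_commute[OF T c[OF c']])
      also have "W * (W' * c * W * T) * W' = (W * W') * c * (W * T * W')" by (simp only: mult.assoc)
      also have "\<dots> = c * (W * T * W')" by (simp only: W(3) absorb[OF c'])
      finally show ?thesis .
    qed
    moreover have "p * (W * T * W') * p = (p * W) * T * (W' * p)" by (simp only: mult.assoc)
    ultimately show ?thesis using W by (auto simp: commutant_def[of p "commutant p gens"])
  qed
  define Ad where "Ad T = U * T * V" for T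
  have AdS: "Ad T \<in> S" if "T \<in> S" for T
    unfolding Ad_def by (rule inS[OF that U(3) V(2) UV UcV(2)])
  have AdS': "V * T * U \<in> S" if "T \<in> S" for T
    by (rule inS[OF that V(3) U(2) VU UcV(1)])
  have "star_iso S S Ad"
    unfolding star_iso_def
  proof (intro conjI ballI allI)
    show "bij_betw Ad S S"
    proof (rule bij_betw_byWitness[where f' = "\<lambda>T. V * T * U"])
      have "V * (U * T * V) * U = (V * U) * T * (V * U)" "U * (V * T * U) * V = (U * V) * T * (U * V)" for T
        by (simp_all only: mult.assoc)
      then show "\<forall>T\<in>S. V * Ad T * U = T" "\<forall>T\<in>S. Ad (V * T * U) = T"
        by (simp_all add: Ad_def UV VU absorb)
    qed (use AdS AdS' in auto)
    fix T T' assume T: "T \<in> S" "T' \<in> S"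
    show "Ad (T + T') = Ad T + Ad T'" by (simp add: Ad_def distrib_left distrib_right)
    have "Ad T * Ad T' = U * (T * (V * U)) * T' * V" by (simp only: Ad_def mult.assoc)
    also have "\<dots> = Ad (T * T')" by (simp only: VU absorb[OF T(1)] Ad_def mult.assoc)
    finally show "Ad (T * T') = Ad T * Ad T'" by simp
  qed (simp_all add: Ad_def adjU adjV mult.assoc)
  then have "star_iso R R (\<lambda>z. inv_into R \<phi> (Ad (\<phi> z)))"
    by (intro star_iso_comp[OF iso] star_iso_comp[OF _ star_iso_inv[OF R.vN S_vN iso]])
  moreover have "inv_into R \<phi> (Ad (\<phi> x)) = \<theta> x" if x: "x \<in> Q" for x
  proof -
    have "Ad (\<phi> x) = \<phi> (\<theta> x) * (U * V)" by (simp only: Ad_def U(5)[OF x] mult.assoc)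
    also have "\<dots> = \<phi> (\<theta> x)" using x \<theta>D(2) by (simp add: UV)
    finally show ?thesis using bij_betw_inv_into_left[OF isoD(1), of "\<theta> x"] x \<theta>D(2) by simp
  qed
  moreover have "inv_into R \<phi> (Ad (\<phi> e)) = e"
  proof -
    have "Ad (\<phi> e) = q * (U * V)" by (simp only: Ad_def \<phi>_e U(4) mult.assoc)
    also have "\<dots> = \<phi> e" by (simp add: UV \<phi>_e)
    finally show ?thesis using bij_betw_inv_into_left[OF isoD(1) eR] by simp
  qed
  ultimately show ?thesis using that by blast
qed

end

section \<open>The Jones tower\<close>

definition vN_factor :: "'h::chilbert_space bop set \<Rightarrow> bool" where
  "vN_factor A \<longleftrightarrow> von_neumann_algebra 1 A \<and> A \<inter> commutant 1 A = range (\<lambda>c. c *\<^sub>C 1)"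

lemma tracial_factorI: "vN_factor A \<Longrightarrow> normal_trace 1 A \<tau> \<Longrightarrow> tracial_factor A \<tau>"
  by (simp add: vN_factor_def tracial_factor_def tracial_factor_axioms_def tracial_def)

lemma basic_construction_step:
  assumes bc: "basic_construction P Q R e" and P: "vN_factor P" and Q: "vN_factor Q" and PQ: "P \<subseteq> Q"
    and R: "normal_trace 1 R \<tau>\<^sub>R"
  obtains \<tau> p \<Lambda> \<pi> E q \<phi> where "basic_step P Q R \<tau> \<tau>\<^sub>R p \<Lambda> \<pi> E e q \<phi>"
proof -
  obtain \<tau> p \<Lambda> \<pi> E q \<phi> where h: "L2_realisation Q \<tau> p \<Lambda> \<pi>" "conditional_expectation \<tau> Q P E"
    "p * q * p = q" "\<forall>x\<in>Q. q \<cdot> \<Lambda> x = \<Lambda> (E x)"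
    "star_iso R (commutant p (commutant p (insert q (\<pi> ` Q)))) \<phi>" "\<forall>x\<in>Q. \<phi> x = \<pi> x" "\<phi> e = q"
    and R': "von_neumann_algebra 1 R" "Q \<subseteq> R" "e \<in> R"
    using bc unfolding basic_construction_def by blast
  have trQ: "normal_trace 1 Q \<tau>" using h(1) by (simp add: L2_realisation_def)
  have fQ: "tracial_factor Q \<tau>" by (rule tracial_factorI[OF Q trQ])
  have "tracial P \<tau>"
    by (rule tracial_subalgebra[OF tracial_factor.axioms(1)[OF fQ] _ PQ]) (use P in \<open>simp add: vN_factor_def\<close>)
  then have fP: "tracial_factor P \<tau>" by (intro tracial_factorI[OF P] tracial.trace)
  have "tracial R \<tau>\<^sub>R" using R R' by (simp add: tracial_def)
  with fP fQ show ?thesis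
    by (intro that[of \<tau> p \<Lambda> \<pi> E q \<phi>] basic_step.intro basic_step_axioms.intro PQ) (use h R' in auto)
qed

locale jones_setting =
  fixes N M :: "'h::chilbert_space bop set" and Mk :: "nat \<Rightarrow> 'h bop set" and e :: "nat \<Rightarrow> 'h bop"
  assumes sub: "subfactor_II1 N M" and tow: "jones_tower N M Mk e"
begin

text \<open>The tower with \<open>N\<close> as its bottom term, so that every step has the same shape.\<close>

definition L :: "nat \<Rightarrow> 'h bop set" where
  "L k = (case k of 0 \<Rightarrow> N | Suc j \<Rightarrow> Mk j)"

lemma L_simps [simp]: "L 0 = N" "L (Suc k) = Mk k" and Mk_0 [simp]: "Mk 0 = M"
  using tow by (auto simp: L_def jones_tower_def)

lemma bc: "basic_construction (L k) (L (Suc k)) (L (Suc (Suc k))) (e (Suc k))"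
  using tow by (cases k) (auto simp: jones_tower_def)

lemma L_Suc: "L k \<subseteq> L (Suc k)"
proof (cases k)
  case 0 then show ?thesis using sub by (simp add: subfactor_II1_def)
next
  case (Suc j) then show ?thesis using bc[of j] by (simp add: basic_construction_def)
qed

lemma L_mono: "i \<le> j \<Longrightarrow> L i \<subseteq> L j"
  using lift_Suc_mono_le[of L i j] L_Suc by blast

lemma ex_trace: "\<exists>\<tau>. normal_trace 1 (L k) \<tau>"
proof (cases k)
  case 0 then show ?thesis using sub by (auto simp: subfactor_II1_def factor_II1_def)
next
  case (Suc j)
  then show ?thesis using bc[of j] unfolding basic_construction_def L2_realisation_def by auto
qed

lemma L_factor: "vN_factor (L k)"
proof -
  have "vN_factor (L k) \<and> vN_factor (L (Suc k))"
  proof (induction k)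
    case 0
    show ?case using sub by (auto simp: subfactor_II1_def factor_II1_def vN_factor_def)
  next
    case (Suc k)
    obtain \<tau>\<^sub>R where R: "normal_trace 1 (L (Suc (Suc k))) \<tau>\<^sub>R" using ex_trace by blast
    obtain \<tau> p \<Lambda> \<pi> E q \<phi> where s: "basic_step (L k) (L (Suc k)) (L (Suc (Suc k))) \<tau> \<tau>\<^sub>R p \<Lambda> \<pi> E (e (Suc k)) q \<phi>"
      using basic_construction_step[OF bc _ _ L_Suc R] Suc by blast
    have "tracial_factor (L (Suc (Suc k))) \<tau>\<^sub>R" by (rule basic_step.R_factor[OF s])
    then have "vN_factor (L (Suc (Suc k)))"
      by (simp add: vN_factor_def tracial_factor_def tracial_factor_axioms_def tracial_def)
    with Suc show ?case by simp
  qed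
  then show ?thesis by simp
qed

lemma step:
  assumes "normal_trace 1 (L (Suc (Suc k))) \<tau>\<^sub>R"
  obtains \<tau> p \<Lambda> \<pi> E q \<phi> where "basic_step (L k) (L (Suc k)) (L (Suc (Suc k))) \<tau> \<tau>\<^sub>R p \<Lambda> \<pi> E (e (Suc k)) q \<phi>"
  using basic_construction_step[OF bc L_factor L_factor L_Suc assms] by blast

lemma L_vN: "von_neumann_algebra 1 (L k)"
  using L_factor by (simp add: vN_factor_def)

lemma Mk_vN: "von_neumann_algebra 1 (Mk k)"
  using L_vN[of "Suc k"] by simp

lemma Mk_mono: "i \<le> j \<Longrightarrow> Mk i \<subseteq> Mk j"
  using L_mono[of "Suc i" "Suc j"] by simp

lemma N_sub_M: "N \<subseteq> M"
  using L_Suc[of 0] by simp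

lemma e_mem: "e (Suc k) \<in> L (Suc (Suc k))"
  using bc[of k] by (simp add: basic_construction_def)

lemma trace_level:
  assumes "tracial (L j) \<tau>" "i \<le> j" shows "tracial_factor (L i) \<tau>"
  using tracial_factorI[OF L_factor tracial.trace[OF tracial_subalgebra[OF assms(1) L_vN L_mono[OF assms(2)]]]] .

lemma ex_tracial: "\<exists>\<tau>. tracial (L j) \<tau>"
  using ex_trace[of j] L_vN[of j] by (auto simp: tracial_def)

text \<open>Each basic construction comes with a trace of its own. By uniqueness it agrees with the restriction of
  any trace from further up the tower, so that a single trace serves several steps.\<close>

lemma jones_projection:
  assumes \<tau>: "tracial (L j) \<tau>" and kj: "Suc (Suc k) \<le> j"
  obtains E where "\<And>x. x \<in> L (Suc k) \<Longrightarrow> E x \<in> L k"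
    "\<And>x y. x \<in> L (Suc k) \<Longrightarrow> y \<in> L k \<Longrightarrow> \<tau> (E x * y) = \<tau> (x * y)"
    "\<And>x. x \<in> L (Suc k) \<Longrightarrow> e (Suc k) * x * e (Suc k) = E x * e (Suc k)"
    "\<And>x. x \<in> L k \<Longrightarrow> e (Suc k) * x = x * e (Suc k)" "adj (e (Suc k)) = e (Suc k)"
    "e (Suc k) * e (Suc k) = e (Suc k)" "0 < Re (\<tau> (e (Suc k)))"
proof -
  have R: "tracial_factor (L (Suc (Suc k))) \<tau>" "tracial_factor (L (Suc k)) \<tau>"
    by (rule trace_level[OF \<tau>]; use kj in simp)+
  obtain \<tau>' p \<Lambda> \<pi> E q \<phi> where s: "basic_step (L k) (L (Suc k)) (L (Suc (Suc k))) \<tau>' \<tau> p \<Lambda> \<pi> E (e (Suc k)) q \<phi>"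
    using step tracial.trace[OF tracial_factor.axioms(1)[OF R(1)]] by blast
  interpret s: basic_step "L k" "L (Suc k)" "L (Suc (Suc k))" \<tau>' \<tau> p \<Lambda> \<pi> E "e (Suc k)" q \<phi> by (rule s)
  have same: "\<tau> x = \<tau>' x" if "x \<in> L (Suc k)" for x
    by (rule s.Q.star_iso_trace[OF tracial_factor.axioms(1)[OF R(2)] s.Q.star_iso_id that])
  show ?thesis
  proof (rule that[of E])
    show "E x \<in> L k" if "x \<in> L (Suc k)" for x using that by (rule s.E_mem)
    show "\<tau> (E x * y) = \<tau> (x * y)" if "x \<in> L (Suc k)" "y \<in> L k" for x y
      using s.E_tr[OF that] same[OF vN_closed(3)[OF L_vN s.mem_Q[OF s.E_mem[OF that(1)]] s.mem_Q[OF that(2)]]]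
        same[OF vN_closed(3)[OF L_vN that(1) s.mem_Q[OF that(2)]]] by simp
  qed (fact s.e_compress s.e_commute s.e_proj s.e_trace_pos(1))+
qed

subsection \<open>Extension of automorphisms to the tower\<close>

definition tower_spec :: "('h bop \<Rightarrow> 'h bop) \<Rightarrow> ('h bop \<Rightarrow> 'h bop) \<Rightarrow> bool" where
  "tower_spec \<theta> \<phi> \<longleftrightarrow> \<phi> \<in> extensional (\<Union>k. Mk k) \<and> (\<forall>k. star_iso (Mk k) (Mk k) \<phi>) \<and>
     (\<forall>x \<in> Mk 0. \<phi> x = \<theta> x) \<and> (\<forall>k. \<phi> (e (Suc k)) = e (Suc k))"

lemma tower_spec_exists:
  assumes \<theta>: "star_iso M M \<theta>" "\<theta> ` N = N"
  shows "\<exists>\<phi>. tower_spec \<theta> \<phi>"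
proof -
  have "\<exists>f. \<forall>n. (star_iso (L (Suc n)) (L (Suc n)) (f n) \<and> f n ` L n = L n \<and> (n = 0 \<longrightarrow> f n = \<theta>)) \<and>
      ((\<forall>x\<in>L (Suc n). f (Suc n) x = f n x) \<and> f (Suc n) (e (Suc n)) = e (Suc n))"
  proof (rule dependent_nat_choice)
    show "\<exists>f. star_iso (L (Suc 0)) (L (Suc 0)) f \<and> f ` L 0 = L 0 \<and> (0 = (0::nat) \<longrightarrow> f = \<theta>)"
      using \<theta> by simp
    fix f n assume f: "star_iso (L (Suc n)) (L (Suc n)) f \<and> f ` L n = L n \<and> (n = 0 \<longrightarrow> f = \<theta>)"
    obtain \<tau>\<^sub>R where R: "normal_trace 1 (L (Suc (Suc n))) \<tau>\<^sub>R" using ex_trace by blast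
    obtain \<tau> p \<Lambda> \<pi> E q \<phi> where s: "basic_step (L n) (L (Suc n)) (L (Suc (Suc n))) \<tau> \<tau>\<^sub>R p \<Lambda> \<pi> E (e (Suc n)) q \<phi>"
      using step[OF R] by blast
    obtain g where g: "star_iso (L (Suc (Suc n))) (L (Suc (Suc n))) g" "\<And>x. x \<in> L (Suc n) \<Longrightarrow> g x = f x"
      "g (e (Suc n)) = e (Suc n)"
      using basic_step.iso_extends[OF s] f by blast
    have "g ` L (Suc n) = f ` L (Suc n)" using g(2) by (intro image_cong) auto
    also have "\<dots> = L (Suc n)" using f star_isoD(8) by blast
    finally show "\<exists>g. (star_iso (L (Suc (Suc n))) (L (Suc (Suc n))) g \<and> g ` L (Suc n) = L (Suc n) \<and> (Suc n = 0 \<longrightarrow> g = \<theta>)) \<and>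
      ((\<forall>x\<in>L (Suc n). g x = f x) \<and> g (e (Suc n)) = e (Suc n))" using g by (intro exI[of _ g]) simp
  qed
  then obtain f where f: "\<And>n. star_iso (Mk n) (Mk n) (f n)" "f 0 = \<theta>"
    "\<And>n x. x \<in> Mk n \<Longrightarrow> f (Suc n) x = f n x" "\<And>n. f (Suc n) (e (Suc n)) = e (Suc n)" by auto
  have agree: "f (n + d) x = f n x" if "x \<in> Mk n" for n d x
  proof (induction d)
    case (Suc d)
    have "x \<in> Mk (n + d)" using that Mk_mono[of n "n + d"] by auto
    then show ?case using Suc f(3) by simp
  qed simp
  define \<phi> where "\<phi> x = (if x \<in> (\<Union>k. Mk k) then f (LEAST k. x \<in> Mk k) x else undefined)" for x
  have \<phi>: "\<phi> x = f k x" if x: "x \<in> Mk k" for x k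
  proof -
    let ?l = "LEAST k. x \<in> Mk k"
    have "x \<in> Mk ?l" using x by (rule LeastI)
    moreover have "?l \<le> k" using x by (rule Least_le)
    ultimately show ?thesis using agree[of x ?l "k - ?l"] x by (auto simp: \<phi>_def)
  qed
  have "tower_spec \<theta> \<phi>" unfolding tower_spec_def
  proof (intro conjI allI ballI)
    show "\<phi> \<in> extensional (\<Union>k. Mk k)" by (auto simp: extensional_def \<phi>_def)
    show "star_iso (Mk k) (Mk k) \<phi>" for k by (rule star_iso_cong[OF f(1) Mk_vN \<phi>])
    show "\<phi> x = \<theta> x" if "x \<in> Mk 0" for x using \<phi>[OF that] f(2) by simp
    show "\<phi> (e (Suc k)) = e (Suc k)" for k
      using \<phi>[of "e (Suc k)" "Suc k"] e_mem[of k] f(4) by simp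
  qed
  then show ?thesis by blast
qed

lemma tower_spec_unique:
  assumes 1: "tower_spec \<theta> \<phi>\<^sub>1" and 2: "tower_spec \<theta> \<phi>\<^sub>2" shows "\<phi>\<^sub>1 = \<phi>\<^sub>2"
proof -
  have "\<forall>x\<in>Mk k. \<phi>\<^sub>1 x = \<phi>\<^sub>2 x" for k
  proof (induction k)
    case 0 then show ?case using 1 2 by (simp add: tower_spec_def)
  next
    case (Suc k)
    obtain \<tau>\<^sub>R where R: "normal_trace 1 (L (Suc (Suc k))) \<tau>\<^sub>R" using ex_trace by blast
    obtain \<tau> p \<Lambda> \<pi> E q \<phi> where s: "basic_step (L k) (L (Suc k)) (L (Suc (Suc k))) \<tau> \<tau>\<^sub>R p \<Lambda> \<pi> E (e (Suc k)) q \<phi>"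
      using step[OF R] by blast
    let ?R = "L (Suc (Suc k))"
    define g where "g = inv_into ?R \<phi>\<^sub>1"
    have i: "star_iso ?R ?R \<phi>\<^sub>1" "star_iso ?R ?R \<phi>\<^sub>2" using 1 2 by (simp_all add: tower_spec_def)
    have g: "star_iso ?R ?R g" unfolding g_def by (rule star_iso_inv[OF L_vN L_vN i(1)])
    have g1: "g (\<phi>\<^sub>1 x) = x" if "x \<in> ?R" for x
      unfolding g_def by (rule bij_betw_inv_into_left[OF star_isoD(1)[OF i(1)] that])
    have g2: "\<phi>\<^sub>1 (g x) = x" if "x \<in> ?R" for x
      unfolding g_def by (rule bij_betw_inv_into_right[OF star_isoD(1)[OF i(1)] that])
    have eR: "e (Suc k) \<in> ?R" by (rule e_mem)
    have "g (\<phi>\<^sub>2 x) = x" if "x \<in> ?R" for x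
    proof (rule basic_step.iso_fixing_unique[OF s star_iso_comp[OF i(2) g]])
      show "g (\<phi>\<^sub>2 x) = x" if "x \<in> L (Suc k)" for x
        using g1[of x] Suc that L_Suc[of "Suc k"] by auto
      show "g (\<phi>\<^sub>2 (e (Suc k))) = e (Suc k)"
        using g1[OF eR] 1 2 by (simp add: tower_spec_def)
    qed (rule that)
    then have "\<phi>\<^sub>1 x = \<phi>\<^sub>2 x" if "x \<in> ?R" for x
      using g2[OF star_isoD(2)[OF i(2) that]] that by simp
    then show ?case by simp
  qed
  then have "\<phi>\<^sub>1 x = \<phi>\<^sub>2 x" if "x \<in> (\<Union>k. Mk k)" for x using that by blast
  then show ?thesis
    using 1 2 unfolding tower_spec_def by (intro extensionalityI[of _ "\<Union>k. Mk k"]) auto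
qed

lemma tower_ext_spec:
  assumes "star_iso M M \<theta>" "\<theta> ` N = N" shows "tower_spec \<theta> (tower_ext Mk e \<theta>)"
proof -
  have "\<exists>!\<phi>. tower_spec \<theta> \<phi>" using tower_spec_exists[OF assms] tower_spec_unique by blast
  then show ?thesis
    unfolding tower_ext_def tower_spec_def[symmetric] by (rule theI')
qed

lemma tower_ext_eqI: "star_iso M M \<theta> \<Longrightarrow> \<theta> ` N = N \<Longrightarrow> tower_spec \<theta> \<phi> \<Longrightarrow> tower_ext Mk e \<theta> = \<phi>"
  using tower_ext_spec tower_spec_unique by blast

end

lemma (in tracial) trace_separates:
  assumes "x \<in> A" "y \<in> A" "\<And>z. z \<in> A \<Longrightarrow> \<tau> (x * z) = \<tau> (y * z)" shows "x = y"
proof -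
  let ?d = "x - y"
  have d: "?d \<in> A" using assms by simp
  then have ad: "adj ?d \<in> A" by (rule mem_closed(5))
  have "\<tau> (?d * adj ?d) = \<tau> (x * adj ?d) - \<tau> (y * adj ?d)"
    unfolding left_diff_distrib by (rule tr_diff; rule mem_closed; fact)
  also have "\<dots> = 0" using assms(3)[OF ad] by simp
  finally have "\<tau> (adj ?d * ?d) = 0" using tr_commute[OF d ad] by simp
  then have "?d = 0" by (rule tr_faithful[OF d])
  then show ?thesis by simp
qed

context jones_setting
begin

subsection \<open>Relations between Jones projections\<close>

lemma L_mem: "x \<in> L i \<Longrightarrow> i \<le> j \<Longrightarrow> x \<in> L j"
  using L_mono by blast

lemma e_commute_L: "x \<in> L k \<Longrightarrow> e (Suc k) * x = x * e (Suc k)" and e_adj: "adj (e (Suc k)) = e (Suc k)"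
  and e_idem: "e (Suc k) * e (Suc k) = e (Suc k)"
proof -
  obtain \<tau> where \<tau>: "tracial (L (Suc (Suc k))) \<tau>" using ex_tracial by blast
  obtain E where "\<And>x. x \<in> L k \<Longrightarrow> e (Suc k) * x = x * e (Suc k)" "adj (e (Suc k)) = e (Suc k)"
    "e (Suc k) * e (Suc k) = e (Suc k)" by (rule jones_projection[OF \<tau> order_refl]) blast
  then show "x \<in> L k \<Longrightarrow> e (Suc k) * x = x * e (Suc k)" "adj (e (Suc k)) = e (Suc k)"
    "e (Suc k) * e (Suc k) = e (Suc k)" by auto
qed

lemma trace_product:
  assumes \<tau>: "tracial (L j) \<tau>" and k: "k \<le> j" and y: "y \<in> L k" and b: "b \<in> L j"
    and c: "\<And>x. x \<in> L k \<Longrightarrow> b * x = x * b"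
  shows "\<tau> (y * b) = \<tau> y * \<tau> b"
  by (rule trace_independent[OF \<tau> trace_level[OF \<tau> k] L_mono[OF k] y b c])

text \<open>The scalar appears by the Markov property \<open>\<tau>(e y) = \<tau>(e) \<tau>(y)\<close> for \<open>y\<close> in the algebra just below \<open>e\<close>:
  compress \<open>y\<close> to the factor that commutes with \<open>e\<close> and use independence.\<close>

lemma jones_relation:
  assumes \<tau>: "tracial (L j) \<tau>" and k: "Suc (Suc (Suc k)) \<le> j"
  shows "e (Suc (Suc k)) * e (Suc k) * e (Suc (Suc k)) = \<tau> (e (Suc k)) *\<^sub>C e (Suc (Suc k))"
proof -
  interpret t: tracial "L j" \<tau> by fact
  interpret s: tracial_factor "L (Suc k)" \<tau> by (rule trace_level[OF \<tau>]) (use k in simp)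
  obtain E where E: "\<And>x. x \<in> L (Suc k) \<Longrightarrow> E x \<in> L k"
    "\<And>x y. x \<in> L (Suc k) \<Longrightarrow> y \<in> L k \<Longrightarrow> \<tau> (E x * y) = \<tau> (x * y)"
    "\<And>x. x \<in> L (Suc k) \<Longrightarrow> e (Suc k) * x * e (Suc k) = E x * e (Suc k)"
    by (rule jones_projection[OF \<tau>, of k]) (use k in \<open>simp, blast\<close>)
  obtain F where F: "\<And>x. x \<in> L (Suc (Suc k)) \<Longrightarrow> F x \<in> L (Suc k)"
    "\<And>x y. x \<in> L (Suc (Suc k)) \<Longrightarrow> y \<in> L (Suc k) \<Longrightarrow> \<tau> (F x * y) = \<tau> (x * y)"
    "\<And>x. x \<in> L (Suc (Suc k)) \<Longrightarrow> e (Suc (Suc k)) * x * e (Suc (Suc k)) = F x * e (Suc (Suc k))"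
    by (rule jones_projection[OF \<tau>, of "Suc k"]) (use k in blast)+
  let ?e = "e (Suc k)"
  have eL: "?e \<in> L (Suc (Suc k))" by (rule e_mem)
  have eJ: "?e \<in> L j" by (rule L_mem[OF eL]) (use k in simp)
  have up: "x \<in> L j" if "x \<in> L (Suc k)" for x by (rule L_mem[OF that]) (use k in simp)
  have "F ?e = \<tau> ?e *\<^sub>C 1"
  proof (rule s.trace_separates)
    show "F ?e \<in> L (Suc k)" by (rule F(1)[OF eL])
    show "\<tau> ?e *\<^sub>C 1 \<in> L (Suc k)" by (rule s.mem_closed(4)[OF s.mem_closed(6)])
    fix y assume y: "y \<in> L (Suc k)"
    have Ey: "E y \<in> L k" "E y \<in> L j" using E(1)[OF y] L_mem[OF E(1)[OF y], of j] k by auto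
    have "\<tau> (F ?e * y) = \<tau> (?e * y)" by (rule F(2)[OF eL y])
    also have "\<dots> = \<tau> (?e * (?e * y))" by (simp add: mult.assoc[symmetric] e_idem)
    also have "\<dots> = \<tau> ((?e * y) * ?e)" by (rule t.tr_commute) (use eJ up[OF y] in auto)
    also have "\<dots> = \<tau> (E y * ?e)" by (simp add: E(3)[OF y])
    also have "\<dots> = \<tau> (E y) * \<tau> ?e"
      by (rule trace_product[OF \<tau> _ Ey(1) eJ e_commute_L]) (use k in auto)
    also have "\<tau> (E y) = \<tau> y" using E(2)[OF y vN_unit_mem[OF L_vN]] by simp
    also have "\<tau> y * \<tau> ?e = \<tau> ((\<tau> ?e *\<^sub>C 1) * y)" using t.tr_scale[OF up[OF y]] by simp
    finally show "\<tau> (F ?e * y) = \<tau> ((\<tau> ?e *\<^sub>C 1) * y)" .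
  qed
  then show ?thesis using F(3)[OF eL] by simp
qed

text \<open>The indices advance by 2, so that the factors commute and the product is a projection.\<close>

fun odd_proj :: "nat \<Rightarrow> nat \<Rightarrow> 'h bop" where
  "odd_proj a 0 = 1"
| "odd_proj a (Suc m) = e (Suc a) * odd_proj (Suc (Suc a)) m"

lemma odd_proj_mem: "odd_proj a m \<in> L (a + 2 * m)"
proof (induction m arbitrary: a)
  case 0 then show ?case using vN_unit_mem[OF L_vN] by simp
next
  case (Suc m)
  have "e (Suc a) \<in> L (a + 2 * Suc m)" by (rule L_mem[OF e_mem]) simp
  then show ?case using vN_closed(3)[OF L_vN, of "e (Suc a)" "a + 2 * Suc m"] Suc[of "Suc (Suc a)"]
    by (simp del: L_simps)
qed

lemma odd_proj_commute: "x \<in> L a \<Longrightarrow> odd_proj a m * x = x * odd_proj a m"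
proof (induction m arbitrary: a)
  case (Suc m)
  have x: "x \<in> L (Suc (Suc a))" by (rule L_mem[OF Suc.prems]) simp
  have "odd_proj a (Suc m) * x = e (Suc a) * (odd_proj (Suc (Suc a)) m * x)" by (simp add: mult.assoc)
  also have "\<dots> = (e (Suc a) * x) * odd_proj (Suc (Suc a)) m" by (simp only: Suc.IH[OF x] mult.assoc)
  also have "\<dots> = x * odd_proj a (Suc m)" by (simp only: e_commute_L[OF Suc.prems] odd_proj.simps mult.assoc)
  finally show ?case .
qed simp

lemma odd_proj_projection: "adj (odd_proj a m) = odd_proj a m" "odd_proj a m * odd_proj a m = odd_proj a m"
proof (induction m arbitrary: a)
  case (Suc m)
  note c = odd_proj_commute[OF e_mem, of _ m]
  { case 1 show ?case by (simp only: odd_proj.simps adj_simps e_adj Suc c) }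
  { case 2
    let ?s = "odd_proj (Suc (Suc a)) m"
    have "odd_proj a (Suc m) * odd_proj a (Suc m) = e (Suc a) * (?s * e (Suc a)) * ?s" by (simp add: mult.assoc)
    also have "\<dots> = (e (Suc a) * e (Suc a)) * (?s * ?s)" by (simp only: c mult.assoc)
    finally show ?case by (simp add: e_idem Suc) }
qed simp_all

lemma odd_proj_trace:
  assumes "tracial (L j) \<tau>" "a + 2 * m \<le> j" shows "\<tau> (odd_proj a m) \<noteq> 0"
  using assms(2)
proof (induction m arbitrary: a)
  case 0 then show ?case using tracial.tr_1[OF assms(1)] by simp
next
  case (Suc m)
  let ?s = "odd_proj (Suc (Suc a)) m"
  have "\<tau> (e (Suc a) * ?s) = \<tau> (e (Suc a)) * \<tau> ?s"
  proof (rule trace_product[OF assms(1) _ e_mem _ odd_proj_commute])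
    show "?s \<in> L j" by (rule L_mem[OF odd_proj_mem]) (use Suc.prems in simp)
  qed (use Suc.prems in auto)
  moreover have "\<tau> (e (Suc a)) \<noteq> 0"
    by (rule jones_projection[OF assms(1), of a]) (use Suc.prems in auto)
  ultimately show ?case using Suc.IH[of "Suc (Suc a)"] Suc.prems by simp
qed

lemma odd_proj_relation:
  assumes \<tau>: "tracial (L j) \<tau>" and "Suc a + 2 * m \<le> j"
  shows "\<exists>\<mu>. \<mu> \<noteq> 0 \<and> odd_proj (Suc a) m * odd_proj a m * odd_proj (Suc a) m = \<mu> *\<^sub>C odd_proj (Suc a) m"
  using assms(2)
proof (induction m arbitrary: a)
  case 0 then show ?case by (intro exI[of _ 1]) simp
next
  case (Suc m)
  let ?f = "e (Suc (Suc a))" and ?g = "e (Suc a)"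
  let ?s = "odd_proj (Suc (Suc (Suc a))) m" and ?t = "odd_proj (Suc (Suc a)) m"
  obtain \<mu> where \<mu>: "\<mu> \<noteq> 0" "?s * ?t * ?s = \<mu> *\<^sub>C ?s" using Suc.IH[of "Suc (Suc a)"] Suc.prems by auto
  have \<lambda>: "\<tau> ?g \<noteq> 0" by (rule jones_projection[OF \<tau>, of a]) (use Suc.prems in auto)
  have sg: "?s * ?g = ?g * ?s" by (rule odd_proj_commute[OF L_mem[OF e_mem]]) simp
  have sf: "?s * ?f = ?f * ?s" by (rule odd_proj_commute[OF e_mem])
  have "(?f * ?s) * (?g * ?t) * (?f * ?s) = ?f * (?s * ?g) * ?t * (?s * ?f)"
    by (simp only: sf mult.assoc)
  also have "\<dots> = ?f * ?g * (?s * ?t * ?s) * ?f" by (simp only: sg mult.assoc)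
  also have "\<dots> = \<mu> *\<^sub>C (?f * ?g * (?s * ?f))"
    by (simp only: \<mu>(2) bop_scaleC_mult) (simp only: mult.assoc)
  also have "\<dots> = \<mu> *\<^sub>C ((?f * ?g * ?f) * ?s)" by (simp only: sf mult.assoc)
  also have "?f * ?g * ?f = \<tau> ?g *\<^sub>C ?f" by (rule jones_relation[OF \<tau>]) (use Suc.prems in simp)
  finally show ?case using \<mu>(1) \<lambda> by (intro exI[of _ "\<mu> * \<tau> ?g"]) simp
qed

text \<open>The element \<open>w\<close> plays the part of the Jones projection of the multistep basic construction for
  \<open>L a \<subseteq> L (a + m)\<close>. To gain a step, multiply the element for \<open>L (a + 1) \<subseteq> L (a + 1 + m)\<close> by
  \<open>odd_proj a (m + 1)\<close>: its first factor implements the expectation of \<open>L (a + 1)\<close> onto \<open>L a\<close>, and the other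
  factors absorb \<open>odd_proj (a + 1) m\<close> by the relation above.\<close>

lemma expectation_implemented:
  assumes \<tau>: "tracial (L j) \<tau>" and "a + 2 * m \<le> j"
  shows "\<exists>w F c. w \<in> L (a + 2 * m) \<and> (\<forall>b\<in>L a. w * b = b * w) \<and> c \<noteq> 0 \<and>
    (\<forall>x\<in>L (a + m). F x \<in> L a \<and> (\<forall>y\<in>L a. \<tau> (F x * y) = \<tau> (x * y)) \<and>
       adj w * x * w = c *\<^sub>C (F x * odd_proj a m))"
  using assms(2)
proof (induction m arbitrary: a)
  case 0
  show ?case
    by (rule exI[of _ 1], rule exI[of _ "\<lambda>x. x"], rule exI[of _ 1])
       (use vN_unit_mem[OF L_vN] in simp)
next
  case (Suc m)
  obtain w F c where w: "w \<in> L (Suc a + 2 * m)" "\<forall>b\<in>L (Suc a). w * b = b * w" "c \<noteq> 0"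
    and F: "\<forall>x\<in>L (Suc a + m). F x \<in> L (Suc a) \<and> (\<forall>y\<in>L (Suc a). \<tau> (F x * y) = \<tau> (x * y)) \<and>
       adj w * x * w = c *\<^sub>C (F x * odd_proj (Suc a) m)"
    using Suc.IH[of "Suc a"] Suc.prems by auto
  obtain E where E: "\<And>x. x \<in> L (Suc a) \<Longrightarrow> E x \<in> L a"
    "\<And>x y. x \<in> L (Suc a) \<Longrightarrow> y \<in> L a \<Longrightarrow> \<tau> (E x * y) = \<tau> (x * y)"
    "\<And>x. x \<in> L (Suc a) \<Longrightarrow> e (Suc a) * x * e (Suc a) = E x * e (Suc a)"
    by (rule jones_projection[OF \<tau>, of a]) (use Suc.prems in \<open>simp, blast\<close>)
  let ?e = "e (Suc a)" and ?s = "odd_proj (Suc (Suc a)) m" and ?D = "odd_proj a (Suc m)" and ?D1 = "odd_proj (Suc a) m"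
  obtain \<mu> where \<mu>: "\<mu> \<noteq> 0" "?s * ?D1 * ?s = \<mu> *\<^sub>C ?s"
    using odd_proj_relation[OF \<tau>, of "Suc a" m] Suc.prems by auto
  have se: "?s * ?e = ?e * ?s" by (rule odd_proj_commute[OF e_mem])
  have key: "?D * (y * ?D1) * ?D = \<mu> *\<^sub>C (E y * ?D)" if y: "y \<in> L (Suc a)" for y
  proof -
    have sy: "?s * y = y * ?s" by (rule odd_proj_commute[OF L_mem[OF y]]) simp
    have "?D * (y * ?D1) * ?D = ?e * (?s * y) * ?D1 * (?e * ?s)" by (simp add: mult.assoc)
    also have "\<dots> = ?e * y * (?s * ?D1 * ?s) * ?e" by (simp only: sy se[symmetric] mult.assoc)
    also have "\<dots> = \<mu> *\<^sub>C (?e * y * (?s * ?e))"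
      by (simp only: \<mu>(2) bop_scaleC_mult) (simp only: mult.assoc)
    also have "\<dots> = \<mu> *\<^sub>C ((?e * y * ?e) * ?s)" by (simp only: se mult.assoc)
    also have "\<dots> = \<mu> *\<^sub>C (E y * ?D)" by (simp only: E(3)[OF y]) (simp only: odd_proj.simps mult.assoc)
    finally show ?thesis .
  qed
  have wL: "w \<in> L (a + 2 * Suc m)" by (rule L_mem[OF w(1)]) simp
  show ?case
  proof (rule exI[of _ "w * ?D"], rule exI[of _ "\<lambda>x. E (F x)"], rule exI[of _ "c * \<mu>"], intro conjI ballI)
    show "w * ?D \<in> L (a + 2 * Suc m)" by (rule vN_closed(3)[OF L_vN wL odd_proj_mem])
    show "w * ?D * b = b * (w * ?D)" if b: "b \<in> L a" for b
    proof -
      have b': "b \<in> L (Suc a)" by (rule L_mem[OF b]) simp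
      have "w * ?D * b = w * (?D * b)" by (simp only: mult.assoc)
      also have "\<dots> = (w * b) * ?D" by (simp only: odd_proj_commute[OF b] mult.assoc)
      also have "w * b = b * w" using w(2) b' by blast
      finally show ?thesis by (simp only: mult.assoc)
    qed
    show "c * \<mu> \<noteq> 0" using w(3) \<mu>(1) by simp
    fix x assume "x \<in> L (a + Suc m)"
    then have x: "x \<in> L (Suc a + m)" by simp
    have Fx: "F x \<in> L (Suc a)" "adj w * x * w = c *\<^sub>C (F x * ?D1)" using F x by blast+
    have F\<tau>: "\<tau> (F x * y) = \<tau> (x * y)" if "y \<in> L (Suc a)" for y using F x that by blast
    show "E (F x) \<in> L a" by (rule E(1)[OF Fx(1)])
    show "\<tau> (E (F x) * y) = \<tau> (x * y)" if y: "y \<in> L a" for y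
    proof -
      have "y \<in> L (Suc a)" by (rule L_mem[OF y]) simp
      then show ?thesis using E(2)[OF Fx(1) y] F\<tau> by simp
    qed
    have "adj (w * ?D) * x * (w * ?D) = ?D * (adj w * x * w) * ?D"
      by (simp only: adj_simps(1) odd_proj_projection mult.assoc)
    also have "\<dots> = c *\<^sub>C (?D * (F x * ?D1) * ?D)" by (simp only: Fx(2) bop_scaleC_mult)
    also have "\<dots> = (c * \<mu>) *\<^sub>C (E (F x) * ?D)" by (simp only: key[OF Fx(1)] scaleC_scaleC)
    finally show "adj (w * ?D) * x * (w * ?D) = (c * \<mu>) *\<^sub>C (E (F x) * ?D)" .
  qed
qed

lemma Mk_mem: "x \<in> Mk i \<Longrightarrow> i \<le> j \<Longrightarrow> x \<in> Mk j"
  using Mk_mono by blast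

lemma M_Mk: "x \<in> M \<Longrightarrow> x \<in> Mk j"
  using Mk_mem[of x 0 j] by simp

text \<open>The situation of the previous lemma for \<open>M \<subseteq> M\<^sub>m\<close>; \<open>D\<close> is a product of Jones projections and \<open>F\<close> is the
  conditional expectation. On elements that commute with \<open>M\<close> it is the trace, as \<open>M\<close> is a factor.\<close>

definition implements ::
    "('h bop \<Rightarrow> complex) \<Rightarrow> nat \<Rightarrow> 'h bop \<Rightarrow> 'h bop \<Rightarrow> ('h bop \<Rightarrow> 'h bop) \<Rightarrow> complex \<Rightarrow> bool" where
  "implements \<tau> m w D F c \<longleftrightarrow> w \<in> Mk (2 * m) \<and> D \<in> Mk (2 * m) \<and> (\<forall>b\<in>M. w * b = b * w) \<and>
     (\<forall>b\<in>M. D * b = b * D) \<and> adj D = D \<and> D * D = D \<and> \<tau> D \<noteq> 0 \<and> c \<noteq> 0 \<and>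
     (\<forall>x\<in>Mk m. F x \<in> M \<and> \<tau> (F x) = \<tau> x \<and> adj w * x * w = c *\<^sub>C (F x * D) \<and>
        ((\<forall>b\<in>M. x * b = b * x) \<longrightarrow> F x = \<tau> x *\<^sub>C 1))"

lemma implementsD:
  assumes "implements \<tau> m w D F c"
  shows "w \<in> Mk (2 * m)" "D \<in> Mk (2 * m)" "\<And>b. b \<in> M \<Longrightarrow> w * b = b * w"
    "\<And>b. b \<in> M \<Longrightarrow> D * b = b * D" "adj D = D" "D * D = D" "\<tau> D \<noteq> 0" "c \<noteq> 0"
    "\<And>x. x \<in> Mk m \<Longrightarrow> F x \<in> M" "\<And>x. x \<in> Mk m \<Longrightarrow> \<tau> (F x) = \<tau> x"
    "\<And>x. x \<in> Mk m \<Longrightarrow> adj w * x * w = c *\<^sub>C (F x * D)"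
    "\<And>x. x \<in> Mk m \<Longrightarrow> (\<And>b. b \<in> M \<Longrightarrow> x * b = b * x) \<Longrightarrow> F x = \<tau> x *\<^sub>C 1"
proof -
  have h: "w \<in> Mk (2 * m)" "D \<in> Mk (2 * m)" "\<forall>b\<in>M. w * b = b * w"
    "\<forall>b\<in>M. D * b = b * D" "adj D = D" "D * D = D" "\<tau> D \<noteq> 0" "c \<noteq> 0"
    "\<forall>x\<in>Mk m. F x \<in> M \<and> \<tau> (F x) = \<tau> x \<and> adj w * x * w = c *\<^sub>C (F x * D) \<and>
        ((\<forall>b\<in>M. x * b = b * x) \<longrightarrow> F x = \<tau> x *\<^sub>C 1)"
    using assms unfolding implements_def by - (elim conjE; assumption)+
  show "w \<in> Mk (2 * m)" "D \<in> Mk (2 * m)" "adj D = D" "D * D = D" "\<tau> D \<noteq> 0" "c \<noteq> 0" by fact+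
  show "\<And>b. b \<in> M \<Longrightarrow> w * b = b * w" by (rule h(3)[rule_format])
  show "\<And>b. b \<in> M \<Longrightarrow> D * b = b * D" by (rule h(4)[rule_format])
  show "\<And>x. x \<in> Mk m \<Longrightarrow> F x \<in> M" by (rule h(9)[rule_format, THEN conjunct1])
  show "\<And>x. x \<in> Mk m \<Longrightarrow> \<tau> (F x) = \<tau> x" by (rule h(9)[rule_format, THEN conjunct2, THEN conjunct1])
  show "\<And>x. x \<in> Mk m \<Longrightarrow> adj w * x * w = c *\<^sub>C (F x * D)"
    by (rule h(9)[rule_format, THEN conjunct2, THEN conjunct2, THEN conjunct1])
  show "\<And>x. x \<in> Mk m \<Longrightarrow> (\<And>b. b \<in> M \<Longrightarrow> x * b = b * x) \<Longrightarrow> F x = \<tau> x *\<^sub>C 1"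
    by (rule h(9)[rule_format, THEN conjunct2, THEN conjunct2, THEN conjunct2, THEN mp]) auto
qed

lemma M_expectation_implemented:
  assumes \<tau>: "tracial (Mk (2 * m)) \<tau>"
  shows "\<exists>w D F c. implements \<tau> m w D F c"
proof -
  have \<tau>': "tracial (L (Suc (2 * m))) \<tau>" using \<tau> by simp
  obtain w F c where w: "w \<in> L (1 + 2 * m)" "\<forall>b\<in>L 1. w * b = b * w" "c \<noteq> 0"
    and F: "\<forall>x\<in>L (1 + m). F x \<in> L 1 \<and> (\<forall>y\<in>L 1. \<tau> (F x * y) = \<tau> (x * y)) \<and>
       adj w * x * w = c *\<^sub>C (F x * odd_proj 1 m)"
    using expectation_implemented[OF \<tau>', of 1 m] by auto
  have L1: "L 1 = M" by (simp add: One_nat_def)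
  interpret s: tracial_factor "L 1" \<tau> by (rule trace_level[OF \<tau>']) simp
  have F': "F x \<in> M" "\<And>y. y \<in> M \<Longrightarrow> \<tau> (F x * y) = \<tau> (x * y)" "adj w * x * w = c *\<^sub>C (F x * odd_proj 1 m)"
    if "x \<in> Mk m" for x using F that unfolding L1 by auto
  have "implements \<tau> m w (odd_proj 1 m) F c" unfolding implements_def
  proof (intro conjI ballI impI)
    show "w \<in> Mk (2 * m)" using w(1) by simp
    show "odd_proj 1 m \<in> Mk (2 * m)" using odd_proj_mem[of 1 m] by simp
    show "w * b = b * w" if "b \<in> M" for b using w(2) that unfolding L1 by blast
    show "odd_proj 1 m * b = b * odd_proj 1 m" if "b \<in> M" for b
      by (rule odd_proj_commute) (use that L1 in simp)
    show "\<tau> (odd_proj 1 m) \<noteq> 0" by (rule odd_proj_trace[OF \<tau>']) simp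
    show "\<tau> (F x) = \<tau> x" if "x \<in> Mk m" for x
      using F'(2)[OF that, of 1] vN_unit_mem[OF Mk_vN[of 0]] by simp
    show "F x = \<tau> x *\<^sub>C 1" if x: "x \<in> Mk m" "\<forall>b\<in>M. x * b = b * x" for x
    proof (rule s.trace_separates)
      show "F x \<in> L 1" using F'(1)[OF x(1)] L1 by simp
      show "\<tau> x *\<^sub>C 1 \<in> L 1" by (rule s.mem_closed(4)[OF s.mem_closed(6)])
      fix z assume z: "z \<in> L 1"
      then have zM: "z \<in> M" by (simp only: L1)
      have xL: "x \<in> L (Suc (2 * m))" using x(1) Mk_mem[of x m "2 * m"] by simp
      have zL: "z \<in> L (Suc (2 * m))" using M_Mk[OF zM] by simp
      have "\<tau> (F x * z) = \<tau> (z * x)" using F'(2)[OF x(1) zM] x(2) zM by simp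
      also have "\<dots> = \<tau> z * \<tau> x"
        by (rule trace_product[OF \<tau>' _ z xL]) (use x(2) L1 in auto)
      also have "\<dots> = \<tau> ((\<tau> x *\<^sub>C 1) * z)" using tracial.tr_scale[OF \<tau>' zL] by simp
      finally show "\<tau> (F x * z) = \<tau> ((\<tau> x *\<^sub>C 1) * z)" .
    qed
  qed (use odd_proj_projection w(3) F' in auto)
  then show ?thesis by blast
qed

lemma ex_tracial_Mk: "\<exists>\<tau>. tracial (Mk j) \<tau>"
  using ex_tracial[of "Suc j"] by simp

text \<open>By independence \<open>\<tau>(y\<^sup>*y b b\<^sup>*) = \<tau>(y\<^sup>*y) \<tau>(b b\<^sup>*)\<close>.\<close>

lemma M_faithful_on_commutant:
  assumes y: "y \<in> M" and b: "b \<in> Mk m" "\<And>x. x \<in> M \<Longrightarrow> b * adj b * x = x * (b * adj b)"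
    and 0: "y * b = 0" and nz: "b \<noteq> 0"
  shows "y = 0"
proof -
  obtain \<tau> where \<tau>: "tracial (Mk m) \<tau>" using ex_tracial_Mk by blast
  have \<tau>': "tracial (L (Suc m)) \<tau>" using \<tau> by simp
  interpret t: tracial "Mk m" \<tau> by fact
  have ym: "y \<in> Mk m" using M_Mk[OF y] .
  have yy: "adj y * y \<in> M" using vN_closed(3)[OF Mk_vN[of 0]] vN_adj[OF Mk_vN[of 0]] y by simp
  have "(adj y * y) * (b * adj b) = adj y * (y * b) * adj b" by (simp only: mult.assoc)
  then have "\<tau> ((adj y * y) * (b * adj b)) = 0" by (simp add: 0)
  moreover have "\<tau> ((adj y * y) * (b * adj b)) = \<tau> (adj y * y) * \<tau> (b * adj b)"
    by (rule trace_product[OF \<tau>', of 1]) (use yy b in \<open>auto simp: One_nat_def\<close>)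
  ultimately have "\<tau> (adj y * y) = 0 \<or> \<tau> (b * adj b) = 0" by simp
  then show "y = 0"
  proof
    assume "\<tau> (adj y * y) = 0"
    then show ?thesis by (rule t.tr_faithful[OF ym])
  next
    assume "\<tau> (b * adj b) = 0"
    then have "adj b = 0" using t.tr_faithful[of "adj b"] b(1) by simp
    then have "adj (adj b) = 0" by simp
    then show ?thesis using nz by (simp only: adj_adj)
  qed
qed

end

context jones_setting
begin

section \<open>Intertwiners and their unitaries\<close>

text \<open>Membership in \<open>Aut M N\<close> without the normalisation off \<open>M\<close>, so that composites and inverses need no
  restriction.\<close>

definition pair_aut :: "('h bop \<Rightarrow> 'h bop) \<Rightarrow> bool" where
  "pair_aut \<theta> \<longleftrightarrow> star_iso M M \<theta> \<and> \<theta> ` N = N"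

lemma Aut_pair_aut: "\<theta> \<in> Aut M N \<Longrightarrow> pair_aut \<theta>"
  by (simp add: Aut_def pair_aut_def)

lemma pair_autD:
  assumes "pair_aut \<theta>"
  shows "star_iso M M \<theta>" "\<theta> ` N = N" "x \<in> M \<Longrightarrow> \<theta> x \<in> M" "\<theta> ` M = M"
    "x \<in> M \<Longrightarrow> y \<in> M \<Longrightarrow> \<theta> (x * y) = \<theta> x * \<theta> y" "x \<in> M \<Longrightarrow> \<theta> (adj x) = adj (\<theta> x)" "\<theta> 1 = 1"
    "x \<in> N \<Longrightarrow> \<theta> x \<in> N"
  using assms star_isoD[of M M \<theta>] star_iso_unit[OF Mk_vN[of 0] Mk_vN[of 0]]
  by (auto simp: pair_aut_def)

lemma tower_extD:
  assumes "pair_aut \<theta>"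
  shows "star_iso (Mk k) (Mk k) (tower_ext Mk e \<theta>)" "x \<in> M \<Longrightarrow> tower_ext Mk e \<theta> x = \<theta> x"
    "tower_ext Mk e \<theta> (e (Suc k)) = e (Suc k)" "tower_ext Mk e \<theta> \<in> extensional (\<Union>k. Mk k)"
  using tower_ext_spec[OF pair_autD(1,2)[OF assms]] by (auto simp: tower_spec_def)

lemma Ker_LoiD:
  assumes "\<alpha> \<in> Ker_Loi M N Mk e"
  shows "pair_aut \<alpha>"
    "x \<in> Mk j \<Longrightarrow> (\<And>b. b \<in> M \<Longrightarrow> x * b = b * x) \<Longrightarrow> tower_ext Mk e \<alpha> x = x"
  using assms Aut_pair_aut by (auto simp: Ker_Loi_def commutant_def)

lemma M_closed:
  "x \<in> M \<Longrightarrow> y \<in> M \<Longrightarrow> x * y \<in> M" "x \<in> M \<Longrightarrow> adj x \<in> M" "x \<in> M \<Longrightarrow> c *\<^sub>C x \<in> M" "1 \<in> M"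
  "x \<in> M \<Longrightarrow> y \<in> M \<Longrightarrow> x - y \<in> M"
  using vN_closed[OF Mk_vN[of 0]] vN_adj[OF Mk_vN[of 0]] vN_unit_mem[OF Mk_vN[of 0]] by simp_all

lemma Mk_closed:
  "x \<in> Mk k \<Longrightarrow> y \<in> Mk k \<Longrightarrow> x * y \<in> Mk k" "x \<in> Mk k \<Longrightarrow> adj x \<in> Mk k" "x \<in> Mk k \<Longrightarrow> c *\<^sub>C x \<in> Mk k"
  "x \<in> Mk k \<Longrightarrow> y \<in> Mk k \<Longrightarrow> x - y \<in> Mk k" "x \<in> Mk k \<Longrightarrow> y \<in> Mk k \<Longrightarrow> x + y \<in> Mk k"
  using vN_closed[OF Mk_vN] vN_adj[OF Mk_vN] by simp_all

lemma M_central_scalar: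
  assumes "z \<in> M" "\<And>x. x \<in> M \<Longrightarrow> z * x = x * z" obtains c where "z = c *\<^sub>C 1"
proof -
  have "z \<in> M \<inter> commutant 1 M" using assms by (auto simp: commutant_def)
  also have "\<dots> = range (\<lambda>c. c *\<^sub>C 1)" using L_factor[of 1] by (simp add: vN_factor_def One_nat_def)
  finally show ?thesis using that by blast
qed

lemma intertwinersD: "a \<in> intertwiners M P \<rho> \<Longrightarrow> a \<in> P" "a \<in> intertwiners M P \<rho> \<Longrightarrow> x \<in> M \<Longrightarrow> \<rho> x * a = a * x"
  by (auto simp: intertwiners_def)

lemma intertwiners_mono: "i \<le> j \<Longrightarrow> a \<in> intertwiners M (Mk i) \<rho> \<Longrightarrow> a \<in> intertwiners M (Mk j) \<rho>"
  using Mk_mono by (auto simp: intertwiners_def)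

context
  fixes \<rho> a k
  assumes \<rho>: "pair_aut \<rho>" and a: "a \<in> intertwiners M (Mk k) \<rho>"
begin

lemma intertwiner_adj: "x \<in> M \<Longrightarrow> adj a * \<rho> x = x * adj a"
  using arg_cong[OF intertwinersD(2)[OF a, of "adj x"], of adj] M_closed(2)[of x] pair_autD(6)[OF \<rho>, of "adj x"]
  by simp

lemma intertwiner_left:
  assumes T: "\<And>x. x \<in> M \<Longrightarrow> T * x = x * T" and y: "y \<in> M"
  shows "(a * T * adj a) * y = y * (a * T * adj a)"
proof -
  obtain x where x: "x \<in> M" "y = \<rho> x" using pair_autD(4)[OF \<rho>] y by blast
  have "(a * T * adj a) * y = a * T * (adj a * \<rho> x)" by (simp only: x(2) mult.assoc)
  also have "\<dots> = a * (T * x) * adj a" by (simp only: intertwiner_adj[OF x(1)] mult.assoc)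
  also have "\<dots> = (a * x) * T * adj a" by (simp only: T[OF x(1)] mult.assoc)
  also have "\<dots> = y * (a * T * adj a)" by (simp only: intertwinersD(2)[OF a x(1), symmetric] x(2) mult.assoc)
  finally show ?thesis .
qed

lemma intertwiner_aa: "y \<in> M \<Longrightarrow> (a * adj a) * y = y * (a * adj a)"
  using intertwiner_left[of 1 y] by simp

lemma intertwiner_right: "x \<in> M \<Longrightarrow> (adj a * a) * x = x * (adj a * a)"
proof -
  assume x: "x \<in> M"
  have "(adj a * a) * x = (adj a * \<rho> x) * a" by (simp only: intertwinersD(2)[OF a x, symmetric] mult.assoc)
  then show ?thesis by (simp only: intertwiner_adj[OF x] mult.assoc)
qed

lemma intertwiner_cancel: "a \<noteq> 0 \<Longrightarrow> y \<in> M \<Longrightarrow> y * a = 0 \<Longrightarrow> y = 0"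
  by (rule M_faithful_on_commutant[OF _ intertwinersD(1)[OF a] intertwiner_aa])

end

lemma tracial_norm_nonzero:
  assumes "tracial A \<tau>" "a \<in> A" "a \<noteq> 0" shows "\<tau> (adj a * a) \<noteq> 0"
  using tracial.tr_faithful[OF assms(1,2)] assms(3) by blast

text \<open>If \<open>w\<close> implements the conditional expectation of \<open>M\<^sub>k\<close> onto \<open>M\<close> then \<open>a w w\<^sup>* a\<^sup>*\<close> lies in a higher
  relative commutant of \<open>M\<close>, on which \<open>\<alpha>\<close> acts trivially. Compressing the resulting identity by \<open>w\<close>
  shows that \<open>\<alpha> a\<close> is in \<open>a M\<close>.\<close>

lemma intertwiner_moves_in_bimodule:
  assumes \<alpha>K: "\<alpha> \<in> Ker_Loi M N Mk e"
    and \<rho>: "pair_aut \<rho>" and a: "a \<in> intertwiners M (Mk m) \<rho>" and nz: "a \<noteq> 0"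
  shows "\<exists>v\<in>M. tower_ext Mk e \<alpha> a = a * v"
proof -
  note \<alpha> = Ker_LoiD(1)[OF \<alpha>K] and ker = Ker_LoiD(2)[OF \<alpha>K]
  define A where "A = tower_ext Mk e \<alpha>"
  obtain \<tau> where \<tau>: "tracial (Mk (2 * m)) \<tau>" using ex_tracial_Mk by blast
  interpret t: tracial "Mk (2 * m)" \<tau> by fact
  obtain w D F c where wDF: "implements \<tau> m w D F c" using M_expectation_implemented[OF \<tau>] by blast
  note w = implementsD(1-8)[OF wDF] and F = implementsD(9-12)[OF wDF]
  have am: "a \<in> Mk m" by (rule intertwinersD(1)[OF a])
  have iso: "star_iso (Mk m) (Mk m) A" "star_iso (Mk (2 * m)) (Mk (2 * m)) A"
    unfolding A_def by (rule tower_extD(1)[OF \<alpha>])+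
  have Aa: "A a \<in> Mk m" by (rule star_isoD(2)[OF iso(1) am])
  have up: "x \<in> Mk (2 * m)" if "x \<in> Mk m" for x by (rule Mk_mem[OF that]) simp
  have wadj: "b * adj w = adj w * b" if "b \<in> M" for b
    using arg_cong[OF w(3)[OF M_closed(2)[OF that]], of adj] by simp
  define T where "T = w * adj w"
  have T: "T \<in> Mk (2 * m)" "\<And>b. b \<in> M \<Longrightarrow> T * b = b * T"
  proof -
    show "T \<in> Mk (2 * m)" using w(1) by (simp add: T_def)
    fix b assume b: "b \<in> M"
    have "T * b = w * (adj w * b)" by (simp only: T_def mult.assoc)
    also have "\<dots> = (w * b) * adj w" by (simp only: wadj[OF b, symmetric] mult.assoc)
    also have "\<dots> = b * T" by (simp only: w(3)[OF b] T_def mult.assoc)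
    finally show "T * b = b * T" .
  qed
  have aTa: "a * T * adj a \<in> Mk (2 * m)" using up[OF am] T by simp
  have "A (a * T * adj a) = a * T * adj a"
    unfolding A_def by (rule ker[OF aTa intertwiner_left[OF \<rho> a T(2)]])
  moreover have "A (a * T * adj a) = A a * A T * adj (A a)"
    using up[OF am] T by (simp add: star_isoD(5,6)[OF iso(2)])
  moreover have "A T = T" unfolding A_def by (rule ker[OF T])
  ultimately have 1: "A a * T * adj (A a) = a * T * adj a" by simp
  have aa: "adj a * a \<in> Mk m" by (rule Mk_closed(1)[OF Mk_closed(2)[OF am] am])
  have "A (adj a * a) = adj a * a" unfolding A_def by (rule ker[OF aa intertwiner_right[OF \<rho> a]])
  then have AaAa: "adj (A a) * A a = adj a * a"
    using am Mk_closed(2)[OF am] by (simp add: star_isoD(5,6)[OF iso(1)])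
  define s where "s = \<tau> (adj a * a)"
  have s: "s \<noteq> 0" unfolding s_def by (rule tracial_norm_nonzero[OF \<tau> up[OF am] nz])
  have Faa: "F (adj a * a) = s *\<^sub>C 1" unfolding s_def by (rule F(4)[OF aa intertwiner_right[OF \<rho> a]])
  have aAa: "adj a * A a \<in> Mk m" by (rule Mk_closed(1)[OF Mk_closed(2)[OF am] Aa])
  define v where "v = F (adj a * A a)"
  have vM: "v \<in> M" unfolding v_def by (rule F(1)[OF aAa])
  have "A a * w * (adj w * (adj (A a) * A a) * w) = (A a * T * adj (A a)) * A a * w"
    by (simp only: T_def mult.assoc)
  also have "\<dots> = a * w * (adj w * (adj a * A a) * w)" by (simp only: 1) (simp only: T_def mult.assoc)
  finally have "c *\<^sub>C (s *\<^sub>C (A a * w * D)) = c *\<^sub>C (a * w * (v * D))"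
    by (simp add: AaAa F(3)[OF aa] F(3)[OF aAa] Faa v_def)
  then have "s *\<^sub>C (A a * w * D) = a * w * (v * D)" using w(8) scaleC_cancel by blast
  also have "a * w * (v * D) = a * (w * v) * D" by (simp only: mult.assoc)
  also have "\<dots> = a * v * w * D" by (simp only: w(3)[OF vM] mult.assoc)
  finally have sD: "s *\<^sub>C (A a * w * D) = a * v * w * D" .
  define y where "y = s *\<^sub>C A a - a * v"
  have ym: "y \<in> Mk m" unfolding y_def
    by (intro Mk_closed Aa am M_Mk[OF vM])
  have "y * w * D = 0" using sD by (simp add: y_def left_diff_distrib)
  moreover have "D * (adj w * (adj y * y) * w) * D = D * adj w * adj y * (y * w * D)"
    by (simp only: mult.assoc)
  ultimately have "D * (adj w * (adj y * y) * w) * D = 0" by simp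
  moreover have yy: "adj y * y \<in> Mk m" by (rule Mk_closed(1)[OF Mk_closed(2)[OF ym] ym])
  ultimately have "c *\<^sub>C (D * (F (adj y * y) * D) * D) = 0" by (simp add: F(3))
  then have "D * (F (adj y * y) * D) * D = 0" using w(8) by simp
  moreover have "D * (F (adj y * y) * D) * D = F (adj y * y) * D"
  proof -
    have "D * (F (adj y * y) * D) * D = (D * F (adj y * y)) * (D * D)" by (simp only: mult.assoc)
    also have "\<dots> = F (adj y * y) * (D * (D * D))" by (simp only: w(4)[OF F(1)[OF yy]] mult.assoc)
    finally show ?thesis by (simp only: w(6))
  qed
  ultimately have "F (adj y * y) * D = 0" by simp
  then have "\<tau> (F (adj y * y)) * \<tau> D = 0"
    using trace_product[of "Suc (2 * m)" \<tau> 1 "F (adj y * y)" D] \<tau> F(1)[OF yy] w(2,4) by (simp add: One_nat_def)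
  then have "\<tau> (adj y * y) = 0" using w(7) F(2)[OF yy] by simp
  then have "y = 0" by (rule t.tr_faithful[OF up[OF ym]])
  then have sA: "s *\<^sub>C A a = a * v" by (simp add: y_def)
  have "A a = (1 / s) *\<^sub>C (s *\<^sub>C A a)" using s by simp
  also have "\<dots> = a * ((1 / s) *\<^sub>C v)" by (simp only: sA bop_scaleC_mult)
  finally show ?thesis using M_closed(3)[OF vM] unfolding A_def by blast
qed

text \<open>Hence \<open>\<alpha> a = u a\<close> with \<open>u\<close> in \<open>M\<close>; the unitary \<open>u\<close> intertwines \<open>\<rho> \<alpha>\<close> and \<open>\<alpha> \<rho>\<close>, so it normalises
  \<open>N\<close> and lies in \<open>N\<close>.\<close>

lemma intertwiner_unitary:
  assumes \<alpha>K: "\<alpha> \<in> Ker_Loi M N Mk e"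
    and nrm: "trivial_normalizer N M"
    and \<rho>: "pair_aut \<rho>" and a: "a \<in> intertwiners M (Mk m) \<rho>" and nz: "a \<noteq> 0"
  obtains u where "u \<in> unitaries N" "tower_ext Mk e \<alpha> a = u * a"
    "\<And>x. x \<in> M \<Longrightarrow> \<alpha> (\<rho> x) * u = u * \<rho> (\<alpha> x)"
proof -
  note \<alpha> = Ker_LoiD(1)[OF \<alpha>K] and ker = Ker_LoiD(2)[OF \<alpha>K]
  define A where "A = tower_ext Mk e \<alpha>"
  have iso: "star_iso (Mk m) (Mk m) A" unfolding A_def by (rule tower_extD(1)[OF \<alpha>])
  have AM: "A x = \<alpha> x" if "x \<in> M" for x unfolding A_def by (rule tower_extD(2)[OF \<alpha> that])
  have am: "a \<in> Mk m" by (rule intertwinersD(1)[OF a])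
  obtain v where v: "v \<in> M" "A a = a * v"
    using intertwiner_moves_in_bimodule[OF \<alpha>K \<rho> a nz] unfolding A_def by blast
  define u where "u = \<rho> v"
  have uM: "u \<in> M" unfolding u_def by (rule pair_autD(3)[OF \<rho> v(1)])
  have Aa: "A a = u * a" using v intertwinersD(2)[OF a v(1)] by (simp add: u_def)
  have M\<alpha>: "\<alpha> x \<in> M" and M\<rho>: "\<rho> x \<in> M" if "x \<in> M" for x using pair_autD(3) \<alpha> \<rho> that by auto
  note cancel = intertwiner_cancel[OF \<rho> a nz]
  have rel: "\<alpha> (\<rho> x) * u = u * \<rho> (\<alpha> x)" if x: "x \<in> M" for x
  proof -
    have "A (\<rho> x * a) = A (a * x)" by (simp only: intertwinersD(2)[OF a x])
    then have "\<alpha> (\<rho> x) * A a = A a * \<alpha> x"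
      using star_isoD(5)[OF iso] am M_Mk[OF x] M_Mk[OF M\<rho>[OF x]] by (simp add: AM M\<rho> x)
    then have "\<alpha> (\<rho> x) * u * a = u * (a * \<alpha> x)" by (simp only: Aa mult.assoc)
    also have "\<dots> = u * \<rho> (\<alpha> x) * a" by (simp only: intertwinersD(2)[OF a M\<alpha>[OF x], symmetric] mult.assoc)
    finally have "(\<alpha> (\<rho> x) * u - u * \<rho> (\<alpha> x)) * a = 0" by (simp add: left_diff_distrib)
    then have "\<alpha> (\<rho> x) * u - u * \<rho> (\<alpha> x) = 0"
      by (rule cancel[rotated]) (intro M_closed M\<alpha> M\<rho> x uM)
    then show ?thesis by simp
  qed
  have rel': "adj u * \<alpha> (\<rho> x) = \<rho> (\<alpha> x) * adj u" if x: "x \<in> M" for x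
    using arg_cong[OF rel[OF M_closed(2)[OF x]], of adj] x M\<alpha> M\<rho> pair_autD(6)[OF \<alpha>] pair_autD(6)[OF \<rho>] by simp
  have onto\<rho>\<alpha>: "\<exists>x\<in>M. y = \<rho> (\<alpha> x)" and onto\<alpha>\<rho>: "\<exists>x\<in>M. y = \<alpha> (\<rho> x)" if "y \<in> M" for y
    using that pair_autD(4)[OF \<alpha>] pair_autD(4)[OF \<rho>] by (metis imageE)+
  have "(adj u * u) * y = y * (adj u * u)" if y: "y \<in> M" for y
  proof -
    obtain x where x: "x \<in> M" "y = \<rho> (\<alpha> x)" using onto\<rho>\<alpha>[OF y] by blast
    have "(adj u * u) * y = (adj u * \<alpha> (\<rho> x)) * u" by (simp only: x(2) rel[OF x(1)] mult.assoc)
    then show ?thesis by (simp only: rel'[OF x(1)] x(2) mult.assoc)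
  qed
  then obtain s where s: "adj u * u = s *\<^sub>C 1"
    using M_central_scalar[of "adj u * u"] M_closed(1)[OF M_closed(2)[OF uM] uM] by blast
  have "(u * adj u) * y = y * (u * adj u)" if y: "y \<in> M" for y
  proof -
    obtain x where x: "x \<in> M" "y = \<alpha> (\<rho> x)" using onto\<alpha>\<rho>[OF y] by blast
    have "(u * adj u) * y = (u * \<rho> (\<alpha> x)) * adj u" by (simp only: x(2) rel'[OF x(1)] mult.assoc)
    then show ?thesis by (simp only: rel[OF x(1), symmetric] x(2) mult.assoc)
  qed
  then obtain t where t: "u * adj u = t *\<^sub>C 1"
    using M_central_scalar[of "u * adj u"] M_closed(1)[OF uM M_closed(2)[OF uM]] by blast
  obtain \<tau> where \<tau>: "tracial (Mk m) \<tau>" using ex_tracial_Mk by blast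
  have "adj (A a) * A a = A (adj a * a)"
    using am Mk_closed(2)[OF am] by (simp add: star_isoD(5,6)[OF iso])
  also have "\<dots> = adj a * a"
    unfolding A_def by (rule ker[OF Mk_closed(1)[OF Mk_closed(2)[OF am] am] intertwiner_right[OF \<rho> a]])
  finally have "adj a * (adj u * u) * a = adj a * a" by (simp add: Aa mult.assoc)
  then have "s *\<^sub>C (adj a * a) = 1 *\<^sub>C (adj a * a)" by (simp add: s)
  then have "(s - 1) *\<^sub>C (adj a * a) = 0" unfolding scaleC_diff_left by simp
  moreover have "adj a * a \<noteq> 0"
    using tracial_norm_nonzero[OF \<tau> am nz] tracial.tr_0[OF \<tau>] by auto
  ultimately have s1: "s = 1" by simp
  have "u * (adj u * u) = (u * adj u) * u" by (simp only: mult.assoc)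
  then have "1 *\<^sub>C u = t *\<^sub>C u" by (simp add: s t s1)
  then have "(1 - t) *\<^sub>C u = 0" unfolding scaleC_diff_left by simp
  moreover have "u \<noteq> 0"
  proof
    assume "u = 0"
    then have "(1::'h bop) = 0" using s s1 by simp
    then have "a = 0" using mult_1_left[of a] by simp
    then show False using nz by simp
  qed
  ultimately have t1: "t = 1" by simp
  have uU: "u \<in> unitaries M" using uM s t s1 t1 by (simp add: unitaries_def)
  have "(\<lambda>x. u * x * adj u) ` N = N"
  proof -
    have NM: "x \<in> M" if "x \<in> N" for x using that N_sub_M by blast
    have conj: "u * \<rho> (\<alpha> x) * adj u = \<alpha> (\<rho> x)" if "x \<in> M" for x
    proof -
      have "u * \<rho> (\<alpha> x) * adj u = \<alpha> (\<rho> x) * (u * adj u)" by (simp only: rel[OF that, symmetric] mult.assoc)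
      then show ?thesis by (simp add: t t1)
    qed
    have N\<rho>\<alpha>: "(\<lambda>x. \<rho> (\<alpha> x)) ` N = N" and N\<alpha>\<rho>: "(\<lambda>x. \<alpha> (\<rho> x)) ` N = N"
      unfolding image_image[symmetric, of \<rho> \<alpha>] image_image[symmetric, of \<alpha> \<rho>]
      by (simp_all only: pair_autD(2)[OF \<alpha>] pair_autD(2)[OF \<rho>])
    have "(\<lambda>x. u * x * adj u) ` N = (\<lambda>x. u * x * adj u) ` (\<lambda>x. \<rho> (\<alpha> x)) ` N"
      by (simp only: N\<rho>\<alpha>)
    also have "\<dots> = (\<lambda>x. u * \<rho> (\<alpha> x) * adj u) ` N" by (simp only: image_image)
    also have "\<dots> = (\<lambda>x. \<alpha> (\<rho> x)) ` N" using conj NM by (intro image_cong) auto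
    also have "\<dots> = N" by (rule N\<alpha>\<rho>)
    finally show ?thesis .
  qed
  then have "u \<in> unitaries N" using nrm uU unfolding trivial_normalizer_def by blast
  then show ?thesis using that[of u] Aa rel unfolding A_def by blast
qed

text \<open>The unitary does not depend on the intertwiner: two of them differ by a scalar, and this scalar is 1
  because the sum of two intertwiners is an intertwiner.\<close>

lemma intertwining_unitary_spec:
  assumes \<alpha>K: "\<alpha> \<in> Ker_Loi M N Mk e"
    and nrm: "trivial_normalizer N M"
    and \<rho>: "pair_aut \<rho>" and a: "a \<in> intertwiners M (Mk m) \<rho>" and nz: "a \<noteq> 0"
  defines "u \<equiv> intertwining_unitary M N Mk e \<alpha> \<rho>"
  shows "u \<in> unitaries N" "\<And>k b. b \<in> intertwiners M (Mk k) \<rho> \<Longrightarrow> tower_ext Mk e \<alpha> b = u * b"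
    and "\<And>x. x \<in> M \<Longrightarrow> \<alpha> (\<rho> x) * u = u * \<rho> (\<alpha> x)"
proof -
  note \<alpha> = Ker_LoiD(1)[OF \<alpha>K] and ker = Ker_LoiD(2)[OF \<alpha>K]
  let ?A = "tower_ext Mk e \<alpha>"
  obtain u\<^sub>0 where u\<^sub>0: "u\<^sub>0 \<in> unitaries N" "?A a = u\<^sub>0 * a" "\<And>x. x \<in> M \<Longrightarrow> \<alpha> (\<rho> x) * u\<^sub>0 = u\<^sub>0 * \<rho> (\<alpha> x)"
    using intertwiner_unitary[OF \<alpha>K nrm \<rho> a nz] by blast
  have UNM: "v \<in> M" if "v \<in> unitaries N" for v using unitariesD(1)[OF that] N_sub_M by blast
  have all: "?A b = u\<^sub>0 * b" if b: "b \<in> intertwiners M (Mk k) \<rho>" for k b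
  proof (cases "b = 0")
    case True
    have "?A 0 = 0" by (rule star_iso_0[OF Mk_vN Mk_vN tower_extD(1)[OF \<alpha>, of 0]])
    then show ?thesis using True by simp
  next
    case False
    define l where "l = max m k"
    have al: "a \<in> intertwiners M (Mk l) \<rho>" and bl: "b \<in> intertwiners M (Mk l) \<rho>"
      using intertwiners_mono[OF _ a, of l] intertwiners_mono[OF _ b, of l] by (auto simp: l_def)
    have iso: "star_iso (Mk l) (Mk l) ?A" by (rule tower_extD(1)[OF \<alpha>])
    have scal: "\<exists>s. v = s *\<^sub>C u\<^sub>0"
      if v: "v \<in> unitaries N" "\<And>x. x \<in> M \<Longrightarrow> \<alpha> (\<rho> x) * v = v * \<rho> (\<alpha> x)" for v
    proof -
      have vM: "v \<in> M" "u\<^sub>0 \<in> M" using UNM v u\<^sub>0 by auto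
      have "(adj u\<^sub>0 * v) * y = y * (adj u\<^sub>0 * v)" if y: "y \<in> M" for y
      proof -
        obtain x where x: "x \<in> M" "y = \<rho> (\<alpha> x)"
          using y pair_autD(4)[OF \<alpha>] pair_autD(4)[OF \<rho>] by (metis imageE)
        have adj_rel: "adj u\<^sub>0 * \<alpha> (\<rho> x) = \<rho> (\<alpha> x) * adj u\<^sub>0"
        proof -
          have "adj u\<^sub>0 * \<alpha> (\<rho> x) = adj u\<^sub>0 * (\<alpha> (\<rho> x) * u\<^sub>0) * adj u\<^sub>0"
            using unitariesD(3)[OF u\<^sub>0(1)] by (simp add: mult.assoc)
          also have "\<dots> = (adj u\<^sub>0 * u\<^sub>0) * \<rho> (\<alpha> x) * adj u\<^sub>0" by (simp only: u\<^sub>0(3)[OF x(1)] mult.assoc)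
          finally show ?thesis using unitariesD(2)[OF u\<^sub>0(1)] by simp
        qed
        have "(adj u\<^sub>0 * v) * y = (adj u\<^sub>0 * \<alpha> (\<rho> x)) * v" by (simp only: x(2) v(2)[OF x(1)] mult.assoc)
        then show ?thesis by (simp only: adj_rel x(2) mult.assoc)
      qed
      then obtain s where s: "adj u\<^sub>0 * v = s *\<^sub>C 1"
        using M_central_scalar[of "adj u\<^sub>0 * v"] M_closed(1)[OF M_closed(2)[OF vM(2)] vM(1)] by blast
      have "v = u\<^sub>0 * (adj u\<^sub>0 * v)" using unitariesD(3)[OF u\<^sub>0(1)] by (simp flip: mult.assoc)
      then show ?thesis using s by auto
    qed
    have each: "\<exists>s. ?A c = s *\<^sub>C (u\<^sub>0 * c)" if c: "c \<in> intertwiners M (Mk l) \<rho>" "c \<noteq> 0" for c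
    proof -
      obtain v where "v \<in> unitaries N" "?A c = v * c" "\<And>x. x \<in> M \<Longrightarrow> \<alpha> (\<rho> x) * v = v * \<rho> (\<alpha> x)"
        using intertwiner_unitary[OF \<alpha>K nrm \<rho> c] by blast
      then show ?thesis using scal by fastforce
    qed
    obtain s where s: "?A b = s *\<^sub>C (u\<^sub>0 * b)" using each[OF bl False] by blast
    have uinj: "x = y" if "u\<^sub>0 * x = u\<^sub>0 * y" for x y
      using arg_cong[OF that, of "\<lambda>z. adj u\<^sub>0 * z"] unitariesD(2)[OF u\<^sub>0(1)] by (simp flip: mult.assoc)
    \<comment> \<open>If \<open>a\<close> and \<open>b\<close> are independent, compare the scalars of \<open>a\<close>, \<open>b\<close> and \<open>a + b\<close>.\<close>
    show ?thesis
    proof (cases "\<exists>r. b = r *\<^sub>C a")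
      case True
      then obtain r where r: "b = r *\<^sub>C a" by blast
      have "?A b = r *\<^sub>C ?A a" unfolding r by (rule star_isoD(4)[OF iso intertwinersD(1)[OF al]])
      then show ?thesis by (simp add: u\<^sub>0(2) r)
    next
      case indep: False
      have ab: "a + b \<in> intertwiners M (Mk l) \<rho>"
        using al bl Mk_closed(5) by (auto simp: intertwiners_def distrib_left distrib_right)
      have "a + b \<noteq> 0"
      proof
        assume "a + b = 0"
        then have "b = (-1) *\<^sub>C a" by (simp add: scaleC_minus_left eq_neg_iff_add_eq_0 add.commute)
        then show False using indep by blast
      qed
      then obtain t where "?A (a + b) = t *\<^sub>C (u\<^sub>0 * (a + b))" using each[OF ab] by blast
      then have "u\<^sub>0 * a + s *\<^sub>C (u\<^sub>0 * b) = t *\<^sub>C (u\<^sub>0 * (a + b))"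
        using star_isoD(3)[OF iso intertwinersD(1)[OF al] intertwinersD(1)[OF bl]] by (simp add: u\<^sub>0(2) s)
      then have "u\<^sub>0 * (a + s *\<^sub>C b) = u\<^sub>0 * (t *\<^sub>C (a + b))" by (simp add: distrib_left)
      then have "a + s *\<^sub>C b = t *\<^sub>C (a + b)" by (rule uinj)
      then have eq: "(s - t) *\<^sub>C b = (t - 1) *\<^sub>C a" by (simp add: scaleC_diff_left scaleC_add_right algebra_simps)
      have "s = t"
      proof (rule ccontr)
        assume "s \<noteq> t"
        then have "b = ((t - 1) / (s - t)) *\<^sub>C a"
          using arg_cong[OF eq, of "\<lambda>z. (1 / (s - t)) *\<^sub>C z"] by simp
        then show False using indep by blast
      qed
      then have "t = 1" using eq nz by simp
      then show ?thesis using s \<open>s = t\<close> by simp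
    qed
  qed
  have uniq: "v = u\<^sub>0" if "v \<in> unitaries N" "\<forall>k. \<forall>a\<in>intertwiners M (Mk k) \<rho>. ?A a = v * a" for v
  proof -
    have "v * a = u\<^sub>0 * a" using that(2) a u\<^sub>0(2) by metis
    then have "(v - u\<^sub>0) * a = 0" by (simp add: left_diff_distrib)
    then have "v - u\<^sub>0 = 0"
      by (rule intertwiner_cancel[OF \<rho> a nz M_closed(5)[OF UNM[OF that(1)] UNM[OF u\<^sub>0(1)]]])
    then show ?thesis by simp
  qed
  have "u = u\<^sub>0"
    unfolding u_def intertwining_unitary_def
  proof (rule the_equality)
    show "u\<^sub>0 \<in> unitaries N \<and> (\<forall>k. \<forall>a\<in>intertwiners M (Mk k) \<rho>. ?A a = u\<^sub>0 * a)"
      by (intro conjI allI ballI u\<^sub>0(1) all)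
  qed (elim conjE, rule uniq)
  then show "u \<in> unitaries N" "\<And>k b. b \<in> intertwiners M (Mk k) \<rho> \<Longrightarrow> ?A b = u * b"
    "\<And>x. x \<in> M \<Longrightarrow> \<alpha> (\<rho> x) * u = u * \<rho> (\<alpha> x)"
    by (simp_all only: u\<^sub>0(1) all u\<^sub>0(3))
qed

text \<open>Non-strongly outer automorphisms are closed under composition. The product of two intertwiners may
  vanish, but not after inserting \<open>w w\<^sup>*\<close> between them.\<close>

lemma intertwiner_compose:
  assumes \<rho>: "pair_aut \<rho>\<^sub>1" "pair_aut \<rho>\<^sub>2"
    and a: "a \<in> intertwiners M (Mk m) \<rho>\<^sub>1" "a \<noteq> 0" "b \<in> intertwiners M (Mk m) \<rho>\<^sub>2" "b \<noteq> 0"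
  shows "\<exists>k. \<exists>c\<in>intertwiners M (Mk k) (\<lambda>x. \<rho>\<^sub>1 (\<rho>\<^sub>2 x)). c \<noteq> 0"
proof -
  obtain \<tau> where \<tau>: "tracial (Mk (2 * m)) \<tau>" using ex_tracial_Mk by blast
  interpret t: tracial "Mk (2 * m)" \<tau> by fact
  obtain w D F c where wDF: "implements \<tau> m w D F c" using M_expectation_implemented[OF \<tau>] by blast
  note w = implementsD(1-8)[OF wDF] and F = implementsD(9-12)[OF wDF]
  have abm: "a \<in> Mk m" "b \<in> Mk m" using intertwinersD(1) a by auto
  have up: "x \<in> Mk (2 * m)" if "x \<in> Mk m" for x by (rule Mk_mem[OF that]) simp
  have wadj: "x * adj w = adj w * x" if "x \<in> M" for x
    using arg_cong[OF w(3)[OF M_closed(2)[OF that]], of adj] by simp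
  define d where "d = a * (w * adj w) * b"
  have dk: "d \<in> Mk (2 * m)" using up abm w(1) by (simp add: d_def)
  have "\<rho>\<^sub>1 (\<rho>\<^sub>2 x) * d = d * x" if x: "x \<in> M" for x
  proof -
    have r2: "\<rho>\<^sub>2 x \<in> M" by (rule pair_autD(3)[OF \<rho>(2) x])
    have "\<rho>\<^sub>1 (\<rho>\<^sub>2 x) * d = (\<rho>\<^sub>1 (\<rho>\<^sub>2 x) * a) * w * adj w * b" by (simp only: d_def mult.assoc)
    also have "\<dots> = a * (w * \<rho>\<^sub>2 x) * adj w * b"
      by (simp only: intertwinersD(2)[OF a(1) r2]) (simp only: w(3)[OF r2] mult.assoc)
    also have "\<dots> = a * w * (\<rho>\<^sub>2 x * adj w) * b" by (simp only: mult.assoc)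
    also have "\<dots> = a * w * adj w * (\<rho>\<^sub>2 x * b)" by (simp only: wadj[OF r2] mult.assoc)
    also have "\<dots> = d * x" by (simp only: intertwinersD(2)[OF a(3) x] d_def mult.assoc)
    finally show ?thesis .
  qed
  then have int: "d \<in> intertwiners M (Mk (2 * m)) (\<lambda>x. \<rho>\<^sub>1 (\<rho>\<^sub>2 x))" using dk by (simp add: intertwiners_def)
  have "d \<noteq> 0"
  proof
    assume "d = 0"
    define s where "s = \<tau> (adj a * a)"
    define r where "r = \<tau> (b * adj b)"
    have s: "s \<noteq> 0" unfolding s_def by (rule tracial_norm_nonzero[OF \<tau> up[OF abm(1)] a(2)])
    have "adj b \<noteq> 0" using a(4) by (metis adj_adj adj_simps(5))
    then have r: "r \<noteq> 0" unfolding r_def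
      using tracial_norm_nonzero[OF \<tau> t.mem_closed(5)[OF up[OF abm(2)]]] by simp
    have aa: "adj a * a \<in> Mk m" by (rule Mk_closed(1)[OF Mk_closed(2)[OF abm(1)] abm(1)])
    have bb: "b * adj b \<in> Mk m" by (rule Mk_closed(1)[OF abm(2) Mk_closed(2)[OF abm(2)]])
    have Faa: "F (adj a * a) = s *\<^sub>C 1" unfolding s_def by (rule F(4)[OF aa intertwiner_right[OF \<rho>(1) a(1)]])
    have Fbb: "F (b * adj b) = r *\<^sub>C 1" unfolding r_def by (rule F(4)[OF bb intertwiner_aa[OF \<rho>(2) a(3)]])
    have "adj d * d = adj b * w * (adj w * (adj a * a) * w) * adj w * b" by (simp add: d_def mult.assoc)
    also have "\<dots> = (c * s) *\<^sub>C (adj b * w * D * adj w * b)" by (simp add: F(3)[OF aa] Faa)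
    finally have "adj b * w * D * adj w * b = 0" using \<open>d = 0\<close> w(8) s by simp
    moreover have "adj (D * adj w * b) * (D * adj w * b) = adj b * w * (D * D) * adj w * b"
      by (simp only: adj_simps(1) adj_adj w(5) mult.assoc)
    ultimately have "adj (D * adj w * b) * (D * adj w * b) = 0" by (simp only: w(6))
    then have "D * adj w * b = 0"
      using t.tr_faithful[of "D * adj w * b"] w(1,2) up[OF abm(2)] t.tr_0 by (simp del: adj_simps)
    moreover have "D * (adj w * (b * adj b) * w) = (D * adj w * b) * (adj b * w)"
      by (simp only: mult.assoc)
    ultimately have "D * (adj w * (b * adj b) * w) = 0" by simp
    then have "c *\<^sub>C (r *\<^sub>C (D * D)) = 0" by (simp add: F(3)[OF bb] Fbb)
    then have "D = 0" using w(6,8) r by simp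
    then show False using w(7) by simp
  qed
  with int show ?thesis by blast
qed

end

section \<open>Symmetric cocycles on finite abelian groups\<close>

text \<open>An operator with an invertible scalar power has an eigenvector of the form \<open>\<Sum>\<^sub>i x\<^sup>i L\<^sup>i v\<close>, where \<open>x\<close>
  is one of the \<open>n\<close> solutions of \<open>x\<^sup>n = 1 / t\<close>; it does not vanish for all of them, as a nonzero
  polynomial of degree less than \<open>n\<close> has fewer than \<open>n\<close> roots.\<close>

lemma eigenvector_of_root_of_scalar:
  fixes L :: "('a \<Rightarrow> complex) \<Rightarrow> 'a \<Rightarrow> complex"
  assumes add: "\<And>x y. L (\<lambda>g. x g + y g) = (\<lambda>g. L x g + L y g)"
    and scale: "\<And>s x. L (\<lambda>g. s * x g) = (\<lambda>g. s * L x g)"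
    and n: "0 < n" and pow: "(L ^^ n) v = (\<lambda>g. t * v g)" and t: "t \<noteq> 0" and v: "v g\<^sub>0 \<noteq> 0"
  shows "\<exists>x. x \<noteq> 0 \<and> (\<exists>g. (\<Sum>i<n. x ^ i * (L ^^ i) v g) \<noteq> 0) \<and>
    L (\<lambda>g. \<Sum>i<n. x ^ i * (L ^^ i) v g) = (\<lambda>g. (1 / x) * (\<Sum>i<n. x ^ i * (L ^^ i) v g))"
proof -
  define p where "p = (\<Sum>i<n. Polynomial.monom ((L ^^ i) v g\<^sub>0) i)"
  have poly: "poly p x = (\<Sum>i<n. x ^ i * (L ^^ i) v g\<^sub>0)" for x
    by (simp add: p_def poly_sum poly_monom mult.commute)
  have "Polynomial.coeff p 0 = (\<Sum>i<n. if i = 0 then (L ^^ i) v g\<^sub>0 else 0)"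
    by (simp add: p_def coeff_sum)
  also have "\<dots> = v g\<^sub>0" using n by simp
  finally have p0: "p \<noteq> 0" using v by auto
  have "degree p \<le> n - 1"
    unfolding p_def by (rule degree_sum_le) (auto intro: order_trans[OF degree_monom_le])
  then have "card {x. poly p x = 0} < n" using card_poly_roots_bound[OF p0] n by linarith
  moreover have "card {x. x ^ n = 1 / t} = n" by (rule card_nth_roots) (use t n in auto)
  ultimately have "\<not> {x. x ^ n = 1 / t} \<subseteq> {x. poly p x = 0}"
    using card_mono[OF poly_roots_finite[OF p0]] by (metis not_less)
  then obtain x where x: "x ^ n = 1 / t" "poly p x \<noteq> 0" by auto
  have x0: "x \<noteq> 0" using x(1) t n by (auto simp: power_0_left)
  have sum: "L (\<lambda>g. \<Sum>i<m. f i g) = (\<lambda>g. \<Sum>i<m. L (f i) g)" for m and f :: "nat \<Rightarrow> 'a \<Rightarrow> complex"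
  proof (induction m)
    case 0
    show ?case using scale[of 0 v] by simp
  next
    case (Suc m)
    show ?case using add[of "\<lambda>g. \<Sum>i<m. f i g" "f m"] Suc by simp
  qed
  have "L (\<lambda>g. \<Sum>i<n. x ^ i * (L ^^ i) v g) g = (1 / x) * (\<Sum>i<n. x ^ i * (L ^^ i) v g)" for g
  proof -
    let ?f = "\<lambda>i. x ^ i * (L ^^ i) v g"
    have "x * L (\<lambda>g. \<Sum>i<n. x ^ i * (L ^^ i) v g) g = (\<Sum>i<n. ?f (Suc i))"
      by (simp add: sum scale sum_distrib_left mult.assoc)
    also have "\<dots> = (\<Sum>i<n. ?f i) + ?f n - ?f 0"
      using sum.lessThan_Suc_shift[of ?f n] by simp
    also have "?f n = ?f 0" using x(1) t by (simp add: pow)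
    finally show ?thesis using x0 by (simp add: field_simps)
  qed
  then show ?thesis using x0 x(2) unfolding poly by (intro exI[of _ x]) auto
qed

text \<open>The cocycle twists the regular representation. By symmetry the resulting operators commute, so they
  have a common eigenvector, and their eigenvalues trivialise the cocycle.\<close>

lemma symmetric_cocycle_is_coboundary:
  fixes G (structure) and c :: "'a \<Rightarrow> 'a \<Rightarrow> complex"
  assumes G: "comm_group G" and fin: "finite (carrier G)"
    and nz: "\<And>h k. h \<in> carrier G \<Longrightarrow> k \<in> carrier G \<Longrightarrow> c h k \<noteq> 0"
    and sym: "\<And>h k. h \<in> carrier G \<Longrightarrow> k \<in> carrier G \<Longrightarrow> c h k = c k h"
    and cocycle: "\<And>h k l. h \<in> carrier G \<Longrightarrow> k \<in> carrier G \<Longrightarrow> l \<in> carrier G \<Longrightarrow>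
      c h k * c (h \<otimes> k) l = c k l * c h (k \<otimes> l)"
  shows "\<exists>b. \<forall>h\<in>carrier G. b h \<noteq> 0 \<and> (\<forall>k\<in>carrier G. b h * b k = c h k * b (h \<otimes> k))"
proof -
  interpret comm_group G by fact
  define W where "W = {f :: 'a \<Rightarrow> complex. \<forall>g. g \<notin> carrier G \<longrightarrow> f g = 0}"
  define Op where "Op h f g = (if g \<in> carrier G then c h (inv h \<otimes> g) * f (inv h \<otimes> g) else 0)" for h f g
  have OpW: "Op h f \<in> W" for h f by (simp add: W_def Op_def)
  have add: "Op h (\<lambda>g. x g + y g) = (\<lambda>g. Op h x g + Op h y g)"
    and scale: "Op h (\<lambda>g. s * x g) = (\<lambda>g. s * Op h x g)" for h x y s
    by (auto simp: Op_def fun_eq_iff algebra_simps)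
  have mult: "Op h (Op k f) = (\<lambda>g. c h k * Op (h \<otimes> k) f g)" if hk: "h \<in> carrier G" "k \<in> carrier G" for h k f
  proof
    fix g
    show "Op h (Op k f) g = c h k * Op (h \<otimes> k) f g"
    proof (cases "g \<in> carrier G")
      case True
      define l where "l = inv (h \<otimes> k) \<otimes> g"
      have l: "l \<in> carrier G" using hk True by (simp add: l_def)
      have 1: "inv k \<otimes> (inv h \<otimes> g) = l" using hk True by (simp add: l_def inv_mult_group m_assoc)
      have 2: "inv h \<otimes> g = k \<otimes> l" unfolding 1[symmetric] using hk True by (simp add: m_assoc[symmetric])
      have "Op h (Op k f) g = c h (k \<otimes> l) * (c k l * f l)"
        using True hk l 1 by (simp add: Op_def 2)
      also have "\<dots> = c h k * (c (h \<otimes> k) l * f l)" using cocycle[OF hk l] by (simp add: mult_ac)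
      finally show ?thesis using True by (simp add: Op_def l_def)
    qed (simp add: Op_def)
  qed
  have comm: "Op h (Op k f) = Op k (Op h f)" if "h \<in> carrier G" "k \<in> carrier G" for h k f
    using that by (simp add: mult sym[OF that] m_comm[OF that])
  have c1: "c \<one> g = c \<one> \<one>" if "g \<in> carrier G" for g
  proof -
    have "c \<one> \<one> * c \<one> g = c \<one> g * c \<one> g"
      using cocycle[OF one_closed one_closed that] by (simp only: l_one one_closed that)
    then show ?thesis using nz[OF one_closed that] by (metis Rings.mult_cancel_right)
  qed
  have Op1: "Op \<one> f = (\<lambda>g. c \<one> \<one> * f g)" if f: "f \<in> W" for f
  proof
    fix g
    show "Op \<one> f g = c \<one> \<one> * f g"
      using f by (cases "g \<in> carrier G") (simp_all add: Op_def W_def c1[of g])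
  qed
  have pow: "\<exists>r. r \<noteq> 0 \<and> (Op k ^^ n) f = (\<lambda>g. r * Op (k [^] n) f g)"
    if k: "k \<in> carrier G" and f: "f \<in> W" for k f and n :: nat
  proof (induction n)
    case 0
    show ?case using Op1[OF f] nz[of \<one> \<one>] by (intro exI[of _ "1 / c \<one> \<one>"]) simp
  next
    case (Suc n)
    then obtain r where r: "r \<noteq> 0" "(Op k ^^ n) f = (\<lambda>g. r * Op (k [^] n) f g)" by blast
    have "(Op k ^^ Suc n) f = (\<lambda>g. r * (c k (k [^] n) * Op (k \<otimes> k [^] n) f g))"
      by (simp add: r(2) scale mult k)
    moreover have "k \<otimes> k [^] n = k [^] Suc n" using k by (simp add: m_comm)
    ultimately show ?case using r(1) nz[of k "k [^] n"] k by (intro exI[of _ "r * c k (k [^] n)"]) (simp add: mult.assoc)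
  qed
  have "\<exists>v\<in>W. (\<exists>g. v g \<noteq> 0) \<and> (\<forall>h\<in>F. \<exists>s. s \<noteq> 0 \<and> Op h v = (\<lambda>g. s * v g))" if "finite F" "F \<subseteq> carrier G" for F
    using that
  proof induction
    case empty
    show ?case
      by (rule bexI[of _ "\<lambda>g. if g = \<one> then 1 else 0"]) (auto simp: W_def)
  next
    case (insert k F)
    then obtain v g\<^sub>0 where v: "v \<in> W" "v g\<^sub>0 \<noteq> 0" "\<And>h. h \<in> F \<Longrightarrow> \<exists>s. s \<noteq> 0 \<and> Op h v = (\<lambda>g. s * v g)" by auto
    have k: "k \<in> carrier G" using insert by simp
    let ?n = "order G"
    have n: "0 < ?n" using fin by (simp add: order_gt_0_iff_finite)
    obtain r where r: "r \<noteq> 0" "(Op k ^^ ?n) v = (\<lambda>g. r * Op (k [^] ?n) v g)" using pow[OF k v(1)] by blast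
    have "(Op k ^^ ?n) v = (\<lambda>g. (r * c \<one> \<one>) * v g)"
      using r(2) pow_order_eq_1[OF k] Op1[OF v(1)] by (simp add: mult.assoc)
    moreover have "r * c \<one> \<one> \<noteq> 0" using r(1) nz[of \<one> \<one>] by simp
    ultimately obtain x where x: "x \<noteq> 0" "\<exists>g. (\<Sum>i<?n. x ^ i * (Op k ^^ i) v g) \<noteq> 0"
      "Op k (\<lambda>g. \<Sum>i<?n. x ^ i * (Op k ^^ i) v g) = (\<lambda>g. (1 / x) * (\<Sum>i<?n. x ^ i * (Op k ^^ i) v g))"
      using eigenvector_of_root_of_scalar[of "Op k" ?n v, OF add scale n _ _ v(2)] by blast
    define v' where "v' g = (\<Sum>i<?n. x ^ i * (Op k ^^ i) v g)" for g
    have powW: "(Op k ^^ i) v \<in> W" for i by (induction i) (simp_all add: v OpW)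
    have v'W: "v' \<in> W" using powW by (auto simp: W_def v'_def)
    have "\<exists>s. s \<noteq> 0 \<and> Op h v' = (\<lambda>g. s * v' g)" if h: "h \<in> F" for h
    proof -
      obtain s where s: "s \<noteq> 0" "Op h v = (\<lambda>g. s * v g)" using v(3)[OF h] by blast
      have hG: "h \<in> carrier G" using h insert by auto
      have i: "Op h ((Op k ^^ i) v) = (\<lambda>g. s * (Op k ^^ i) v g)" for i
        by (induction i) (simp_all add: s(2) comm[OF hG k] scale)
      have "Op h (\<lambda>g. \<Sum>i<m. x ^ i * (Op k ^^ i) v g) = (\<lambda>g. s * (\<Sum>i<m. x ^ i * (Op k ^^ i) v g))" for m
      proof (induction m)
        case 0 show ?case by (auto simp: Op_def)
      next
        case (Suc m) then show ?case by (simp add: add scale i algebra_simps)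
      qed
      then show ?thesis using s(1) unfolding v'_def[abs_def] by blast
    qed
    moreover have "Op k v' = (\<lambda>g. (1 / x) * v' g)" using x(3) unfolding v'_def[abs_def] .
    moreover have "\<exists>g. v' g \<noteq> 0" using x(2) unfolding v'_def .
    ultimately show ?case using v'W x(1) by (intro bexI[of _ v']) (auto intro: exI[of _ "1 / x"])
  qed
  from this[OF fin order_refl] obtain v g\<^sub>0 where v: "v g\<^sub>0 \<noteq> 0"
    "\<forall>h\<in>carrier G. \<exists>s. s \<noteq> 0 \<and> Op h v = (\<lambda>g. s * v g)" by blast
  then obtain b where b: "\<And>h. h \<in> carrier G \<Longrightarrow> b h \<noteq> 0 \<and> Op h v = (\<lambda>g. b h * v g)" by metis
  have "b h * b k = c h k * b (h \<otimes> k)" if hk: "h \<in> carrier G" "k \<in> carrier G" for h k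
  proof -
    have "Op h (Op k v) g\<^sub>0 = b k * (b h * v g\<^sub>0)" using b[OF hk(1)] b[OF hk(2)] by (simp add: scale)
    moreover have "Op h (Op k v) g\<^sub>0 = c h k * (b (h \<otimes> k) * v g\<^sub>0)" using mult[OF hk] b[of "h \<otimes> k"] hk by simp
    ultimately show ?thesis using v(1) by (simp add: mult_ac)
  qed
  then show ?thesis using b by blast
qed

context jones_setting
begin

section \<open>The group of non-strongly outer automorphisms\<close>

lemma pair_aut_comp: "pair_aut \<theta> \<Longrightarrow> pair_aut \<eta> \<Longrightarrow> pair_aut (\<lambda>x. \<theta> (\<eta> x))"
  unfolding pair_aut_def using star_iso_comp[of M M \<eta> M \<theta>] by (simp add: image_image[symmetric])

lemma pair_aut_cong: "pair_aut \<theta> \<Longrightarrow> (\<And>x. x \<in> M \<Longrightarrow> \<eta> x = \<theta> x) \<Longrightarrow> pair_aut \<eta>"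
proof -
  assume p: "pair_aut \<theta>" and eq: "\<And>x. x \<in> M \<Longrightarrow> \<eta> x = \<theta> x"
  have "\<eta> ` N = \<theta> ` N" by (rule image_cong) (use eq N_sub_M in auto)
  then show ?thesis
    using star_iso_cong[OF pair_autD(1)[OF p] _ eq] Mk_vN[of 0] pair_autD(2)[OF p] by (simp add: pair_aut_def)
qed

lemma pair_aut_inv:
  assumes "pair_aut \<theta>" shows "pair_aut (inv_into M \<theta>)"
proof -
  have "inv_into M \<theta> ` (\<theta> ` N) = N"
    using N_sub_M star_isoD(1)[OF pair_autD(1)[OF assms]] by (intro inv_into_image_cancel) (auto simp: bij_betw_def)
  then show ?thesis
    using star_iso_inv[of 1 M 1 M \<theta>] Mk_vN[of 0] assms by (simp add: pair_aut_def)
qed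

lemma pair_aut_Ad:
  assumes "u \<in> unitaries N" shows "pair_aut (\<lambda>x. u * x * adj u)"
proof -
  note u = unitariesD[OF assms]
  have uu: "adj u * (u * x * adj u) * u = x" "u * (adj u * x * u) * adj u = x" for x
  proof -
    have "adj u * (u * x * adj u) * u = (adj u * u) * x * (adj u * u)"
      "u * (adj u * x * u) * adj u = (u * adj u) * x * (u * adj u)" by (simp_all only: mult.assoc)
    then show "adj u * (u * x * adj u) * u = x" "u * (adj u * x * u) * adj u = x" using u by simp_all
  qed
  have bij: "bij_betw (\<lambda>x. u * x * adj u) A A"
    if A: "von_neumann_algebra 1 A" "u \<in> A" for A
    by (rule bij_betw_byWitness[where f' = "\<lambda>x. adj u * x * u"])
       (use uu vN_closed(3)[OF A(1)] vN_adj[OF A(1)] A(2) in auto)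
  have uM: "u \<in> M" using u(1) N_sub_M by blast
  have "u * (x * y) * adj u = (u * x * adj u) * (u * y * adj u)" for x y
  proof -
    have "(u * x * adj u) * (u * y * adj u) = u * x * (adj u * u) * y * adj u" by (simp only: mult.assoc)
    then show ?thesis using u by (simp add: mult.assoc)
  qed
  then have "star_iso M M (\<lambda>x. u * x * adj u)"
    unfolding star_iso_def using bij[OF _ uM] Mk_vN[of 0]
    by (simp add: distrib_left distrib_right mult.assoc)
  moreover have "(\<lambda>x. u * x * adj u) ` N = N"
    using bij[of N] L_vN[of 0] u(1) by (simp add: bij_betw_def)
  ultimately show ?thesis by (simp add: pair_aut_def)
qed

lemma Aut_iff: "\<theta> \<in> Aut M N \<longleftrightarrow> \<theta> \<in> extensional M \<and> pair_aut \<theta>"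
  by (auto simp: Aut_def pair_aut_def)

lemma Aut_Bij: "Aut M N \<subseteq> Bij M"
  by (auto simp: Aut_def Bij_def star_iso_def)

lemma intertwiners_cong: "(\<And>x. x \<in> M \<Longrightarrow> \<theta> x = \<eta> x) \<Longrightarrow> intertwiners M P \<theta> = intertwiners M P \<eta>"
  by (auto simp: intertwiners_def)

lemma one_nonzero: "(1::'h bop) \<noteq> 0"
proof
  assume "(1::'h bop) = 0"
  moreover obtain \<tau> where "tracial (Mk 0) \<tau>" using ex_tracial_Mk by blast
  ultimately show False using tracial.tr_1[of "Mk 0" \<tau>] tracial.tr_0[of "Mk 0" \<tau>] by simp
qed

lemma unitary_nonzero: "u \<in> unitaries A \<Longrightarrow> u \<noteq> (0::'h bop)"
proof
  assume u: "u \<in> unitaries A" "u = 0"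
  have "1 = adj u * u" by (rule unitariesD(2)[OF u(1), symmetric])
  also have "\<dots> = 0" by (simp only: u(2) mult_zero_right)
  finally show False by (rule notE[OF one_nonzero])
qed

lemma Cnt_rI: "\<theta> \<in> Aut M N \<Longrightarrow> a \<in> intertwiners M (Mk k) \<theta> \<Longrightarrow> a \<noteq> 0 \<Longrightarrow> \<theta> \<in> Cnt_r M N Mk"
  by (auto simp: Cnt_r_def)

lemma Cnt_rE:
  assumes "\<theta> \<in> Cnt_r M N Mk"
  obtains k a where "a \<in> intertwiners M (Mk k) \<theta>" "a \<noteq> 0" "\<theta> \<in> Aut M N"
  using assms by (auto simp: Cnt_r_def)

lemma compose_Cnt_r:
  assumes "\<theta> \<in> Cnt_r M N Mk" "\<eta> \<in> Cnt_r M N Mk" shows "compose M \<theta> \<eta> \<in> Cnt_r M N Mk"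
proof -
  obtain i a where a: "a \<in> intertwiners M (Mk i) \<theta>" "a \<noteq> 0" "\<theta> \<in> Aut M N" using assms(1) by (rule Cnt_rE)
  obtain j b where b: "b \<in> intertwiners M (Mk j) \<eta>" "b \<noteq> 0" "\<eta> \<in> Aut M N" using assms(2) by (rule Cnt_rE)
  note p = Aut_pair_aut[OF a(3)] Aut_pair_aut[OF b(3)]
  have comp: "compose M \<theta> \<eta> \<in> Aut M N"
    unfolding Aut_iff using pair_aut_cong[OF pair_aut_comp[OF p]] by (simp add: compose_def)
  obtain k c where "c \<in> intertwiners M (Mk k) (\<lambda>x. \<theta> (\<eta> x))" "c \<noteq> 0"
    using intertwiner_compose[OF p intertwiners_mono[OF max.cobounded1 a(1)] a(2) intertwiners_mono[OF max.cobounded2 b(1)] b(2)]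
    by blast
  moreover have "intertwiners M P (compose M \<theta> \<eta>) = intertwiners M P (\<lambda>x. \<theta> (\<eta> x))" for P
    by (rule intertwiners_cong) (simp add: compose_def)
  ultimately show ?thesis using Cnt_rI[OF comp] by metis
qed

lemma inv_Cnt_r:
  assumes "\<theta> \<in> Cnt_r M N Mk" shows "restrict (inv_into M \<theta>) M \<in> Cnt_r M N Mk"
proof -
  obtain i a where a: "a \<in> intertwiners M (Mk i) \<theta>" "a \<noteq> 0" "\<theta> \<in> Aut M N" using assms by (rule Cnt_rE)
  note p = Aut_pair_aut[OF a(3)]
  have "restrict (inv_into M \<theta>) M \<in> Aut M N"
    unfolding Aut_iff using pair_aut_cong[OF pair_aut_inv[OF p]] by simp
  moreover have "adj a \<in> intertwiners M (Mk i) (restrict (inv_into M \<theta>) M)"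
    unfolding intertwiners_def
  proof (intro CollectI conjI ballI)
    show "adj a \<in> Mk i" by (rule Mk_closed(2)[OF intertwinersD(1)[OF a(1)]])
    fix x assume x: "x \<in> M"
    let ?y = "inv_into M \<theta> x"
    have y: "?y \<in> M" "\<theta> ?y = x"
      using x pair_autD(4)[OF p] by (auto intro: inv_into_into f_inv_into_f)
    show "restrict (inv_into M \<theta>) M x * adj a = adj a * x"
      using intertwiner_adj[OF p a(1) y(1)] x y(2) by simp
  qed
  moreover have "adj a \<noteq> 0" using a(2) by (metis adj_adj adj_simps(5))
  ultimately show ?thesis by (rule Cnt_rI)
qed

lemma Inn_mem: "i \<in> Inn M N \<Longrightarrow> \<exists>u\<in>unitaries N. i = (\<lambda>x\<in>M. u * x * adj u)"
  by (auto simp: Inn_def)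

lemma Inn_Cnt_r: "Inn M N \<subseteq> Cnt_r M N Mk"
proof
  fix i assume "i \<in> Inn M N"
  then obtain u where u: "u \<in> unitaries N" "i = (\<lambda>x\<in>M. u * x * adj u)" using Inn_mem by blast
  note u' = unitariesD[OF u(1)]
  have "i \<in> Aut M N"
    unfolding Aut_iff u(2) using pair_aut_cong[OF pair_aut_Ad[OF u(1)]] by simp
  moreover have "u \<in> intertwiners M (Mk 0) i"
  proof -
    have "u * x * adj u * u = u * x" for x using u' by (simp add: mult.assoc)
    then show ?thesis using u' N_sub_M by (auto simp: intertwiners_def u(2))
  qed
  ultimately show "i \<in> Cnt_r M N Mk" using unitary_nonzero[OF u(1)] by (rule Cnt_rI)
qed

abbreviation "chi \<equiv> chi_a M N Mk e"

definition CntGroup where "CntGroup = BijGroup M \<lparr>carrier := Cnt_r M N Mk\<rparr>"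

lemma Cnt_r_Aut: "Cnt_r M N Mk \<subseteq> Aut M N"
  by (auto simp: Cnt_r_def)

lemma mult_Aut: "\<theta> \<in> Aut M N \<Longrightarrow> \<eta> \<in> Aut M N \<Longrightarrow> \<theta> \<otimes>\<^bsub>BijGroup M\<^esub> \<eta> = compose M \<theta> \<eta>"
  using Aut_Bij by (auto simp: BijGroup_def)

lemma Cnt_subgroup: "subgroup (Cnt_r M N Mk) (BijGroup M)"
proof (rule group.subgroupI[OF group_BijGroup])
  show "Cnt_r M N Mk \<subseteq> carrier (BijGroup M)" using Cnt_r_Aut Aut_Bij by (auto simp: BijGroup_def)
  have "1 \<in> unitaries N" using vN_unit_mem[OF L_vN[of 0]] by (simp add: unitaries_def)
  then show "Cnt_r M N Mk \<noteq> {}" using Inn_Cnt_r by (auto simp: Inn_def)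
next
  fix \<theta> assume t: "\<theta> \<in> Cnt_r M N Mk"
  then have "\<theta> \<in> Bij M" using Cnt_r_Aut Aut_Bij by blast
  then show "inv\<^bsub>BijGroup M\<^esub> \<theta> \<in> Cnt_r M N Mk" using inv_BijGroup[of \<theta> M] inv_Cnt_r[OF t] by simp
  fix \<eta> assume h: "\<eta> \<in> Cnt_r M N Mk"
  show "\<theta> \<otimes>\<^bsub>BijGroup M\<^esub> \<eta> \<in> Cnt_r M N Mk"
    using mult_Aut[OF subsetD[OF Cnt_r_Aut t] subsetD[OF Cnt_r_Aut h]] compose_Cnt_r[OF t h] by simp
qed

lemma Cnt_group: "group CntGroup"
  unfolding CntGroup_def by (rule group.subgroup_imp_group[OF group_BijGroup Cnt_subgroup])

lemma CntGroup_simps [simp]: "carrier CntGroup = Cnt_r M N Mk" "mult CntGroup = mult (BijGroup M)"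
  by (simp_all add: CntGroup_def)

lemma mult_Cnt: "\<theta> \<in> Cnt_r M N Mk \<Longrightarrow> \<eta> \<in> Cnt_r M N Mk \<Longrightarrow> \<theta> \<otimes>\<^bsub>BijGroup M\<^esub> \<eta> = compose M \<theta> \<eta>"
  using mult_Aut Cnt_r_Aut by blast

lemma inv_Cnt: "\<theta> \<in> Cnt_r M N Mk \<Longrightarrow> inv\<^bsub>CntGroup\<^esub> \<theta> = restrict (inv_into M \<theta>) M"
proof -
  assume t: "\<theta> \<in> Cnt_r M N Mk"
  then have "\<theta> \<in> Bij M" using Cnt_r_Aut Aut_Bij by blast
  then show ?thesis
    unfolding CntGroup_def using group.m_inv_consistent[OF group_BijGroup Cnt_subgroup t] inv_BijGroup[of \<theta> M] by simp
qed

lemma InnI: "u \<in> unitaries N \<Longrightarrow> i \<in> extensional M \<Longrightarrow> (\<And>x. x \<in> M \<Longrightarrow> i x = u * x * adj u) \<Longrightarrow> i \<in> Inn M N"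
  unfolding Inn_def by (rule image_eqI[of _ _ u]) (auto simp: extensional_def restrict_def)

lemma N_unitary_mult:
  assumes "u \<in> unitaries N" "v \<in> unitaries N" shows "u * v \<in> unitaries N"
proof -
  note u = unitariesD[OF assms(1)] and v = unitariesD[OF assms(2)]
  have "adj (u * v) * (u * v) = adj v * (adj u * u) * v" "u * v * adj (u * v) = u * (v * adj v) * adj u"
    by (simp_all add: mult.assoc)
  then show ?thesis using u v vN_closed(3)[OF L_vN[of 0]] by (simp add: unitaries_def)
qed

lemma N_unitary_adj: "u \<in> unitaries N \<Longrightarrow> adj u \<in> unitaries N"
  using unitaries_adj[of N u] vN_adj[OF L_vN[of 0]] by auto

lemma N_unitary_aut:
  assumes "pair_aut \<theta>" "u \<in> unitaries N" shows "\<theta> u \<in> unitaries N"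
proof -
  note u = unitariesD[OF assms(2)]
  have uM: "u \<in> M" "adj u \<in> M" using u(1) N_sub_M M_closed(2) by auto
  have "adj (\<theta> u) * \<theta> u = \<theta> (adj u * u)" "\<theta> u * adj (\<theta> u) = \<theta> (u * adj u)"
    using uM pair_autD(5,6)[OF assms(1)] by simp_all
  then show ?thesis using u pair_autD(7,8)[OF assms(1)] by (simp add: unitaries_def)
qed

lemma Inn_normal: "Inn M N \<lhd> CntGroup"
proof -
  interpret G: group CntGroup by (rule Cnt_group)
  have ext: "\<theta> \<in> extensional M" if "\<theta> \<in> Cnt_r M N Mk" for \<theta> using that Cnt_r_Aut by (auto simp: Aut_def)
  show ?thesis
  proof (rule G.normal_invI)
    show "subgroup (Inn M N) CntGroup"
    proof (rule G.subgroupI)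
      show "Inn M N \<subseteq> carrier CntGroup" using Inn_Cnt_r by simp
      have "1 \<in> unitaries N" using vN_unit_mem[OF L_vN[of 0]] by (simp add: unitaries_def)
      then show "Inn M N \<noteq> {}" by (auto simp: Inn_def)
    next
      fix i assume i: "i \<in> Inn M N"
      obtain u where u: "u \<in> unitaries N" "i = (\<lambda>x\<in>M. u * x * adj u)" using Inn_mem[OF i] by blast
      note u' = unitariesD[OF u(1)]
      have iC: "i \<in> Cnt_r M N Mk" using i Inn_Cnt_r by blast
      have uM: "u \<in> M" "adj u \<in> M" using u'(1) N_sub_M M_closed(2) by auto
      show "inv\<^bsub>CntGroup\<^esub> i \<in> Inn M N"
      proof (rule InnI[OF N_unitary_adj[OF u(1)]])
        show "inv\<^bsub>CntGroup\<^esub> i \<in> extensional M" by (simp add: inv_Cnt[OF iC])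
        fix x assume x: "x \<in> M"
        have y: "adj u * x * u \<in> M" using uM x M_closed(1) by simp
        have "i (adj u * x * u) = (u * adj u) * x * (u * adj u)" using y by (simp add: u(2) mult.assoc)
        then have "i (adj u * x * u) = x" using u' by simp
        moreover have "inj_on i M"
          using iC Cnt_r_Aut Aut_Bij by (auto simp: Bij_def bij_betw_def)
        ultimately have "inv_into M i x = adj u * x * u" using inv_into_f_eq[of i M "adj u * x * u" x] y by simp
        then show "(inv\<^bsub>CntGroup\<^esub> i) x = adj u * x * adj (adj u)" using x by (simp add: inv_Cnt[OF iC])
      qed
      fix j assume j: "j \<in> Inn M N"
      obtain v where v: "v \<in> unitaries N" "j = (\<lambda>x\<in>M. v * x * adj v)" using Inn_mem[OF j] by blast
      have vM: "v \<in> M" "adj v \<in> M" using unitariesD(1)[OF v(1)] N_sub_M M_closed(2) by auto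
      have jC: "j \<in> Cnt_r M N Mk" using j Inn_Cnt_r by blast
      show "i \<otimes>\<^bsub>CntGroup\<^esub> j \<in> Inn M N"
      proof (rule InnI[OF N_unitary_mult[OF u(1) v(1)]])
        show "i \<otimes>\<^bsub>CntGroup\<^esub> j \<in> extensional M" by (simp add: mult_Cnt[OF iC jC])
        fix x assume x: "x \<in> M"
        have "v * x * adj v \<in> M" using vM x M_closed(1) by simp
        then show "(i \<otimes>\<^bsub>CntGroup\<^esub> j) x = u * v * x * adj (u * v)"
          unfolding CntGroup_simps mult_Cnt[OF iC jC] using x by (simp add: compose_def u(2) v(2) mult.assoc)
      qed
    qed
  next
    fix \<theta> i assume t: "\<theta> \<in> carrier CntGroup" and i: "i \<in> Inn M N"
    have t': "\<theta> \<in> Cnt_r M N Mk" using t by simp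
    obtain u where u: "u \<in> unitaries N" "i = (\<lambda>x\<in>M. u * x * adj u)" using Inn_mem[OF i] by blast
    have iC: "i \<in> Cnt_r M N Mk" using i Inn_Cnt_r by blast
    have p: "pair_aut \<theta>" using Aut_pair_aut t' Cnt_r_Aut by blast
    have uM: "u \<in> M" "adj u \<in> M" using unitariesD(1)[OF u(1)] N_sub_M M_closed(2) by auto
    have c: "compose M \<theta> i \<in> Cnt_r M N Mk" "restrict (inv_into M \<theta>) M \<in> Cnt_r M N Mk"
      using compose_Cnt_r[OF t' iC] inv_Cnt_r[OF t'] by auto
    show "\<theta> \<otimes>\<^bsub>CntGroup\<^esub> i \<otimes>\<^bsub>CntGroup\<^esub> inv\<^bsub>CntGroup\<^esub> \<theta> \<in> Inn M N"
    proof (rule InnI[OF N_unitary_aut[OF p u(1)]])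
      show "\<theta> \<otimes>\<^bsub>CntGroup\<^esub> i \<otimes>\<^bsub>CntGroup\<^esub> inv\<^bsub>CntGroup\<^esub> \<theta> \<in> extensional M"
        by (simp add: mult_Cnt[OF t' iC] inv_Cnt[OF t'] mult_Cnt[OF c])
      fix x assume x: "x \<in> M"
      let ?y = "inv_into M \<theta> x"
      have y: "?y \<in> M" "\<theta> ?y = x"
        using x pair_autD(4)[OF p] by (auto intro: inv_into_into f_inv_into_f)
      have "\<theta> (u * ?y * adj u) = \<theta> u * x * adj (\<theta> u)"
        using uM y M_closed(1) by (simp add: pair_autD(5,6)[OF p])
      then show "(\<theta> \<otimes>\<^bsub>CntGroup\<^esub> i \<otimes>\<^bsub>CntGroup\<^esub> inv\<^bsub>CntGroup\<^esub> \<theta>) x = \<theta> u * x * adj (\<theta> u)"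
        unfolding CntGroup_simps mult_Cnt[OF t' iC] inv_Cnt[OF t'] mult_Cnt[OF c]
        using x y by (simp add: compose_def u(2))
    qed
  qed
qed

end

locale chi_setting = jones_setting +
  assumes nrm: "trivial_normalizer N M" and ker: "Ker_Loi M N Mk e = Aut M N"
begin

lemma Cnt_Ker: "Cnt_r M N Mk \<inter> Ker_Loi M N Mk e = Cnt_r M N Mk"
  using Cnt_r_Aut ker by blast

lemma chi_eq: "chi = CntGroup Mod (Inn M N)"
  by (simp add: chi_a_def AutGroup_def CntGroup_def Cnt_Ker)

lemma chi_group: "group chi"
  unfolding chi_eq by (rule normal.factorgroup_is_group[OF Inn_normal])

lemma mult_chi: "h \<otimes>\<^bsub>chi\<^esub> k = h <#>\<^bsub>CntGroup\<^esub> k"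
  by (simp add: chi_eq FactGroup_def)

lemma chi_carrierE:
  assumes "h \<in> carrier chi"
  obtains g where "g \<in> Cnt_r M N Mk" "h = Inn M N #>\<^bsub>CntGroup\<^esub> g"
  using assms by (auto simp: chi_eq FactGroup_def RCOSETS_def)

lemma chi_sub_Cnt: "h \<in> carrier chi \<Longrightarrow> \<theta> \<in> h \<Longrightarrow> \<theta> \<in> Cnt_r M N Mk"
proof -
  assume h: "h \<in> carrier chi" and \<theta>: "\<theta> \<in> h"
  obtain g where g: "g \<in> Cnt_r M N Mk" "h = Inn M N #>\<^bsub>CntGroup\<^esub> g" using h by (rule chi_carrierE)
  then obtain i where "i \<in> Inn M N" "\<theta> = i \<otimes>\<^bsub>CntGroup\<^esub> g" using \<theta> by (auto simp: r_coset_def)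
  then show "\<theta> \<in> Cnt_r M N Mk"
    using group.is_monoid[OF Cnt_group, THEN monoid.m_closed, of i g] g Inn_Cnt_r by auto
qed

lemma chi_coset: "h \<in> carrier chi \<Longrightarrow> \<theta> \<in> h \<Longrightarrow> h = Inn M N #>\<^bsub>CntGroup\<^esub> \<theta>"
proof -
  assume h: "h \<in> carrier chi" and \<theta>: "\<theta> \<in> h"
  obtain g where g: "g \<in> Cnt_r M N Mk" "h = Inn M N #>\<^bsub>CntGroup\<^esub> g" using h by (rule chi_carrierE)
  show ?thesis
    using group.repr_independence[OF Cnt_group, of \<theta> "Inn M N" g] g \<theta> normal.axioms(1)[OF Inn_normal] by simp
qed

lemma same_class:
  assumes h: "h \<in> carrier chi" and \<theta>: "\<theta> \<in> h" "\<eta> \<in> h"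
  shows "\<exists>w\<in>unitaries N. \<forall>x\<in>M. \<eta> x = w * \<theta> x * adj w"
proof -
  have C: "\<theta> \<in> Cnt_r M N Mk" by (rule chi_sub_Cnt[OF h \<theta>(1)])
  have "\<eta> \<in> Inn M N #>\<^bsub>CntGroup\<^esub> \<theta>" using chi_coset[OF h \<theta>(1)] \<theta>(2) by simp
  then obtain i where i: "i \<in> Inn M N" "\<eta> = i \<otimes>\<^bsub>CntGroup\<^esub> \<theta>" by (auto simp: r_coset_def)
  obtain u where u: "u \<in> unitaries N" "i = (\<lambda>x\<in>M. u * x * adj u)" using Inn_mem[OF i(1)] by blast
  have iC: "i \<in> Cnt_r M N Mk" using i(1) Inn_Cnt_r by blast
  have "\<eta> x = u * \<theta> x * adj u" if x: "x \<in> M" for x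
  proof -
    have "\<theta> x \<in> M" using pair_autD(3)[OF Aut_pair_aut x] C Cnt_r_Aut by blast
    then show ?thesis unfolding i(2) CntGroup_simps mult_Cnt[OF iC C] using x by (simp add: compose_def u(2))
  qed
  then show ?thesis using u(1) by blast
qed

lemma Cnt_pair_aut: "\<theta> \<in> Cnt_r M N Mk \<Longrightarrow> pair_aut \<theta>"
  using Aut_pair_aut Cnt_r_Aut by blast

lemma intertwining_unitary_Cnt:
  assumes \<alpha>: "\<alpha> \<in> Cnt_r M N Mk" and \<rho>: "\<rho> \<in> Cnt_r M N Mk"
  defines "u \<equiv> intertwining_unitary M N Mk e \<alpha> \<rho>"
  shows "u \<in> unitaries N" "\<And>k b. b \<in> intertwiners M (Mk k) \<rho> \<Longrightarrow> tower_ext Mk e \<alpha> b = u * b"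
    "\<And>x. x \<in> M \<Longrightarrow> \<alpha> (\<rho> x) * u = u * \<rho> (\<alpha> x)"
proof -
  obtain m a where a: "a \<in> intertwiners M (Mk m) \<rho>" "a \<noteq> 0" using \<rho> by (rule Cnt_rE)
  have "\<alpha> \<in> Ker_Loi M N Mk e" using \<alpha> Cnt_r_Aut ker by blast
  note s = intertwining_unitary_spec[OF this nrm Cnt_pair_aut[OF \<rho>] a, folded u_def]
  show "u \<in> unitaries N" by (rule s(1))
  show "\<And>k b. b \<in> intertwiners M (Mk k) \<rho> \<Longrightarrow> tower_ext Mk e \<alpha> b = u * b" by (rule s(2))
  show "\<And>x. x \<in> M \<Longrightarrow> \<alpha> (\<rho> x) * u = u * \<rho> (\<alpha> x)" by (rule s(3))
qed

text \<open>The commutator of two elements of \<open>Cnt_r\<close> is the inner automorphism given by their intertwining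
  unitary.\<close>

lemma chi_comm_group: "comm_group chi"
proof (rule group.group_comm_groupI[OF chi_group])
  fix h k assume hk: "h \<in> carrier chi" "k \<in> carrier chi"
  interpret G: group CntGroup by (rule Cnt_group)
  obtain \<alpha> where \<alpha>: "\<alpha> \<in> Cnt_r M N Mk" "h = Inn M N #>\<^bsub>CntGroup\<^esub> \<alpha>" using hk(1) by (rule chi_carrierE)
  obtain \<rho> where \<rho>: "\<rho> \<in> Cnt_r M N Mk" "k = Inn M N #>\<^bsub>CntGroup\<^esub> \<rho>" using hk(2) by (rule chi_carrierE)
  define u where "u = intertwining_unitary M N Mk e \<alpha> \<rho>"
  note U = intertwining_unitary_Cnt[OF \<alpha>(1) \<rho>(1), folded u_def]
  note u = unitariesD[OF U(1)]
  define i where "i = (\<lambda>x\<in>M. u * x * adj u)"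
  have i: "i \<in> Inn M N" by (rule InnI[OF U(1)]) (simp_all add: i_def)
  have iC: "i \<in> Cnt_r M N Mk" using i Inn_Cnt_r by blast
  have c: "compose M \<alpha> \<rho> \<in> Cnt_r M N Mk" "compose M \<rho> \<alpha> \<in> Cnt_r M N Mk"
    using compose_Cnt_r \<alpha>(1) \<rho>(1) by auto
  have "compose M \<alpha> \<rho> = compose M i (compose M \<rho> \<alpha>)"
  proof
    fix x
    show "compose M \<alpha> \<rho> x = compose M i (compose M \<rho> \<alpha>) x"
    proof (cases "x \<in> M")
      case True
      have m: "\<rho> (\<alpha> x) \<in> M" using pair_autD(3)[OF Cnt_pair_aut] \<alpha>(1) \<rho>(1) True by blast
      have "\<alpha> (\<rho> x) = \<alpha> (\<rho> x) * u * adj u" using u(3) by (simp add: mult.assoc)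
      also have "\<dots> = u * \<rho> (\<alpha> x) * adj u" by (simp only: U(3)[OF True])
      finally show ?thesis using True m by (simp add: compose_def i_def)
    qed (simp add: compose_def)
  qed
  then have "\<alpha> \<otimes>\<^bsub>CntGroup\<^esub> \<rho> = i \<otimes>\<^bsub>CntGroup\<^esub> (\<rho> \<otimes>\<^bsub>CntGroup\<^esub> \<alpha>)"
    using mult_Cnt[OF \<alpha>(1) \<rho>(1)] mult_Cnt[OF \<rho>(1) \<alpha>(1)] mult_Cnt[OF iC c(2)] by simp
  then have "\<alpha> \<otimes>\<^bsub>CntGroup\<^esub> \<rho> \<in> Inn M N #>\<^bsub>CntGroup\<^esub> (\<rho> \<otimes>\<^bsub>CntGroup\<^esub> \<alpha>)"
    using i by (auto simp: r_coset_def)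
  moreover have "\<rho> \<otimes>\<^bsub>CntGroup\<^esub> \<alpha> \<in> carrier CntGroup" using \<alpha>(1) \<rho>(1) by (intro G.m_closed) simp_all
  ultimately have "Inn M N #>\<^bsub>CntGroup\<^esub> (\<rho> \<otimes>\<^bsub>CntGroup\<^esub> \<alpha>) = Inn M N #>\<^bsub>CntGroup\<^esub> (\<alpha> \<otimes>\<^bsub>CntGroup\<^esub> \<rho>)"
    by (rule G.repr_independence) (rule normal.axioms(1)[OF Inn_normal])
  then show "h \<otimes>\<^bsub>chi\<^esub> k = k \<otimes>\<^bsub>chi\<^esub> h"
    unfolding mult_chi \<alpha>(2) \<rho>(2) using \<alpha>(1) \<rho>(1) by (simp add: normal.rcos_sum[OF Inn_normal] del: CntGroup_simps(2))
qed

lemma liftingD: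
  assumes "lifting M N Mk e \<sigma>" and h: "h \<in> carrier chi"
  shows "\<sigma> h \<in> h" "\<sigma> h \<in> Cnt_r M N Mk"
    "k \<in> carrier chi \<Longrightarrow> x \<in> M \<Longrightarrow> \<sigma> (h \<otimes>\<^bsub>chi\<^esub> k) x = \<sigma> h (\<sigma> k x)"
proof -
  have l: "\<sigma> \<in> hom chi (AutGroup M N)" "\<And>h. h \<in> carrier chi \<Longrightarrow> \<sigma> h \<in> h"
    using assms(1) by (auto simp: lifting_def)
  show "\<sigma> h \<in> h" by (rule l(2)[OF h])
  have C: "\<sigma> h \<in> Cnt_r M N Mk" if "h \<in> carrier chi" for h by (rule chi_sub_Cnt[OF that l(2)[OF that]])
  show "\<sigma> h \<in> Cnt_r M N Mk" by (rule C[OF h])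
  assume k: "k \<in> carrier chi" and x: "x \<in> M"
  have "\<sigma> (h \<otimes>\<^bsub>chi\<^esub> k) = \<sigma> h \<otimes>\<^bsub>BijGroup M\<^esub> \<sigma> k"
    using hom_mult[OF l(1) h k] by (simp add: AutGroup_def)
  also have "\<dots> = compose M (\<sigma> h) (\<sigma> k)" by (rule mult_Cnt[OF C[OF h] C[OF k]])
  finally show "\<sigma> (h \<otimes>\<^bsub>chi\<^esub> k) x = \<sigma> h (\<sigma> k x)" using x by (simp add: compose_def)
qed

text \<open>The right-hand side defines an extension of \<open>\<eta>\<close> that fixes the Jones projections, as these commute
  with \<open>N\<close>.\<close>

lemma tower_ext_Ad:
  assumes \<theta>: "pair_aut \<theta>" and \<eta>: "pair_aut \<eta>" and w: "w \<in> unitaries N"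
    and eq: "\<And>x. x \<in> M \<Longrightarrow> \<eta> x = w * \<theta> x * adj w" and y: "y \<in> Mk k"
  shows "tower_ext Mk e \<eta> y = w * tower_ext Mk e \<theta> y * adj w"
proof -
  let ?A = "tower_ext Mk e \<theta>"
  define \<phi> where "\<phi> = restrict (\<lambda>y. w * ?A y * adj w) (\<Union>k. Mk k)"
  note w' = unitariesD[OF w]
  have wk: "w \<in> Mk k" for k using w'(1) N_sub_M M_Mk by blast
  have "tower_spec \<eta> \<phi>" unfolding tower_spec_def
  proof (intro conjI allI ballI)
    show "\<phi> \<in> extensional (\<Union>k. Mk k)" by (simp add: \<phi>_def)
    show "star_iso (Mk k) (Mk k) \<phi>" for k
    proof (rule star_iso_cong[OF star_iso_comp[OF tower_extD(1)[OF \<theta>]] Mk_vN])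
      have uu: "adj w * (w * x * adj w) * w = x" "w * (adj w * x * w) * adj w = x" for x
      proof -
        have "adj w * (w * x * adj w) * w = (adj w * w) * x * (adj w * w)"
          "w * (adj w * x * w) * adj w = (w * adj w) * x * (w * adj w)" by (simp_all only: mult.assoc)
        then show "adj w * (w * x * adj w) * w = x" "w * (adj w * x * w) * adj w = x" using w' by simp_all
      qed
      have bij: "bij_betw (\<lambda>x. w * x * adj w) (Mk k) (Mk k)"
        by (rule bij_betw_byWitness[where f' = "\<lambda>x. adj w * x * w"])
           (use uu wk[of k] Mk_closed(1,2)[of _ k] in auto)
      have "w * (x * y) * adj w = (w * x * adj w) * (w * y * adj w)" for x y
      proof -
        have "(w * x * adj w) * (w * y * adj w) = w * x * (adj w * w) * y * adj w" by (simp only: mult.assoc)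
        then show ?thesis using w' by (simp add: mult.assoc)
      qed
      then show "star_iso (Mk k) (Mk k) (\<lambda>x. w * x * adj w)"
        unfolding star_iso_def using bij by (simp add: distrib_left distrib_right mult.assoc)
    qed (auto simp: \<phi>_def)
    show "\<phi> x = \<eta> x" if "x \<in> Mk 0" for x
    proof -
      have xM: "x \<in> M" using that by simp
      have "x \<in> (\<Union>k. Mk k)" using that by blast
      then show ?thesis using tower_extD(2)[OF \<theta> xM] eq[OF xM] by (simp only: \<phi>_def restrict_apply' if_True)
    qed
    fix k
    have em: "e (Suc k) \<in> Mk (Suc k)" using e_mem[of k] by simp
    have "w \<in> L k" using w'(1) L_mono[of 0 k] by auto
    from e_commute_L[OF this] have "w * e (Suc k) * adj w = e (Suc k) * (w * adj w)" by (simp only: mult.assoc[symmetric])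
    then have "w * e (Suc k) * adj w = e (Suc k)" using w' by simp
    moreover have "e (Suc k) \<in> (\<Union>k. Mk k)" using em by blast
    ultimately show "\<phi> (e (Suc k)) = e (Suc k)" using tower_extD(3)[OF \<theta>, of k] by (simp only: \<phi>_def restrict_apply' if_True)
  qed
  then have "tower_ext Mk e \<eta> = \<phi>" by (rule tower_ext_eqI[OF pair_autD(1,2)[OF \<eta>]])
  moreover have "y \<in> (\<Union>k. Mk k)" using y by blast
  ultimately show ?thesis by (simp only: \<phi>_def restrict_apply' if_True)
qed

text \<open>If \<open>a\<close> intertwines \<open>\<sigma>\<^sub>h\<close> then \<open>w\<^sub>h a\<close> intertwines \<open>\<sigma>'\<^sub>h\<close>, and \<open>\<sigma>'\<^sub>k(w\<^sub>h a) = w\<^sub>k \<sigma>\<^sub>k(w\<^sub>h) v a w\<^sub>k\<^sup>*\<close> where \<open>v\<close> is the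
  scalar for \<open>\<sigma>\<close>. If the scalar for \<open>\<sigma>'\<close> is the same, the left-hand side is \<open>v w\<^sub>h a\<close>, and moving \<open>w\<^sub>k\<^sup>*\<close> past
  \<open>a\<close> gives the symmetry.\<close>

lemma equal_kappa_symmetric:
  assumes \<sigma>: "lifting M N Mk e \<sigma>" and \<sigma>': "lifting M N Mk e \<sigma>'"
    and h: "h \<in> carrier chi" and k: "k \<in> carrier chi"
    and kap: "kappa_a M N Mk e \<sigma> h k = kappa_a M N Mk e \<sigma>' h k"
    and wh: "wh \<in> unitaries N" "\<And>x. x \<in> M \<Longrightarrow> \<sigma>' h x = wh * \<sigma> h x * adj wh"
    and wk: "wk \<in> unitaries N" "\<And>x. x \<in> M \<Longrightarrow> \<sigma>' k x = wk * \<sigma> k x * adj wk"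
  shows "wh * \<sigma> h wk = wk * \<sigma> k wh"
proof -
  note sh = liftingD[OF \<sigma> h] and sk = liftingD[OF \<sigma> k] and th = liftingD[OF \<sigma>' h] and tk = liftingD[OF \<sigma>' k]
  define v where "v = intertwining_unitary M N Mk e (\<sigma> k) (\<sigma> h)"
  have v': "intertwining_unitary M N Mk e (\<sigma>' k) (\<sigma>' h) = v"
    using arg_cong[OF kap, of adj] by (simp add: kappa_a_def v_def)
  note V = intertwining_unitary_Cnt[OF sk(2) sh(2), folded v_def]
  note V' = intertwining_unitary_Cnt[OF tk(2) th(2), unfolded v']
  note ph = Cnt_pair_aut[OF sh(2)] and pk = Cnt_pair_aut[OF sk(2)]
  have NM: "x \<in> unitaries N \<Longrightarrow> x \<in> M" for x using unitariesD(1)[of x N] N_sub_M by blast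
  have whM: "wh \<in> M" and wkM: "wk \<in> M" and vM: "v \<in> M" using NM wh(1) wk(1) V(1) by auto
  obtain c where c: "v = c *\<^sub>C 1"
  proof (rule M_central_scalar[OF vM])
    fix y assume y: "y \<in> M"
    have "y \<in> \<sigma> h ` (\<sigma> k ` M)" by (simp only: pair_autD(4)[OF pk] pair_autD(4)[OF ph] y)
    then obtain x where x: "x \<in> M" "y = \<sigma> h (\<sigma> k x)" by blast
    have "h \<otimes>\<^bsub>chi\<^esub> k = k \<otimes>\<^bsub>chi\<^esub> h" by (rule comm_groupE(4)[OF chi_comm_group h k])
    then have "\<sigma> k (\<sigma> h x) = y" using sh(3)[OF k x(1)] sk(3)[OF h x(1)] x(2) by simp
    then show "v * y = y * v" using V(3)[OF x(1)] x(2) by simp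
  qed
  have c0: "c \<noteq> 0" using c unitary_nonzero[OF V(1)] by auto
  obtain m a where a: "a \<in> intertwiners M (Mk m) (\<sigma> h)" "a \<noteq> 0" using sh(2) by (rule Cnt_rE)
  have am: "a \<in> Mk m" by (rule intertwinersD(1)[OF a(1)])
  have wam: "wh * a \<in> Mk m" by (rule Mk_closed(1)[OF M_Mk[OF whM] am])
  have "wh * a \<in> intertwiners M (Mk m) (\<sigma>' h)"
  proof -
    have "\<sigma>' h x * (wh * a) = wh * a * x" if x: "x \<in> M" for x
    proof -
      have "\<sigma>' h x * (wh * a) = wh * \<sigma> h x * (adj wh * wh) * a" by (simp only: wh(2)[OF x] mult.assoc)
      also have "\<dots> = wh * (\<sigma> h x * a)" using unitariesD(2)[OF wh(1)] by (simp add: mult.assoc)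
      also have "\<dots> = wh * a * x" by (simp only: intertwinersD(2)[OF a(1) x] mult.assoc)
      finally show ?thesis .
    qed
    then show ?thesis using wam by (simp add: intertwiners_def)
  qed
  then have "tower_ext Mk e (\<sigma>' k) (wh * a) = v * (wh * a)" by (rule V'(2))
  moreover have "tower_ext Mk e (\<sigma>' k) (wh * a) = wk * tower_ext Mk e (\<sigma> k) (wh * a) * adj wk"
    by (rule tower_ext_Ad[OF pk Cnt_pair_aut[OF tk(2)] wk wam])
  moreover have "tower_ext Mk e (\<sigma> k) (wh * a) = \<sigma> k wh * (v * a)"
    using star_isoD(5)[OF tower_extD(1)[OF pk] M_Mk[OF whM] am] tower_extD(2)[OF pk whM] V(2)[OF a(1)] by simp
  ultimately have "v * (wh * a) = wk * (\<sigma> k wh * (v * a)) * adj wk" by simp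
  then have "c *\<^sub>C (wh * a) = c *\<^sub>C (wk * (\<sigma> k wh * a) * adj wk)" by (simp add: c)
  then have 1: "wh * a = wk * (\<sigma> k wh * a) * adj wk" using c0 scaleC_cancel by blast
  have "wh * \<sigma> h wk * a = (wh * a) * wk" by (simp only: intertwinersD(2)[OF a(1) wkM] mult.assoc)
  also have "\<dots> = wk * \<sigma> k wh * a * (adj wk * wk)" by (simp only: 1) (simp only: mult.assoc)
  also have "\<dots> = wk * \<sigma> k wh * a" using unitariesD(2)[OF wk(1)] by simp
  finally have "(wh * \<sigma> h wk - wk * \<sigma> k wh) * a = 0" by (simp add: left_diff_distrib)
  then have "wh * \<sigma> h wk - wk * \<sigma> k wh = 0"
    by (rule intertwiner_cancel[OF ph a, rotated])
       (intro M_closed whM wkM pair_autD(3)[OF ph] pair_autD(3)[OF pk])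
  then show ?thesis by simp
qed

text \<open>The unitaries \<open>w\<^sub>h\<close> with \<open>\<sigma>'\<^sub>h = Ad w\<^sub>h \<sigma>\<^sub>h\<close> are multiplicative up to a cocycle \<open>c\<close>; dividing them by a function \<open>b\<close>
  that trivialises \<open>c\<close> makes them multiplicative.\<close>

lemma cocycle_perturbation:
  assumes fin: "finite (carrier chi)"
    and \<sigma>: "lifting M N Mk e \<sigma>" and \<sigma>': "lifting M N Mk e \<sigma>'"
    and kap: "\<And>h k. h \<in> carrier chi \<Longrightarrow> k \<in> carrier chi \<Longrightarrow> kappa_a M N Mk e \<sigma> h k = kappa_a M N Mk e \<sigma>' h k"
  shows "\<exists>u. \<forall>h \<in> carrier chi. u h \<in> unitaries N \<and>
           (\<forall>k \<in> carrier chi. u h * \<sigma> h (u k) = u (h \<otimes>\<^bsub>chi\<^esub> k)) \<and>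
           (\<forall>x\<in>M. \<sigma>' h x = u h * \<sigma> h x * adj (u h))"
proof -
  interpret G: comm_group chi by (rule chi_comm_group)
  have "\<exists>w. w \<in> unitaries N \<and> (\<forall>x\<in>M. \<sigma>' h x = w * \<sigma> h x * adj w)" if "h \<in> carrier chi" for h
    using same_class[OF that liftingD(1)[OF \<sigma> that] liftingD(1)[OF \<sigma>' that]] by blast
  then obtain w where w: "\<And>h. h \<in> carrier chi \<Longrightarrow> w h \<in> unitaries N"
    "\<And>h x. h \<in> carrier chi \<Longrightarrow> x \<in> M \<Longrightarrow> \<sigma>' h x = w h * \<sigma> h x * adj (w h)" by metis
  have pa: "pair_aut (\<sigma> h)" if "h \<in> carrier chi" for h by (rule Cnt_pair_aut[OF liftingD(2)[OF \<sigma> that]])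
  have wM: "w h \<in> M" if "h \<in> carrier chi" for h using unitariesD(1)[OF w(1)[OF that]] N_sub_M by blast
  have yU: "w h * \<sigma> h (w k) \<in> unitaries N" if "h \<in> carrier chi" "k \<in> carrier chi" for h k
    by (rule N_unitary_mult[OF w(1)[OF that(1)] N_unitary_aut[OF pa[OF that(1)] w(1)[OF that(2)]]])
  have "\<exists>c. w h * \<sigma> h (w k) = c *\<^sub>C w (h \<otimes>\<^bsub>chi\<^esub> k)" if hk: "h \<in> carrier chi" "k \<in> carrier chi" for h k
  proof -
    define y where "y = w h * \<sigma> h (w k)"
    define g where "g = h \<otimes>\<^bsub>chi\<^esub> k"
    have g: "g \<in> carrier chi" using hk by (simp add: g_def)
    note yu = unitariesD[OF yU[OF hk, folded y_def]] and wg = unitariesD[OF w(1)[OF g]]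
    have yM: "y \<in> M" using yu(1) N_sub_M by blast
    have eq: "w g * z * adj (w g) = y * z * adj y" if z: "z \<in> M" for z
    proof -
      have "z \<in> \<sigma> g ` M" by (simp only: pair_autD(4)[OF pa[OF g]] z)
      then obtain x where x: "x \<in> M" "z = \<sigma> g x" by blast
      have kx: "\<sigma> k x \<in> M" "\<sigma>' k x \<in> M"
        using pair_autD(3)[OF pa[OF hk(2)] x(1)] pair_autD(3)[OF Cnt_pair_aut[OF liftingD(2)[OF \<sigma>' hk(2)]] x(1)] by auto
      note p = pair_autD[OF pa[OF hk(1)]]
      have wkM: "w k \<in> M" "adj (w k) \<in> M" using wM[OF hk(2)] M_closed(2) by auto
      have "w g * z * adj (w g) = \<sigma>' g x" by (simp only: w(2)[OF g x(1)] x(2))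
      also have "\<dots> = \<sigma>' h (\<sigma>' k x)" unfolding g_def by (rule liftingD(3)[OF \<sigma>' hk x(1)])
      also have "\<dots> = w h * \<sigma> h (w k * \<sigma> k x * adj (w k)) * adj (w h)"
        by (simp only: w(2)[OF hk(1) kx(2)]) (simp only: w(2)[OF hk(2) x(1)])
      also have "\<sigma> h (w k * \<sigma> k x * adj (w k)) = \<sigma> h (w k) * \<sigma> h (\<sigma> k x) * adj (\<sigma> h (w k))"
        by (simp only: p(5)[OF M_closed(1)[OF wkM(1) kx(1)] wkM(2)] p(5)[OF wkM(1) kx(1)] p(6)[OF wkM(1)])
      also have "\<sigma> h (\<sigma> k x) = z" unfolding x(2) g_def by (rule liftingD(3)[OF \<sigma> hk x(1), symmetric])
      finally show ?thesis by (simp add: y_def mult.assoc)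
    qed
    have ywM: "adj (w g) * y \<in> M" by (rule M_closed(1)[OF M_closed(2)[OF wM[OF g]] yM])
    obtain c where c: "adj (w g) * y = c *\<^sub>C 1"
    proof (rule M_central_scalar[OF ywM])
      fix z assume z: "z \<in> M"
      have "adj (w g) * (w g * z * adj (w g)) * y = adj (w g) * (y * z * adj y) * y" by (simp only: eq[OF z])
      then have "(adj (w g) * w g) * z * (adj (w g) * y) = (adj (w g) * y) * z * (adj y * y)" by (simp only: mult.assoc)
      then show "adj (w g) * y * z = z * (adj (w g) * y)" by (simp only: wg yu mult_1_left mult_1_right)
    qed
    have "y = w g * (adj (w g) * y)" by (simp only: mult.assoc[symmetric] wg mult_1_left)
    also have "\<dots> = c *\<^sub>C w g" by (simp add: c)
    finally show ?thesis unfolding y_def g_def by blast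
  qed
  then obtain c where c: "\<And>h k. h \<in> carrier chi \<Longrightarrow> k \<in> carrier chi \<Longrightarrow> w h * \<sigma> h (w k) = c h k *\<^sub>C w (h \<otimes>\<^bsub>chi\<^esub> k)"
    by metis
  have inj: "a = b" if "a *\<^sub>C w h = b *\<^sub>C w h" "h \<in> carrier chi" for a b h
    using that unitary_nonzero[OF w(1)[OF that(2)]] scaleC_diff_left[of a b "w h"] by simp
  have c1: "cmod (c h k) = 1" if hk: "h \<in> carrier chi" "k \<in> carrier chi" for h k
  proof -
    have g: "h \<otimes>\<^bsub>chi\<^esub> k \<in> carrier chi" using hk by simp
    have "1 = adj (w h * \<sigma> h (w k)) * (w h * \<sigma> h (w k))" by (rule unitariesD(2)[OF yU[OF hk], symmetric])
    also have "\<dots> = (c h k * cnj (c h k)) *\<^sub>C (adj (w (h \<otimes>\<^bsub>chi\<^esub> k)) * w (h \<otimes>\<^bsub>chi\<^esub> k))" by (simp add: c[OF hk] del: adj_simps(1))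
    also have "\<dots> = (c h k * cnj (c h k)) *\<^sub>C 1" by (simp only: unitariesD(2)[OF w(1)[OF g]])
    finally have "(1 - c h k * cnj (c h k)) *\<^sub>C (1::'a bop) = 0" by (simp add: scaleC_diff_left)
    then have "c h k * cnj (c h k) = 1" using one_nonzero by simp
    then have "complex_of_real ((cmod (c h k))\<^sup>2) = 1" by (simp only: complex_norm_square)
    then have "(cmod (c h k))\<^sup>2 = 1" using of_real_eq_1_iff by blast
    then show ?thesis using norm_ge_zero[of "c h k"] unfolding power2_eq_1_iff by linarith
  qed
  have "\<exists>b. \<forall>h\<in>carrier chi. b h \<noteq> 0 \<and> (\<forall>k\<in>carrier chi. b h * b k = c h k * b (h \<otimes>\<^bsub>chi\<^esub> k))"
  proof (rule symmetric_cocycle_is_coboundary[OF chi_comm_group fin])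
    show "c h k \<noteq> 0" if "h \<in> carrier chi" "k \<in> carrier chi" for h k using c1[OF that] by auto
    show "c h k = c k h" if hk: "h \<in> carrier chi" "k \<in> carrier chi" for h k
    proof (rule inj)
      have "w h * \<sigma> h (w k) = w k * \<sigma> k (w h)"
        by (rule equal_kappa_symmetric[OF \<sigma> \<sigma>' hk kap[OF hk] w(1)[OF hk(1)] w(2)[OF hk(1)] w(1)[OF hk(2)] w(2)[OF hk(2)]])
      then show "c h k *\<^sub>C w (h \<otimes>\<^bsub>chi\<^esub> k) = c k h *\<^sub>C w (h \<otimes>\<^bsub>chi\<^esub> k)"
        by (simp only: c[OF hk] c[OF hk(2,1)] G.m_comm[OF hk(2,1)])
    qed (use hk in simp)
    show "c h k * c (h \<otimes>\<^bsub>chi\<^esub> k) l = c k l * c h (k \<otimes>\<^bsub>chi\<^esub> l)"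
      if hkl: "h \<in> carrier chi" "k \<in> carrier chi" "l \<in> carrier chi" for h k l
    proof (rule inj)
      have kl: "k \<otimes>\<^bsub>chi\<^esub> l \<in> carrier chi" and hk: "h \<otimes>\<^bsub>chi\<^esub> k \<in> carrier chi" using hkl by auto
      note p = pair_autD[OF pa[OF hkl(1)]]
      have sl: "\<sigma> k (w l) \<in> M" by (rule pair_autD(3)[OF pa[OF hkl(2)] wM[OF hkl(3)]])
      have "w h * \<sigma> h (w k * \<sigma> k (w l)) = (w h * \<sigma> h (w k)) * \<sigma> h (\<sigma> k (w l))"
        by (simp only: p(5)[OF wM[OF hkl(2)] sl] mult.assoc)
      also have "\<dots> = c h k *\<^sub>C (w (h \<otimes>\<^bsub>chi\<^esub> k) * \<sigma> (h \<otimes>\<^bsub>chi\<^esub> k) (w l))"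
        by (simp only: c[OF hkl(1,2)] liftingD(3)[OF \<sigma> hkl(1,2) wM[OF hkl(3)]] bop_scaleC_mult)
      also have "\<dots> = (c h k * c (h \<otimes>\<^bsub>chi\<^esub> k) l) *\<^sub>C w (h \<otimes>\<^bsub>chi\<^esub> k \<otimes>\<^bsub>chi\<^esub> l)"
        by (simp only: c[OF hk hkl(3)] scaleC_scaleC)
      finally have 1: "w h * \<sigma> h (w k * \<sigma> k (w l)) = (c h k * c (h \<otimes>\<^bsub>chi\<^esub> k) l) *\<^sub>C w (h \<otimes>\<^bsub>chi\<^esub> k \<otimes>\<^bsub>chi\<^esub> l)" .
      have "\<sigma> h (c k l *\<^sub>C w (k \<otimes>\<^bsub>chi\<^esub> l)) = c k l *\<^sub>C \<sigma> h (w (k \<otimes>\<^bsub>chi\<^esub> l))"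
        by (rule star_isoD(4)[OF p(1) wM[OF kl]])
      then have "w h * \<sigma> h (w k * \<sigma> k (w l)) = c k l *\<^sub>C (w h * \<sigma> h (w (k \<otimes>\<^bsub>chi\<^esub> l)))"
        by (simp only: c[OF hkl(2,3)] bop_scaleC_mult)
      also have "\<dots> = (c k l * c h (k \<otimes>\<^bsub>chi\<^esub> l)) *\<^sub>C w (h \<otimes>\<^bsub>chi\<^esub> k \<otimes>\<^bsub>chi\<^esub> l)"
        by (simp only: c[OF hkl(1) kl] scaleC_scaleC G.m_assoc[OF hkl])
      finally show "(c h k * c (h \<otimes>\<^bsub>chi\<^esub> k) l) *\<^sub>C w (h \<otimes>\<^bsub>chi\<^esub> k \<otimes>\<^bsub>chi\<^esub> l) =
          (c k l * c h (k \<otimes>\<^bsub>chi\<^esub> l)) *\<^sub>C w (h \<otimes>\<^bsub>chi\<^esub> k \<otimes>\<^bsub>chi\<^esub> l)" unfolding 1 .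
    qed (use hkl in simp)
  qed
  then obtain b where b: "\<And>h. h \<in> carrier chi \<Longrightarrow> b h \<noteq> 0"
    "\<And>h k. h \<in> carrier chi \<Longrightarrow> k \<in> carrier chi \<Longrightarrow> b h * b k = c h k * b (h \<otimes>\<^bsub>chi\<^esub> k)" by blast
  \<comment> \<open>The modulus of \<open>b\<close> is a homomorphism from a finite group to the positive reals.\<close>
  have bm: "cmod (b h) * cmod (b k) = cmod (b (h \<otimes>\<^bsub>chi\<^esub> k))" if hk: "h \<in> carrier chi" "k \<in> carrier chi" for h k
    using arg_cong[OF b(2)[OF hk], of cmod] c1[OF hk] by (simp add: norm_mult)
  have b1: "cmod (b \<one>\<^bsub>chi\<^esub>) = 1"
    using bm[of "\<one>\<^bsub>chi\<^esub>" "\<one>\<^bsub>chi\<^esub>"] b(1)[of "\<one>\<^bsub>chi\<^esub>"] by simp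
  have bU: "cmod (b h) = 1" if h: "h \<in> carrier chi" for h
  proof -
    have "cmod (b (h [^]\<^bsub>chi\<^esub> n)) = cmod (b h) ^ n" for n :: nat
    proof (induction n)
      case (Suc n)
      have "cmod (b (h [^]\<^bsub>chi\<^esub> Suc n)) = cmod (b (h [^]\<^bsub>chi\<^esub> n)) * cmod (b h)"
        using bm[OF G.nat_pow_closed[OF h] h, of n] by simp
      then show ?case using Suc by simp
    qed (simp add: b1)
    from this[of "order chi"] have "cmod (b h) ^ order chi = 1" using G.pow_order_eq_1[OF h] b1 by simp
    moreover have "0 < order chi" using fin by (simp add: G.order_gt_0_iff_finite)
    ultimately show ?thesis by (metis norm_ge_zero power_eq_1_iff abs_of_nonneg less_not_refl real_norm_def)
  qed
  define u where "u h = (1 / b h) *\<^sub>C w h" for h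
  show ?thesis
  proof (rule exI[of _ u], intro ballI conjI)
    fix h assume h: "h \<in> carrier chi"
    note wu = unitariesD[OF w(1)[OF h]]
    have "(1 / b h) * cnj (1 / b h) = complex_of_real ((cmod (1 / b h))\<^sup>2)" by (simp only: complex_norm_square)
    also have "\<dots> = 1" using bU[OF h] by (simp add: norm_divide)
    finally have s: "(1 / b h) * cnj (1 / b h) = 1" .
    have conj: "u h * x * adj (u h) = w h * x * adj (w h)" for x
    proof -
      have "u h * x * adj (u h) = (cnj (1 / b h) * (1 / b h)) *\<^sub>C (w h * x * adj (w h))"
        by (simp only: u_def adj_simps bop_scaleC_mult scaleC_scaleC)
      then show ?thesis using s by (simp only: mult.commute[of "cnj (1 / b h)"] scaleC_one)
    qed
    have "adj (u h) * u h = (cnj (1 / b h) * (1 / b h)) *\<^sub>C (adj (w h) * w h)"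
      by (simp only: u_def adj_simps bop_scaleC_mult scaleC_scaleC mult.commute)
    then have "adj (u h) * u h = 1" using s by (simp only: mult.commute[of "cnj (1 / b h)"] scaleC_one wu)
    moreover have "u h * adj (u h) = 1" using conj[of 1] wu by simp
    moreover have "u h \<in> N" unfolding u_def using vN_closed(4)[OF L_vN[of 0] , of "w h"] wu(1) by simp
    ultimately show "u h \<in> unitaries N" by (simp add: unitaries_def)
    show "\<sigma>' h x = u h * \<sigma> h x * adj (u h)" if "x \<in> M" for x unfolding conj by (rule w(2)[OF h that])
    fix k assume k: "k \<in> carrier chi"
    have hk: "h \<otimes>\<^bsub>chi\<^esub> k \<in> carrier chi" using h k by simp
    have "\<sigma> h (u k) = (1 / b k) *\<^sub>C \<sigma> h (w k)"
      unfolding u_def by (rule star_isoD(4)[OF pair_autD(1)[OF pa[OF h]] wM[OF k]])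
    then have "u h * \<sigma> h (u k) = ((1 / b h) * (1 / b k)) *\<^sub>C (w h * \<sigma> h (w k))"
      unfolding u_def by (simp add: mult.commute)
    also have "\<dots> = (c h k / (b h * b k)) *\<^sub>C w (h \<otimes>\<^bsub>chi\<^esub> k)" by (simp add: c[OF h k])
    also have "c h k / (b h * b k) = 1 / b (h \<otimes>\<^bsub>chi\<^esub> k)"
      using b(1)[OF hk] c1[OF h k] by (auto simp: b(2)[OF h k])
    finally show "u h * \<sigma> h (u k) = u (h \<otimes>\<^bsub>chi\<^esub> k)" by (simp only: u_def)
  qed
qed

end

theorem propositionA1:
  fixes N M :: "'h::chilbert_space bop set"
    and Mk :: "nat \<Rightarrow> 'h bop set" and e :: "nat \<Rightarrow> 'h bop"
    and \<sigma> \<sigma>' :: "('h bop \<Rightarrow> 'h bop) set \<Rightarrow> 'h bop \<Rightarrow> 'h bop"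
  assumes "subfactor_II1 N M" and "finite_index N M" and "jones_tower N M Mk e"
    and A1: "extremal N M"
    and A2: "trivial_normalizer N M" "trivial_normalizer M (Mk 1)"
    and A3: "Ker_Loi M N Mk e = Aut M N"
    and A4: "finite (carrier (chi_a M N Mk e))"
    and A5: "\<exists>\<rho>. lifting M N Mk e \<rho>"
    and "lifting M N Mk e \<sigma>" and "lifting M N Mk e \<sigma>'"
    and "\<forall>h \<in> carrier (chi_a M N Mk e). \<forall>k \<in> carrier (chi_a M N Mk e).
           kappa_a M N Mk e \<sigma> h k = kappa_a M N Mk e \<sigma>' h k"
  shows "\<exists>u. \<forall>h \<in> carrier (chi_a M N Mk e).
           u h \<in> unitaries N \<and>
           (\<forall>k \<in> carrier (chi_a M N Mk e).
              u h * \<sigma> h (u k) = u (h \<otimes>\<^bsub>chi_a M N Mk e\<^esub> k)) \<and>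
           (\<forall>x\<in>M. \<sigma>' h x = u h * \<sigma> h x * adj (u h))"
proof -
  interpret chi_setting N M Mk e
    by unfold_locales (fact assms)+
  show ?thesis
    by (rule cocycle_perturbation) (use assms in auto)
qed

end
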